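(* Let $0 \leq \alpha < 1$ and $\theta > -\alpha$. Suppose that $X$ and $Y$ are random variables that take values in $\Delta_\infty^\downarrow$. Then the following two statements (about the joint law of $(X,Y)$) are equivalent: (1) $X \sim \mathrm{PD}(\alpha, \theta)$ and, conditional on $X$, $Y \sim \mathrm{Frag}_\alpha(X)$. (2) $Y \sim \mathrm{PD}(\alpha, \theta+1)$ and, conditional on $Y$, $X \sim \mathrm{Coag}_{\alpha,\theta}(Y)$.
   Context: Let $\Delta_\infty^\downarrow = \{ x = (x_1, x_2, \ldots) : x_1 \geq x_2 \geq \cdots > 0, \ \sum_{i=1}^\infty x_i = 1 \}$. A superscript $\downarrow$ on a sequence means that the sequence is put into decreasing order. Poisson--Dirichlet distribution: for $0 \leq \alpha < 1$ and $\theta > -\alpha$, let $B_1, B_2, \ldots$ be independent with $B_n \sim \mathrm{Beta}(1-\alpha, \theta + n\alpha)$. Let $\tilde X_1 = B_1$ and $\tilde X_n = (1-B_1)\cdots(1-B_{n-1})B_n$ for $n \geq 2$. Let $X_1 \geq X_2 \geq \cdots$ be the ranked values of the $\tilde X_n$. Then $\mathrm{PD}(\alpha,\theta)$ is the law of $(X_1, X_2, \ldots)$. Fragmentation operator: $\mathrm{Frag}_\alpha : \Delta_\infty^\downarrow \to \Delta_\infty^\downarrow$ is the random operator defined as follows. For $x \in \Delta_\infty^\downarrow$, let $I$ be a random index with $\mathbb{P}(I=i) = x_i$, $i \geq 1$, and let $\eta = (\eta_1,\eta_2,\ldots) \sim \mathrm{PD}(\alpha, 1-\alpha)$ be independent of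 $I$. Then $\mathrm{Frag}_\alpha(x) = (x_1, \ldots, x_{I-1}, x_I\eta_1, x_I\eta_2, \ldots, x_{I+1}, x_{I+2}, \ldots)^\downarrow$, i.e. the decreasing rearrangement of the collection consisting of all $x_j$ with $j \neq I$ and all $x_I \eta_k$, $k \geq 1$. Coagulation operator: $\mathrm{Coag}_{\alpha,\theta} : \Delta_\infty^\downarrow \to \Delta_\infty^\downarrow$ is the random operator defined as follows. If $\alpha > 0$, let $B \sim \mathrm{Beta}((1-\alpha)/\alpha, (\theta+\alpha)/\alpha)$; if $\alpha = 0$, let $B = 1/(\theta+1)$. Let $I_1, I_2, \ldots$ be $\{0,1\}$-valued random variables which, given $B$, are i.i.d. $\mathrm{Bernoulli}(B)$. Then $\mathrm{Coag}_{\alpha,\theta}(x) = \left( \sum_{i : I_i = 1} x_i, \ (x_j : I_j = 0) \right)^\downarrow$. "Conditional on $X$, $Y \sim \mathrm{Frag}_\alpha(X)$" means that the regular conditional law of $Y$ given $X = x$ is the law of $\mathrm{Frag}_\alpha(x)$ (the randomness in the operator being independent of $X$); similarly for $\mathrm{Coag}_{\alpha,\theta}$. *)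

theory Defs
  imports "HOL-Probability.Probability"
begin

text \<open>
  All sequences are indexed from 0: the value at \<open>n\<close> is the mathematical entry with
  index \<open>n + 1\<close>.
\<close>

definition ranked_simplex :: "(nat \<Rightarrow> real) set" where
  "ranked_simplex = {x. decseq x \<and> (\<forall>i. x i > 0) \<and> x sums 1}"

definition seq_space :: "(nat \<Rightarrow> real) measure" where
  "seq_space = PiM UNIV (\<lambda>_. borel)"

definition ranked_simplex_space :: "(nat \<Rightarrow> real) measure" where
  "ranked_simplex_space = restrict_space seq_space ranked_simplex"

text \<open>
  The collection to be ranked is a family \<open>f\<close> over the index set \<open>A\<close>, so that equal values
  are kept with their multiplicity.  If the family has no rearrangement into a decreasing
  sequence, all the predicates below are constantly false, and the value is one
  fixed unspecified sequence.  For the laws defined below this happens with probability 0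
  (for instance when only finitely many blocks remain after a coagulation).
\<close>

definition is_decreasing_rearrangement ::
    "'i set \<Rightarrow> ('i \<Rightarrow> real) \<Rightarrow> (nat \<Rightarrow> real) \<Rightarrow> bool" where
  "is_decreasing_rearrangement A f y \<longleftrightarrow>
     decseq y \<and> (\<exists>\<pi>. bij_betw \<pi> (UNIV :: nat set) A \<and> y = f \<circ> \<pi>)"

definition decreasing_rearrangement :: "'i set \<Rightarrow> ('i \<Rightarrow> real) \<Rightarrow> nat \<Rightarrow> real" where
  "decreasing_rearrangement A f = (THE y. is_decreasing_rearrangement A f y)"

lemma is_decreasing_rearrangement_le:
  assumes "is_decreasing_rearrangement A f y" "is_decreasing_rearrangement A f z"
  shows "z n \<le> y n"
proof -
  obtain p q where p: "bij_betw p UNIV A" "y = f \<circ> p" and q: "bij_betw q UNIV A" "z = f \<circ> q"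
    and dec: "decseq y" "decseq z"
    using assms unfolding is_decreasing_rearrangement_def by blast
  define s where "s = inv_into UNIV p \<circ> q"
  have s: "bij_betw s UNIV UNIV"
    unfolding s_def using q(1) bij_betw_inv_into[OF p(1)] by (rule bij_betw_trans)
  have z: "z k = y (s k)" for k
    using p q by (simp add: s_def bij_betw_inv_into_right[OF p(1)] bij_betw_apply)
  have "\<exists>k\<le>n. n \<le> s k"
  proof (rule ccontr)
    assume "\<not> ?thesis"
    then have "s ` {..n} \<subseteq> {..<n}"
      by auto
    moreover have "card (s ` {..n}) = Suc n"
      using s by (subst card_image) (auto simp: bij_betw_def inj_on_def)
    ultimately show False
      using card_mono[of "{..<n}" "s ` {..n}"] by simp
  qed
  then obtain k where "k \<le> n" "n \<le> s k"
    by blast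
  then show ?thesis
    using decseqD[OF dec(2), of k n] decseqD[OF dec(1), of n "s k"] z[of k] by simp
qed

lemma decreasing_rearrangement_eqI:
  assumes "is_decreasing_rearrangement A f y"
  shows "decreasing_rearrangement A f = y"
  unfolding decreasing_rearrangement_def
  using assms is_decreasing_rearrangement_le
  by (intro the_equality) (auto intro!: antisym ext)

definition beta_density :: "real \<Rightarrow> real \<Rightarrow> real \<Rightarrow> real" where
  "beta_density a b t =
     (if 0 < t \<and> t < 1 then t powr (a - 1) * (1 - t) powr (b - 1) / Beta a b else 0)"

definition beta_law :: "real \<Rightarrow> real \<Rightarrow> real measure" where
  "beta_law a b = density lborel (\<lambda>t. ennreal (beta_density a b t))"

definition stick_breaking :: "(nat \<Rightarrow> real) \<Rightarrow> nat \<Rightarrow> real" where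
  "stick_breaking b n = (\<Prod>i<n. 1 - b i) * b n"

definition PD :: "real \<Rightarrow> real \<Rightarrow> (nat \<Rightarrow> real) measure" where
  "PD \<alpha> \<theta> =
     distr (PiM UNIV (\<lambda>n. beta_law (1 - \<alpha>) (\<theta> + real (Suc n) * \<alpha>))) seq_space
       (\<lambda>b. decreasing_rearrangement UNIV (stick_breaking b))"

text \<open>
  The random operators are represented by the laws of their values.  In \<open>frag_map\<close>,
  \<open>Inl j\<close> indexes the entry \<open>x j\<close> and \<open>Inr k\<close> the fragment \<open>x i * \<eta> k\<close>; in \<open>coag_map\<close>,
  \<open>None\<close> indexes the merged block and \<open>Some j\<close> the entry \<open>x j\<close>.
\<close>

definition frag_map :: "(nat \<Rightarrow> real) \<Rightarrow> nat \<Rightarrow> (nat \<Rightarrow> real) \<Rightarrow> nat \<Rightarrow> real" where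
  "frag_map x i \<eta> =
     decreasing_rearrangement (Inl ` {j. j \<noteq> i} \<union> range Inr) (case_sum x (\<lambda>k. x i * \<eta> k))"

definition Frag_law :: "real \<Rightarrow> (nat \<Rightarrow> real) \<Rightarrow> (nat \<Rightarrow> real) measure" where
  "Frag_law \<alpha> x =
     distr (measure_pmf (embed_pmf x) \<Otimes>\<^sub>M PD \<alpha> (1 - \<alpha>)) seq_space (\<lambda>(i, \<eta>). frag_map x i \<eta>)"

definition coag_map :: "(nat \<Rightarrow> real) \<Rightarrow> (nat \<Rightarrow> bool) \<Rightarrow> nat \<Rightarrow> real" where
  "coag_map x I =
     decreasing_rearrangement (insert None (Some ` {j. \<not> I j}))
       (case_option (\<Sum>\<^sub>\<infinity>i\<in>{i. I i}. x i) x)"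

definition coag_parameter_law :: "real \<Rightarrow> real \<Rightarrow> real measure" where
  "coag_parameter_law \<alpha> \<theta> =
     (if \<alpha> = 0 then return borel (1 / (\<theta> + 1)) else beta_law ((1 - \<alpha>) / \<alpha>) ((\<theta> + \<alpha>) / \<alpha>))"

definition Coag_law :: "real \<Rightarrow> real \<Rightarrow> (nat \<Rightarrow> real) \<Rightarrow> (nat \<Rightarrow> real) measure" where
  "Coag_law \<alpha> \<theta> x =
     coag_parameter_law \<alpha> \<theta> \<bind>
       (\<lambda>b. distr (PiM UNIV (\<lambda>_::nat. measure_pmf (bernoulli_pmf b))) seq_space (coag_map x))"

text \<open>
  \<open>K\<close> is a regular conditional law of the \<open>T\<close>-valued \<open>Y\<close> given the \<open>S\<close>-valued \<open>X\<close>: it is a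
  probability kernel, and \<open>K (X \<omega>) B\<close> is a version of \<open>P (Y \<in> B | X)\<close> for each \<open>B\<close>.
\<close>

definition regular_conditional_law ::
    "'a measure \<Rightarrow> 'b measure \<Rightarrow> ('a \<Rightarrow> 'b) \<Rightarrow> 'c measure \<Rightarrow> ('a \<Rightarrow> 'c) \<Rightarrow> ('b \<Rightarrow> 'c measure) \<Rightarrow> bool"
  where
  "regular_conditional_law M S X T Y K \<longleftrightarrow>
     K \<in> S \<rightarrow>\<^sub>M prob_algebra T \<and>
     (\<forall>B\<in>sets T. AE \<omega> in M. measure (K (X \<omega>)) B =
        real_cond_exp M (vimage_algebra (space M) X S) (indicator (Y -` B \<inter> space M)) \<omega>)"

end

theory Submission
  imports Defs
begin

text \<open>
  The equivalence says that two descriptions define the same joint law of \<open>(X, Y)\<close>: a marginal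
  together with a conditional law is the same as a joint law (\<open>conditional_law_iff_joint_law\<close>).  So the
  task is to show that \<open>PD \<alpha> \<theta>\<close> followed by fragmentation and \<open>PD \<alpha> (\<theta> + 1)\<close> followed by
  coagulation give the same law on pairs (\<open>PD_Frag_law_eq_PD_Coag_law\<close>).  Both are described by a
  collection of sticks, some of which are marked, where \<open>Y\<close> ranks all sticks and \<open>X\<close> ranks the sticks
  after the marked ones have been merged.

  \<^item> Fragmentation.  In stick-breaking order the first stick is a size-biased pick
    (\<open>GEM_size_biased\<close>), so the fragmented block may be taken to be the first stick, of length
    \<open>W\<close> with law \<open>beta_law (1 - \<alpha>) (\<theta> + \<alpha>)\<close>.  Marking its fragments gives \<open>split_law \<alpha> a b\<close> with
    \<open>a = 1 - \<alpha>\<close> and \<open>b = \<theta> + \<alpha>\<close>: a marked part of length \<open>W\<close> broken with parameter \<open>a\<close> and an unmarked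
    part of length \<open>1 - W\<close> broken with parameter \<open>b\<close>.

  \<^item> Coagulation.  Here the sticks have parameter \<open>a + b = \<theta> + 1\<close> and are marked independently with a
    random success probability, which gives \<open>mark_law \<alpha> a b\<close>.

  The two laws of marked sticks agree up to the order of the sticks.  Both satisfy one recursion
  (\<open>stick_recursive\<close>): a stick with law \<open>beta_law (1 - \<alpha>) (a + b + \<alpha>)\<close> appears, it is marked with
  probability \<open>a / (a + b)\<close>, and \<open>a\<close> or \<open>b\<close> increases by \<open>\<alpha>\<close> according to the mark, as in a Polya urn.
  For \<open>mark_law\<close> this is the conjugacy of beta and Bernoulli laws, for \<open>split_law\<close> a beta identity
  (\<open>nn_integral_beta_split\<close>) applied to a stick exposed in the marked or in the unmarked part.  Iterating
  the recursion couples the first \<open>n\<close> sticks, and the expected length they leave over tends to 0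
  (\<open>mean_residual_tendsto_0\<close>).  Hence the laws agree on order-free functionals that are Lipschitz in the
  remaining length (\<open>stick_recursive_unique\<close>), and smoothed counts of large blocks provide enough of
  these to determine the law of the ranked sequences (\<open>split_law_eq_mark_law\<close>).

  The size-biased property follows from the same kind of recursion.  For two sticks it is the symmetry of
  a Dirichlet density, and an induction over truncated sums extends it to all of them, again with an error
  bounded by the expected length left over.
\<close>

section \<open>Ranking countable families\<close>

text \<open>
  The rearrangement depends only on the multiset of values, so relabelling the index set leaves
  it unchanged.  Every passage between differently indexed descriptions of the same blocks is an
  instance of this.
\<close>

lemma is_decreasing_rearrangement_reindex:
  assumes s: "bij_betw s A A'"
  shows "is_decreasing_rearrangement A (f \<circ> s) y \<longleftrightarrow> is_decreasing_rearrangement A' f y"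
proof
  assume "is_decreasing_rearrangement A (f \<circ> s) y"
  then obtain p where "decseq y" "bij_betw p UNIV A" "y = f \<circ> (s \<circ> p)"
    unfolding is_decreasing_rearrangement_def by (auto simp: comp_assoc)
  then show "is_decreasing_rearrangement A' f y"
    unfolding is_decreasing_rearrangement_def using bij_betw_trans[OF _ s] by blast
next
  assume "is_decreasing_rearrangement A' f y"
  then obtain p where p: "decseq y" "bij_betw p UNIV A'" "y = f \<circ> p"
    unfolding is_decreasing_rearrangement_def by auto
  have "bij_betw (inv_into A s \<circ> p) UNIV A"
    using p(2) bij_betw_inv_into[OF s] by (rule bij_betw_trans)
  moreover have "y = (f \<circ> s) \<circ> (inv_into A s \<circ> p)"
    using p s by (auto simp: fun_eq_iff bij_betw_inv_into_right bij_betw_apply)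
  ultimately show "is_decreasing_rearrangement A (f \<circ> s) y"
    unfolding is_decreasing_rearrangement_def using p(1) by blast
qed

lemma decreasing_rearrangement_reindex:
  assumes "bij_betw s A A'" "\<And>i. i \<in> A \<Longrightarrow> g i = f (s i)"
  shows "decreasing_rearrangement A g = decreasing_rearrangement A' f"
proof -
  have "is_decreasing_rearrangement A g y \<longleftrightarrow> is_decreasing_rearrangement A (f \<circ> s) y" for y
  proof -
    have "g \<circ> p = f \<circ> s \<circ> p" if "bij_betw p UNIV A" for p :: "nat \<Rightarrow> _"
      using assms(2) that by (auto simp: fun_eq_iff bij_betw_apply)
    then show ?thesis
      unfolding is_decreasing_rearrangement_def by metis
  qed
  then have "is_decreasing_rearrangement A g = is_decreasing_rearrangement A' f"
    by (intro ext) (simp add: is_decreasing_rearrangement_reindex[OF assms(1)])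
  then show ?thesis
    unfolding decreasing_rearrangement_def by simp
qed

text \<open>
  The \<open>k\<close>-th largest value (counted from 0) exceeds \<open>t\<close> as soon as more than \<open>k\<close> members of the
  family do.  This turns statements about ranked entries into statements about counts, which are
  visibly measurable in the family.
\<close>

lemma less_decreasing_rearrangement_iff:
  assumes "is_decreasing_rearrangement A f y"
  shows "t < y k \<longleftrightarrow> (\<exists>S\<subseteq>A. finite S \<and> card S = Suc k \<and> (\<forall>i\<in>S. t < f i))"
proof -
  obtain p where p: "decseq y" "bij_betw p UNIV A" "y = f \<circ> p"
    using assms unfolding is_decreasing_rearrangement_def by auto
  show ?thesis
  proof
    assume t: "t < y k"
    have "t < f i" if i: "i \<in> p ` {..k}" for i
    proof -
      obtain j where "i = p j" "j \<le> k" using i by auto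
      then show ?thesis using t decseqD[OF p(1) \<open>j \<le> k\<close>] p(3) by simp
    qed
    moreover have "card (p ` {..k}) = Suc k"
      using p(2) by (subst card_image) (auto simp: bij_betw_def inj_on_def)
    ultimately show "\<exists>S\<subseteq>A. finite S \<and> card S = Suc k \<and> (\<forall>i\<in>S. t < f i)"
      using p(2) by (intro exI[of _ "p ` {..k}"]) (auto simp: bij_betw_def)
  next
    assume "\<exists>S\<subseteq>A. finite S \<and> card S = Suc k \<and> (\<forall>i\<in>S. t < f i)"
    then obtain S where S: "S \<subseteq> A" "finite S" "card S = Suc k" "\<And>i. i \<in> S \<Longrightarrow> t < f i" by auto
    define T where "T = p -` S"
    have T: "S = p ` T"
      using S(1) p(2) unfolding T_def bij_betw_def by auto
    have "card T = Suc k"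
      using S(3) p(2) unfolding T by (subst (asm) card_image) (auto simp: bij_betw_def inj_on_def)
    then have "\<not> T \<subseteq> {..<k}"
      using card_mono[of "{..<k}" T] by auto
    then obtain n where "n \<in> T" "k \<le> n" by (meson lessThan_iff not_le subsetI)
    then have "t < f (p n)" using S(4) T by auto
    also have "\<dots> \<le> y k" using decseqD[OF p(1) \<open>k \<le> n\<close>] p(3) by simp
    finally show "t < y k" .
  qed
qed

text \<open>
  Order the indices by decreasing value and break ties by the index itself.  Every index then has
  finitely many predecessors, and the number of predecessors is the position of the index.
\<close>

lemma ex_decreasing_rearrangement_nat:
  fixes g :: "nat \<Rightarrow> real"
  assumes fin: "\<And>i. finite {j. g i < g j}"
  shows "\<exists>y. is_decreasing_rearrangement UNIV g y"
proof -
  define P where "P i = {j. g i < g j \<or> (g j = g i \<and> j < i)}" for i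
  define r where "r i = card (P i)" for i
  have finP: "finite (P i)" for i
    by (rule finite_subset[of _ "{j. g i < g j} \<union> {..<i}"]) (auto simp: P_def fin)
  have mono: "r j < r i" if "j \<in> P i" for i j
    unfolding r_def by (intro psubset_card_mono finP) (use that in \<open>auto simp: P_def\<close>)
  have total: "i \<in> P j \<or> j \<in> P i" if "i \<noteq> j" for i j
    using that by (auto simp: P_def)
  have inj: "inj r"
  proof (rule injI, rule ccontr)
    fix i j assume "r i = r j" "i \<noteq> j"
    then show False using total[of i j] mono[of i j] mono[of j i] by auto
  qed
  have "surj r"
  proof -
    have "\<exists>i. n = r i" for n
    proof -
      have "infinite (range r)"
        using inj by (simp add: finite_image_iff)
      then have "\<exists>k>n. k \<in> range r"
        unfolding infinite_nat_iff_unbounded by (rule spec)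
      then obtain i where i: "n < r i"
        by blast
      \<comment> \<open>Distinct predecessors of \<open>i\<close> have distinct ranks below \<open>r i\<close>, and there are \<open>r i\<close> of them.\<close>
      have "r ` P i = {..<r i}"
      proof (rule card_subset_eq)
        show "card (r ` P i) = card {..<r i}"
          using card_image[OF inj_on_subset[OF inj], of "P i"] by (simp add: r_def[of i])
      qed (auto intro: mono)
      then show ?thesis using i by (metis imageE lessThan_iff)
    qed
    then show ?thesis unfolding surj_def by blast
  qed
  then have bij: "bij r" using inj by (simp add: bij_def)
  have "decseq (g \<circ> inv r)"
  proof (rule decseq_SucI, rule ccontr)
    fix n assume "\<not> (g \<circ> inv r) (Suc n) \<le> (g \<circ> inv r) n"
    then have "inv r (Suc n) \<in> P (inv r n)" by (auto simp: P_def)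
    from mono[OF this] show False
      using \<open>surj r\<close> by (simp add: surj_f_inv_f)
  qed
  then show ?thesis
    unfolding is_decreasing_rearrangement_def using bij_imp_bij_inv[OF bij] by blast
qed

text \<open>
  In a ranking every index is preceded by all indices of larger value, so these must be finite in
  number.  The exact criterion serves measurability: the set on which a random family can be ranked
  must be described without reference to the ranking.
\<close>

lemma ex_decreasing_rearrangement_iff:
  fixes f :: "'i::countable \<Rightarrow> real"
  shows "(\<exists>y. is_decreasing_rearrangement A f y) \<longleftrightarrow>
    infinite A \<and> (\<forall>i\<in>A. finite {j\<in>A. f i < f j})"
proof
  assume "\<exists>y. is_decreasing_rearrangement A f y"
  then obtain y p where p: "decseq y" "bij_betw p UNIV A" "y = f \<circ> p"
    unfolding is_decreasing_rearrangement_def by auto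
  have "finite {j\<in>A. f i < f j}" if i: "i \<in> A" for i
  proof -
    obtain n where n: "i = p n" using p(2) i by (auto simp: bij_betw_def)
    have "{j\<in>A. f i < f j} \<subseteq> p ` {..<n}"
    proof
      fix j assume j: "j \<in> {j\<in>A. f i < f j}"
      then obtain m where m: "j = p m" using p(2) by (auto simp: bij_betw_def)
      have "m < n"
        using decseqD[OF p(1), of n m] p(3) j n m by (cases "m < n") auto
      then show "j \<in> p ` {..<n}" using m by auto
    qed
    then show ?thesis by (rule finite_subset) auto
  qed
  moreover have "infinite A" using bij_betw_finite[OF p(2)] by simp
  ultimately show "infinite A \<and> (\<forall>i\<in>A. finite {j\<in>A. f i < f j})" by auto
next
  assume A: "infinite A \<and> (\<forall>i\<in>A. finite {j\<in>A. f i < f j})"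
  define s where "s = from_nat_into A"
  have s: "bij_betw s UNIV A"
    unfolding s_def using A by (intro bij_betw_from_nat_into) auto
  have "finite {j. (f \<circ> s) i < (f \<circ> s) j}" for i
  proof -
    have "s ` {j. (f \<circ> s) i < (f \<circ> s) j} \<subseteq> {j\<in>A. f (s i) < f j}"
      using s by (auto simp: bij_betw_apply)
    moreover have "finite {j\<in>A. f (s i) < f j}" using A s by (auto simp: bij_betw_apply)
    ultimately have "finite (s ` {j. (f \<circ> s) i < (f \<circ> s) j})" by (rule finite_subset)
    then show ?thesis
      using s by (subst (asm) finite_image_iff) (auto simp: bij_betw_def inj_on_def)
  qed
  from ex_decreasing_rearrangement_nat[OF this]
  show "\<exists>y. is_decreasing_rearrangement A f y"
    unfolding is_decreasing_rearrangement_reindex[OF s] .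
qed

lemma is_decreasing_rearrangement_positive:
  fixes f :: "'i::countable \<Rightarrow> real"
  assumes A: "infinite A" and pos: "\<And>i. i \<in> A \<Longrightarrow> 0 < f i" and summ: "f summable_on A"
  shows "is_decreasing_rearrangement A f (decreasing_rearrangement A f)"
proof -
  have "finite {j\<in>A. f i < f j}" if i: "i \<in> A" for i
  proof (rule ccontr)
    assume inf: "infinite {j\<in>A. f i < f j}" (is "infinite ?J")
    have "f summable_on ?J" using summ by (rule summable_on_subset_banach) auto
    obtain n :: nat where n: "infsum f ?J < n * f i"
      using ex_less_of_nat_mult[OF pos[OF i]] by blast
    obtain B where B: "finite B" "card B = n" "B \<subseteq> ?J"
      using infinite_arbitrarily_large[OF inf] by blast
    have "n * f i \<le> sum f B"
      using B by (intro sum_bounded_below[of B "f i" f, simplified B(2)]) auto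
    also have "\<dots> \<le> infsum f ?J"
      using \<open>f summable_on ?J\<close> B pos by (intro finite_sum_le_infsum) (auto intro: less_imp_le)
    finally show False using n by simp
  qed
  then obtain y where y: "is_decreasing_rearrangement A f y"
    using A ex_decreasing_rearrangement_iff by metis
  then show ?thesis using decreasing_rearrangement_eqI[OF y] by simp
qed

lemma space_seq_space[simp]: "space seq_space = UNIV"
  by (simp add: seq_space_def space_PiM)

lemma sets_seq_space[measurable_cong]: "sets seq_space = sets (PiM UNIV (\<lambda>_. borel))"
  by (simp add: seq_space_def)

lemma measurable_seq_space_component[measurable (raw)]: "(\<lambda>x. x i) \<in> borel_measurable seq_space"
  unfolding seq_space_def by (rule measurable_component_singleton) simp

lemma measurable_seq_space_apply[measurable_dest]:
  "f \<in> M \<rightarrow>\<^sub>M seq_space \<Longrightarrow> g \<in> N \<rightarrow>\<^sub>M M \<Longrightarrow> (\<lambda>x. f (g x) i) \<in> borel_measurable N"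
  by (rule measurable_compose[OF measurable_compose measurable_seq_space_component])

lemma measurable_seq_spaceI:
  "(\<And>i. (\<lambda>x. f x i) \<in> borel_measurable M) \<Longrightarrow> f \<in> M \<rightarrow>\<^sub>M seq_space"
  unfolding seq_space_def by (rule measurable_PiM_single') (auto simp: space_PiM)

text \<open>
  The index set is random too, since a coagulation or fragmentation step removes indices.  Off the
  set where a rearrangement exists the value is a fixed sequence, so measurability holds everywhere
  and not only up to a null set.
\<close>

lemma measurable_decreasing_rearrangement:
  fixes f :: "'a \<Rightarrow> 'i::countable \<Rightarrow> real"
  assumes f[measurable]: "\<And>i. (\<lambda>\<omega>. f \<omega> i) \<in> borel_measurable N"
    and P[measurable]: "\<And>i. Measurable.pred N (\<lambda>\<omega>. P \<omega> i)"
  shows "(\<lambda>\<omega>. decreasing_rearrangement {i. P \<omega> i} (f \<omega>)) \<in> N \<rightarrow>\<^sub>M seq_space"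
proof (rule measurable_seq_spaceI)
  fix k
  define E where "E \<omega> \<longleftrightarrow> (\<exists>y. is_decreasing_rearrangement {i. P \<omega> i} (f \<omega>) y)" for \<omega>
  have fin: "finite A \<longleftrightarrow> (\<exists>n. \<forall>i. i \<in> A \<longrightarrow> to_nat i < n)" for A :: "'i set"
  proof -
    have "finite A \<longleftrightarrow> finite (to_nat ` A)"
      by (simp add: finite_image_iff)
    also have "\<dots> \<longleftrightarrow> (\<exists>n. \<forall>i. i \<in> A \<longrightarrow> to_nat i < n)"
      by (auto simp: finite_nat_iff_bounded)
    finally show ?thesis .
  qed
  have E[measurable]: "Measurable.pred N E"
    unfolding E_def[abs_def] ex_decreasing_rearrangement_iff fin Ball_def mem_Collect_eq by measurable
  define c :: real where "c = (THE y :: nat \<Rightarrow> real. False) k"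
  have eq: "decreasing_rearrangement {i. P \<omega> i} (f \<omega>) k =
      (if E \<omega> then decreasing_rearrangement {i. P \<omega> i} (f \<omega>) k else c)" for \<omega>
  proof (cases "E \<omega>")
    case False
    then have "is_decreasing_rearrangement {i. P \<omega> i} (f \<omega>) = (\<lambda>y. False)"
      by (auto simp: E_def)
    then show ?thesis using False unfolding c_def decreasing_rearrangement_def by simp
  qed simp
  show "(\<lambda>\<omega>. decreasing_rearrangement {i. P \<omega> i} (f \<omega>) k) \<in> borel_measurable N"
  proof (rule borel_measurableI_greater)
    fix t
    have "t < decreasing_rearrangement {i. P \<omega> i} (f \<omega>) k \<longleftrightarrow>
       (if E \<omega> then \<exists>S\<in>{S. finite S \<and> card S = Suc k}. \<forall>i\<in>S. P \<omega> i \<and> t < f \<omega> i else t < c)" for \<omega>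
    proof (cases "E \<omega>")
      case True
      then obtain y where y: "is_decreasing_rearrangement {i. P \<omega> i} (f \<omega>) y" by (auto simp: E_def)
      show ?thesis
        unfolding decreasing_rearrangement_eqI[OF y]
        using True less_decreasing_rearrangement_iff[OF y, of t k] by auto
    qed (subst eq, simp)
    then have *: "{\<omega> \<in> space N. t < decreasing_rearrangement {i. P \<omega> i} (f \<omega>) k} = 
       {\<omega> \<in> space N. if E \<omega> then \<exists>S\<in>{S. finite S \<and> card S = Suc k}. \<forall>i\<in>S. P \<omega> i \<and> t < f \<omega> i else t < c}"
      by simp
    have cnt: "countable {S :: 'i set. finite S \<and> card S = Suc k}"
      by (rule countable_subset[OF _ countable_Collect_finite]) auto
    have [measurable]: "Measurable.pred N (\<lambda>\<omega>. \<exists>S\<in>{S. finite S \<and> card S = Suc k}. \<forall>i\<in>S. P \<omega> i \<and> t < f \<omega> i)"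
      by (intro measurable_pred_countable(2)[OF cnt] pred_intros_finite) auto
    show "{\<omega> \<in> space N. t < decreasing_rearrangement {i. P \<omega> i} (f \<omega>) k} \<in> sets N"
      unfolding * by measurable
  qed
qed

section \<open>Beta laws and the Dirichlet law\<close>

text \<open>
  An instance of this for a given \<open>g\<close>, declared as a rule, lets the measurability prover treat \<open>g\<close> like a
  binary operation.
\<close>

lemma measurable_split_compose:
  assumes "(\<lambda>(v, s). g v s) \<in> A \<Otimes>\<^sub>M B \<rightarrow>\<^sub>M C" "a \<in> N \<rightarrow>\<^sub>M A" "b \<in> N \<rightarrow>\<^sub>M B"
  shows "(\<lambda>x. g (a x) (b x)) \<in> N \<rightarrow>\<^sub>M C"
  using measurable_compose[OF measurable_Pair[OF assms(2,3)] assms(1)] by simp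

lemma Beta_pos_real: "0 < a \<Longrightarrow> 0 < b \<Longrightarrow> 0 < Beta a (b::real)"
  by (auto simp: Beta_def intro!: divide_pos_pos mult_pos_pos Gamma_real_pos)

lemma beta_density_nonneg: "0 < a \<Longrightarrow> 0 < b \<Longrightarrow> 0 \<le> beta_density a b t"
  by (auto simp: beta_density_def intro!: divide_nonneg_nonneg less_imp_le[OF Beta_pos_real])

lemma measurable_beta_density[measurable]: "beta_density a b \<in> borel_measurable borel"
  unfolding beta_density_def[abs_def] by measurable

lemma sets_beta_law[measurable_cong, simp]: "sets (beta_law a b) = sets borel"
  by (simp add: beta_law_def)

lemma space_beta_law[simp]: "space (beta_law a b) = UNIV"
  by (simp add: beta_law_def)

lemma nn_integral_beta_law:
  "f \<in> borel_measurable borel \<Longrightarrow>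
    (\<integral>\<^sup>+t. f t \<partial>beta_law a b) = (\<integral>\<^sup>+t. ennreal (beta_density a b t) * f t \<partial>lborel)"
  unfolding beta_law_def by (subst nn_integral_density) auto

lemma prob_space_beta_law:
  assumes "0 < a" "0 < b"
  shows "prob_space (beta_law a b)"
proof
  have "((\<lambda>t. t powr (a - 1) * (1 - t) powr (b - 1)) has_integral Beta a b) {0<..<1}"
    using has_integral_Beta_real[OF assms] by (simp add: has_integral_Icc_iff_Ioo)
  then have "((\<lambda>t. t powr (a - 1) * (1 - t) powr (b - 1) / Beta a b) has_integral Beta a b / Beta a b) {0<..<1}"
    by (rule has_integral_divide)
  then have "((\<lambda>t. if t \<in> {0<..<1} then t powr (a - 1) * (1 - t) powr (b - 1) / Beta a b else 0) has_integral 1) UNIV"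
    using Beta_pos_real[OF assms] by (subst has_integral_restrict_UNIV) simp
  then have "(beta_density a b has_integral 1) UNIV"
    by (simp add: beta_density_def[abs_def] cong: if_cong)
  then have "(\<integral>\<^sup>+t. ennreal (beta_density a b t) \<partial>lborel) = 1"
    by (subst nn_integral_has_integral_lborel[where I=1]) (auto intro: beta_density_nonneg assms)
  then show "emeasure (beta_law a b) (space (beta_law a b)) = 1"
    unfolding beta_law_def by (subst emeasure_density) auto
qed

lemma AE_beta_law: "AE t in beta_law a b. 0 < t \<and> t < 1"
  unfolding beta_law_def
  by (subst AE_density) (auto simp: beta_density_def)

lemma nn_integral_beta_law_reflect:
  assumes [measurable]: "f \<in> borel_measurable borel"
  shows "(\<integral>\<^sup>+t. f (1 - t) \<partial>beta_law a b) = (\<integral>\<^sup>+t. f t \<partial>beta_law b a)"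
proof -
  have "(\<integral>\<^sup>+t. f t \<partial>beta_law b a) = (\<integral>\<^sup>+t. ennreal (beta_density b a t) * f t \<partial>lborel)"
    by (rule nn_integral_beta_law) simp
  also have "\<dots> = (\<integral>\<^sup>+t. ennreal (beta_density b a (1 - t)) * f (1 - t) \<partial>lborel)"
    by (subst nn_integral_real_affine[where c="-1" and t=1]) auto
  also have "\<dots> = (\<integral>\<^sup>+t. ennreal (beta_density a b t) * f (1 - t) \<partial>lborel)"
    by (intro nn_integral_cong arg_cong2[where f="(*)"] arg_cong[where f=ennreal])
       (auto simp: beta_density_def Beta_commute mult.commute)
  finally show ?thesis by (simp add: nn_integral_beta_law)
qed

text \<open>
  The factor \<open>t\<close> raises the first exponent of the density by one; the ratio of the two normalising
  constants is the mean \<open>a / (a + b)\<close>.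
\<close>

lemma nn_integral_beta_law_size_biased:
  assumes ab: "0 < a" "0 < b" and [measurable]: "f \<in> borel_measurable borel"
  shows "(\<integral>\<^sup>+t. ennreal t * f t \<partial>beta_law a b) = ennreal (a / (a + b)) * (\<integral>\<^sup>+t. f t \<partial>beta_law (a + 1) b)"
proof -
  have B: "(a + b) * Beta (a + 1) b = a * Beta a b"
    using ab by (intro Beta_plus1_left) (auto elim!: nonpos_Ints_cases)
  have *: "beta_density a b t * t = a / (a + b) * beta_density (a + 1) b t" for t
  proof (cases "0 < t \<and> t < 1")
    case True
    have "t powr (a - 1) * t = t powr a"
      using True by (simp add: powr_diff)
    moreover have "1 / Beta a b = a / (a + b) / Beta (a + 1) b"
      using B Beta_pos_real[of a b] Beta_pos_real[of "a+1" b] ab by (simp add: field_simps)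
    moreover have "beta_density a b t * t = (t powr (a - 1) * t) * (1 - t) powr (b - 1) * (1 / Beta a b)"
      using True by (simp add: beta_density_def)
    ultimately have "beta_density a b t * t = t powr a * (1 - t) powr (b - 1) * (a / (a + b) / Beta (a + 1) b)"
      by metis
    then show ?thesis
      using True by (simp add: beta_density_def)
  qed (auto simp: beta_density_def)
  have **: "ennreal (beta_density a b t) * (ennreal t * f t) =
     ennreal (a / (a + b)) * (ennreal (beta_density (a + 1) b t) * f t)" for t
  proof (cases "0 < t \<and> t < 1")
    case True
    have "ennreal (beta_density a b t) * ennreal t = ennreal (a / (a + b)) * ennreal (beta_density (a + 1) b t)"
      using True ab by (simp add: ennreal_mult'[symmetric] * beta_density_nonneg)
    then show ?thesis by (simp add: mult.assoc[symmetric])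
  qed (auto simp: beta_density_def)
  have "(\<integral>\<^sup>+t. ennreal t * f t \<partial>beta_law a b) = (\<integral>\<^sup>+t. ennreal (beta_density a b t) * (ennreal t * f t) \<partial>lborel)"
    by (rule nn_integral_beta_law) simp
  also have "\<dots> = ennreal (a / (a + b)) * (\<integral>\<^sup>+t. f t \<partial>beta_law (a + 1) b)"
    unfolding ** by (subst nn_integral_cmult) (auto simp: nn_integral_beta_law)
  finally show ?thesis .
qed

lemma nn_integral_beta_law_size_biased_complement:
  assumes ab: "0 < a" "0 < b" and [measurable]: "f \<in> borel_measurable borel"
  shows "(\<integral>\<^sup>+t. ennreal (1 - t) * f t \<partial>beta_law a b) = ennreal (b / (a + b)) * (\<integral>\<^sup>+t. f t \<partial>beta_law a (b + 1))"
proof -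
  have "(\<integral>\<^sup>+t. ennreal (1 - t) * f t \<partial>beta_law a b) = (\<integral>\<^sup>+t. ennreal (1 - (1 - t)) * f (1 - t) \<partial>beta_law b a)"
    by (subst nn_integral_beta_law_reflect) auto
  also have "\<dots> = ennreal (b / (b + a)) * (\<integral>\<^sup>+t. f (1 - t) \<partial>beta_law (b + 1) a)"
    by (simp add: nn_integral_beta_law_size_biased ab)
  also have "(\<integral>\<^sup>+t. f (1 - t) \<partial>beta_law (b + 1) a) = (\<integral>\<^sup>+t. f t \<partial>beta_law a (b + 1))"
    by (rule nn_integral_beta_law_reflect) simp
  finally show ?thesis by (simp add: add.commute)
qed

text \<open>
  The Dirichlet density on the simplex \<open>v + s + (1 - v - s) = 1\<close>, in its first two coordinates.
\<close>

definition dirichlet_density :: "real \<Rightarrow> real \<Rightarrow> real \<Rightarrow> real \<Rightarrow> real \<Rightarrow> real" where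
  "dirichlet_density p q r v s =
     (if 0 < v \<and> 0 < s \<and> v + s < 1
      then v powr (p - 1) * s powr (q - 1) * (1 - v - s) powr (r - 1) *
           (Gamma (p + q + r) / (Gamma p * Gamma q * Gamma r))
      else 0)"

lemma measurable_dirichlet_density[measurable (raw)]:
  assumes [measurable]: "f \<in> borel_measurable M" "g \<in> borel_measurable M"
  shows "(\<lambda>x. dirichlet_density p q r (f x) (g x)) \<in> borel_measurable M"
  unfolding dirichlet_density_def by measurable

lemma dirichlet_density_commute: "dirichlet_density p q r v s = dirichlet_density q p r s v"
  by (simp add: dirichlet_density_def algebra_simps)

lemma dirichlet_density_nonneg:
  "0 < p \<Longrightarrow> 0 < q \<Longrightarrow> 0 < r \<Longrightarrow> 0 \<le> dirichlet_density p q r v s"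
  by (auto simp: dirichlet_density_def intro!: mult_nonneg_nonneg divide_nonneg_nonneg Gamma_real_nonneg)

text \<open>
  Breaking two sticks in a row gives a Dirichlet vector: for fixed \<open>v\<close> the second coordinate
  \<open>s = (1 - v) * w\<close> depends linearly on \<open>w\<close>, so one affine substitution in the inner integral suffices.
\<close>

lemma nn_integral_beta_stick_dirichlet:
  assumes pqr: "0 < p" "0 < q" "0 < r"
    and g: "(\<lambda>(v, s). g v s) \<in> borel_measurable (borel \<Otimes>\<^sub>M borel)"
  shows "(\<integral>\<^sup>+v. \<integral>\<^sup>+w. g v ((1 - v) * w) \<partial>beta_law q r \<partial>beta_law p (q + r)) =
    (\<integral>\<^sup>+v. \<integral>\<^sup>+s. ennreal (dirichlet_density p q r v s) * g v s \<partial>lborel \<partial>lborel)"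
proof -
  note [measurable (raw)] = measurable_split_compose[OF g]
  have "ennreal (beta_density p (q + r) v) * (\<integral>\<^sup>+w. ennreal (beta_density q r w) * g v ((1 - v) * w) \<partial>lborel) =
      (\<integral>\<^sup>+s. ennreal (dirichlet_density p q r v s) * g v s \<partial>lborel)" for v
  proof (cases "0 < v \<and> v < 1")
    case True
    have Gpos: "Gamma p > 0" "Gamma q > 0" "Gamma r > 0" "Gamma (q + r) > 0" "Gamma (p + q + r) > 0"
      using pqr by (auto intro!: Gamma_real_pos)
    have *: "(1 - v) * dirichlet_density p q r v ((1 - v) * w) = beta_density p (q + r) v * beta_density q r w" for w
    proof (cases "0 < w \<and> w < 1")
      case w: True
      have "v + (1 - v) * w < 1"
      proof -
        have "(1 - v) * w < (1 - v) * 1" using True w by (intro mult_strict_left_mono) auto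
        then show ?thesis by simp
      qed
      moreover have "1 - v - (1 - v) * w = (1 - v) * (1 - w)" by (simp add: algebra_simps)
      moreover have "(1 - v) * ((1 - v) powr (q - 1) * (1 - v) powr (r - 1)) = (1 - v) powr (q + r - 1)"
      proof -
        have "(1 - v) * ((1 - v) powr (q - 1) * (1 - v) powr (r - 1)) = (1 - v) powr 1 * ((1 - v) powr (q - 1) * (1 - v) powr (r - 1))"
          using True by simp
        also have "\<dots> = (1 - v) powr (1 + (q - 1 + (r - 1)))"
          by (simp only: powr_add)
        also have "\<dots> = (1 - v) powr (q + r - 1)" by (simp add: algebra_simps)
        finally show ?thesis .
      qed
      ultimately have "(1 - v) * dirichlet_density p q r v ((1 - v) * w) =
         v powr (p - 1) * (1 - v) powr (q + r - 1) * (w powr (q - 1) * (1 - w) powr (r - 1)) *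
           (Gamma (p + q + r) / (Gamma p * Gamma q * Gamma r))"
        using True w by (simp add: dirichlet_density_def powr_mult)
      moreover have "Gamma (p + q + r) / (Gamma p * Gamma q * Gamma r) = 1 / (Beta p (q + r) * Beta q r)"
        using Gpos by (simp add: Beta_def field_simps)
      ultimately show ?thesis
        using True w by (simp add: beta_density_def)
    next
      case False
      have "\<not> (0 < (1 - v) * w \<and> v + (1 - v) * w < 1)"
      proof
        assume a: "0 < (1 - v) * w \<and> v + (1 - v) * w < 1"
        then have "0 < w" using True by (simp add: zero_less_mult_iff)
        moreover have "w < 1"
        proof -
          have "(1 - v) * w < (1 - v) * 1" using a unfolding mult_1_right by linarith
          then show ?thesis using True by (metis diff_gt_0_iff_gt mult_less_cancel_left_pos)
        qed
        ultimately show False using False by simp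
      qed
      then show ?thesis using False by (auto simp: dirichlet_density_def beta_density_def)
    qed
    have "(\<integral>\<^sup>+s. ennreal (dirichlet_density p q r v s) * g v s \<partial>lborel) =
        ennreal (1 - v) * (\<integral>\<^sup>+w. ennreal (dirichlet_density p q r v ((1 - v) * w)) * g v ((1 - v) * w) \<partial>lborel)"
      using True by (subst nn_integral_real_affine[where c="1 - v" and t=0]) auto
    also have "\<dots> = (\<integral>\<^sup>+w. ennreal (1 - v) * (ennreal (dirichlet_density p q r v ((1 - v) * w)) * g v ((1 - v) * w)) \<partial>lborel)"
    proof -
      have "(\<lambda>w. ennreal (dirichlet_density p q r v ((1 - v) * w)) * g v ((1 - v) * w)) \<in> borel_measurable lborel"
        by measurable
      from nn_integral_cmult[OF this] show ?thesis by simp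
    qed
    also have "\<dots> = (\<integral>\<^sup>+w. ennreal (beta_density p (q + r) v) * (ennreal (beta_density q r w) * g v ((1 - v) * w)) \<partial>lborel)"
      using pqr True by (intro nn_integral_cong)
        (simp add: mult.assoc[symmetric] ennreal_mult'[symmetric] * dirichlet_density_nonneg beta_density_nonneg)
    also have "\<dots> = ennreal (beta_density p (q + r) v) * (\<integral>\<^sup>+w. (ennreal (beta_density q r w) * g v ((1 - v) * w)) \<partial>lborel)"
      by (rule nn_integral_cmult) measurable
    finally show ?thesis by simp
  next
    case False
    have "dirichlet_density p q r v s = 0" for s
      using False by (auto simp: dirichlet_density_def)
    moreover have "beta_density p (q + r) v = 0" using False by (auto simp: beta_density_def)
    ultimately show ?thesis by simp
  qed
  then show ?thesis
    by (simp add: nn_integral_beta_law)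
qed

text \<open>
  The same Dirichlet vector arises by first splitting off \<open>W\<close> and then dividing \<open>W\<close> in the proportions
  \<open>u\<close> and \<open>1 - u\<close>.  Read from the complement \<open>1 - W\<close>, this is again a two-stick construction, with
  the three parameters permuted.
\<close>

lemma nn_integral_beta_split_dirichlet:
  assumes pqr: "0 < p" "0 < q" "0 < r"
    and g: "(\<lambda>(v, s). g v s) \<in> borel_measurable (borel \<Otimes>\<^sub>M borel)"
  shows "(\<integral>\<^sup>+W. \<integral>\<^sup>+u. g (W * u) (W * (1 - u)) \<partial>beta_law p q \<partial>beta_law (p + q) r) =
    (\<integral>\<^sup>+v. \<integral>\<^sup>+s. ennreal (dirichlet_density p q r v s) * g v s \<partial>lborel \<partial>lborel)"
proof -
  note [measurable (raw)] = measurable_split_compose[OF g]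
  interpret B: prob_space "beta_law p q" by (rule prob_space_beta_law) fact+
  have r: "(1 - t) * (1 - u) = 1 - t - (1 - t) * u" for t u :: real
    by (simp add: algebra_simps)
  have "(\<integral>\<^sup>+W. \<integral>\<^sup>+u. g (W * u) (W * (1 - u)) \<partial>beta_law p q \<partial>beta_law (p + q) r) =
      (\<integral>\<^sup>+t. \<integral>\<^sup>+u. g ((1 - t) * u) ((1 - t) * (1 - u)) \<partial>beta_law p q \<partial>beta_law r (p + q))"
    by (rule nn_integral_beta_law_reflect[symmetric]) measurable
  also have "\<dots> = (\<integral>\<^sup>+t. \<integral>\<^sup>+v. ennreal (dirichlet_density r p q t v) * g v (1 - t - v) \<partial>lborel \<partial>lborel)"
    unfolding r using pqr by (intro nn_integral_beta_stick_dirichlet) auto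
  also have "\<dots> = (\<integral>\<^sup>+v. \<integral>\<^sup>+t. ennreal (dirichlet_density r p q t v) * g v (1 - t - v) \<partial>lborel \<partial>lborel)"
    by (rule lborel_pair.Fubini') measurable
  also have "\<dots> = (\<integral>\<^sup>+v. \<integral>\<^sup>+s. ennreal (dirichlet_density p q r v s) * g v s \<partial>lborel \<partial>lborel)"
  proof (rule nn_integral_cong)
    fix v :: real
    have m: "(\<lambda>t. ennreal (dirichlet_density r p q t v) * g v (1 - t - v)) \<in> borel_measurable borel"
      by measurable
    have "dirichlet_density r p q (1 - v - s) v = dirichlet_density p q r v s" for s
      by (auto simp: dirichlet_density_def algebra_simps)
    then show "(\<integral>\<^sup>+t. ennreal (dirichlet_density r p q t v) * g v (1 - t - v) \<partial>lborel) =
      (\<integral>\<^sup>+s. ennreal (dirichlet_density p q r v s) * g v s \<partial>lborel)"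
      using nn_integral_real_affine[OF m, of "-1" "1 - v"] by simp
  qed
  finally show ?thesis .
qed

text \<open>
  The size-biased symmetry of the first two sticks: with equal parameters the Dirichlet density is
  symmetric in its first two coordinates.
\<close>

lemma nn_integral_beta_stick_swap:
  assumes pr: "0 < p" "0 < r"
    and g: "(\<lambda>(v, s). g v s) \<in> borel_measurable (borel \<Otimes>\<^sub>M borel)"
  shows "(\<integral>\<^sup>+v. \<integral>\<^sup>+w. g v ((1 - v) * w) \<partial>beta_law p r \<partial>beta_law p (p + r)) =
    (\<integral>\<^sup>+v. \<integral>\<^sup>+w. g ((1 - v) * w) v \<partial>beta_law p r \<partial>beta_law p (p + r))"
proof -
  note [measurable (raw)] = measurable_split_compose[OF g]
  have "(\<integral>\<^sup>+v. \<integral>\<^sup>+w. g v ((1 - v) * w) \<partial>beta_law p r \<partial>beta_law p (p + r)) =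
    (\<integral>\<^sup>+v. \<integral>\<^sup>+s. ennreal (dirichlet_density p p r v s) * g v s \<partial>lborel \<partial>lborel)"
    using pr by (intro nn_integral_beta_stick_dirichlet) auto
  also have "\<dots> = (\<integral>\<^sup>+s. \<integral>\<^sup>+v. ennreal (dirichlet_density p p r v s) * g v s \<partial>lborel \<partial>lborel)"
    by (rule lborel_pair.Fubini'[symmetric]) measurable
  also have "\<dots> = (\<integral>\<^sup>+s. \<integral>\<^sup>+v. ennreal (dirichlet_density p p r s v) * g v s \<partial>lborel \<partial>lborel)"
    by (subst dirichlet_density_commute) rule
  also have "\<dots> = (\<integral>\<^sup>+v. \<integral>\<^sup>+w. g ((1 - v) * w) v \<partial>beta_law p r \<partial>beta_law p (p + r))"
    using pr by (intro nn_integral_beta_stick_dirichlet[symmetric]) auto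
  finally show ?thesis .
qed

text \<open>
  Both sides describe one Dirichlet vector \<open>(v, s)\<close>, the left in terms of \<open>W = v + s\<close> and the
  right in terms of \<open>v\<close> and the relative size \<open>s / (1 - v)\<close>.
\<close>

lemma nn_integral_beta_split:
  assumes pqr: "0 < p" "0 < q" "0 < r"
    and g: "(\<lambda>(v, w). g v w) \<in> borel_measurable (borel \<Otimes>\<^sub>M borel)"
  shows "(\<integral>\<^sup>+W. \<integral>\<^sup>+u. g (W * u) (W * (1 - u) / (1 - W * u)) \<partial>beta_law p q \<partial>beta_law (p + q) r) =
    (\<integral>\<^sup>+v. \<integral>\<^sup>+w. g v w \<partial>beta_law q r \<partial>beta_law p (q + r))"
proof -
  note [measurable (raw)] = measurable_split_compose[OF g]
  have "(\<integral>\<^sup>+W. \<integral>\<^sup>+u. g (W * u) (W * (1 - u) / (1 - W * u)) \<partial>beta_law p q \<partial>beta_law (p + q) r) =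
    (\<integral>\<^sup>+v. \<integral>\<^sup>+s. ennreal (dirichlet_density p q r v s) * g v (s / (1 - v)) \<partial>lborel \<partial>lborel)"
    using pqr by (intro nn_integral_beta_split_dirichlet) auto
  also have "\<dots> = (\<integral>\<^sup>+v. \<integral>\<^sup>+w. g v ((1 - v) * w / (1 - v)) \<partial>beta_law q r \<partial>beta_law p (q + r))"
    using pqr by (intro nn_integral_beta_stick_dirichlet[symmetric]) auto
  also have "\<dots> = (\<integral>\<^sup>+v. \<integral>\<^sup>+w. g v w \<partial>beta_law q r \<partial>beta_law p (q + r))"
    by (intro nn_integral_cong_AE, use AE_beta_law[of p "q+r"] in eventually_elim) auto
  finally show ?thesis .
qed

section \<open>Stick breaking\<close>

text \<open>
  The factors may differ, which is what stick breaking with \<open>\<alpha> > 0\<close> requires: removing the first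
  factor changes the parameter of the remaining product.
\<close>

lemma nn_integral_PiM_case_nat:
  fixes M :: "nat \<Rightarrow> 'a measure"
  assumes M: "\<And>i. prob_space (M i)"
    and f[measurable]: "f \<in> borel_measurable (PiM UNIV M)"
  shows "(\<integral>\<^sup>+\<omega>. f \<omega> \<partial>PiM UNIV M) =
    (\<integral>\<^sup>+x. \<integral>\<^sup>+\<omega>. f (case_nat x \<omega>) \<partial>PiM UNIV (\<lambda>n. M (Suc n)) \<partial>M 0)"
proof -
  have UN: "insert 0 (range Suc) = UNIV"
    using UNIV_nat_eq by simp
  interpret S: prob_space "PiM (range Suc) M" by (intro prob_space_PiM M)
  have upd: "(\<lambda>(x, X). X(0 := x)) \<in> M 0 \<Otimes>\<^sub>M PiM (range Suc) M \<rightarrow>\<^sub>M PiM UNIV M"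
    using UN unfolding case_prod_beta' by (intro measurable_fun_upd[where J="range Suc"]) auto
  have re: "(\<lambda>\<omega>. \<lambda>n\<in>range Suc. \<omega> (n - 1)) \<in> PiM UNIV (\<lambda>n. M (Suc n)) \<rightarrow>\<^sub>M PiM (range Suc) M"
  proof (rule measurable_restrict)
    fix n assume "n \<in> range Suc"
    then have "M (Suc (n - 1)) = M n" by auto
    then show "(\<lambda>\<omega>. \<omega> (n - 1)) \<in> PiM UNIV (\<lambda>n. M (Suc n)) \<rightarrow>\<^sub>M M n"
      using measurable_component_singleton[of "n - 1" UNIV "\<lambda>n. M (Suc n)"] by simp
  qed
  have "PiM (range Suc) (\<lambda>i. M (Suc (i - 1))) = PiM (range Suc) M"
    by (rule PiM_cong) auto
  then have reindex: "distr (PiM UNIV (\<lambda>n. M (Suc n))) (PiM (range Suc) M)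
      (\<lambda>\<omega>. \<lambda>n\<in>range Suc. \<omega> (n - 1)) = PiM (range Suc) M"
    using distr_PiM_reindex[of UNIV "\<lambda>n. M (Suc n)" "\<lambda>i. i - 1" "range Suc"] M
    by (auto simp: inj_on_def)
  have "(\<integral>\<^sup>+\<omega>. f \<omega> \<partial>PiM UNIV M) =
      (\<integral>\<^sup>+\<omega>. f \<omega> \<partial>distr (M 0 \<Otimes>\<^sub>M PiM (range Suc) M) (PiM UNIV M) (\<lambda>(x, X). X(0 := x)))"
    using distr_pair_PiM_eq_PiM[of "range Suc" M 0] M unfolding UN by simp
  also have "\<dots> = (\<integral>\<^sup>+z. f ((\<lambda>(x, X). X(0 := x)) z) \<partial>(M 0 \<Otimes>\<^sub>M PiM (range Suc) M))"
    by (rule nn_integral_distr[OF upd]) simp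
  also have "\<dots> = (\<integral>\<^sup>+x. \<integral>\<^sup>+X. f (X(0 := x)) \<partial>PiM (range Suc) M \<partial>M 0)"
    using S.nn_integral_fst[OF measurable_compose[OF upd f]] by simp
  also have "\<dots> = (\<integral>\<^sup>+x. \<integral>\<^sup>+\<omega>. f (case_nat x \<omega>) \<partial>PiM UNIV (\<lambda>n. M (Suc n)) \<partial>M 0)"
  proof (rule nn_integral_cong)
    fix x assume x: "x \<in> space (M 0)"
    have m: "(\<lambda>X. f (X(0 := x))) \<in> borel_measurable (PiM (range Suc) M)"
      using measurable_compose[OF measurable_compose[OF measurable_Pair1'[OF x] upd] f] by simp
    have "(\<lambda>n\<in>range Suc. \<omega> (n - 1))(0 := x) = case_nat x \<omega>" for \<omega> :: "nat \<Rightarrow> 'a"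
      by (auto simp: fun_eq_iff restrict_def split: nat.split)
    moreover have "(\<integral>\<^sup>+X. f (X(0 := x)) \<partial>PiM (range Suc) M) =
        (\<integral>\<^sup>+\<omega>. f ((\<lambda>n\<in>range Suc. \<omega> (n - 1))(0 := x)) \<partial>PiM UNIV (\<lambda>n. M (Suc n)))"
      by (subst reindex[symmetric]) (rule nn_integral_distr[OF re], simp add: m)
    ultimately show "(\<integral>\<^sup>+X. f (X(0 := x)) \<partial>PiM (range Suc) M) =
        (\<integral>\<^sup>+\<omega>. f (case_nat x \<omega>) \<partial>PiM UNIV (\<lambda>n. M (Suc n)))"
      by simp
  qed
  finally show ?thesis .
qed

lemma measurable_case_nat_seq_space[measurable (raw)]:
  assumes [measurable]: "f \<in> borel_measurable M" "g \<in> M \<rightarrow>\<^sub>M seq_space"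
  shows "(\<lambda>x. case_nat (f x) (g x)) \<in> M \<rightarrow>\<^sub>M seq_space"
  by (rule measurable_seq_spaceI) (auto split: nat.split)

lemma measurable_compose_perm_seq_space[measurable (raw)]:
  assumes [measurable]: "g \<in> M \<rightarrow>\<^sub>M seq_space"
  shows "(\<lambda>x. g x \<circ> p) \<in> M \<rightarrow>\<^sub>M seq_space"
  by (rule measurable_seq_spaceI) simp

text \<open>
  Put a first stick of length \<open>v\<close> in front of \<open>x\<close>, rescaled to fill the remaining length.
\<close>

definition prepend_stick :: "real \<Rightarrow> (nat \<Rightarrow> real) \<Rightarrow> nat \<Rightarrow> real" where
  "prepend_stick v x = case_nat v (\<lambda>n. (1 - v) * x n)"

lemma prepend_stick_simps[simp]:
  "prepend_stick v x 0 = v" "prepend_stick v x (Suc n) = (1 - v) * x n"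
  by (auto simp: prepend_stick_def)

lemma measurable_prepend_stick[measurable (raw)]:
  assumes [measurable]: "f \<in> borel_measurable M" "g \<in> M \<rightarrow>\<^sub>M seq_space"
  shows "(\<lambda>x. prepend_stick (f x) (g x)) \<in> M \<rightarrow>\<^sub>M seq_space"
proof (rule measurable_seq_spaceI)
  fix i show "(\<lambda>x. prepend_stick (f x) (g x) i) \<in> borel_measurable M"
    by (cases i) auto
qed

lemma prepend_stick_compose: "prepend_stick v (x \<circ> p) = prepend_stick v x \<circ> case_nat 0 (Suc \<circ> p)"
  by (auto simp: fun_eq_iff prepend_stick_def split: nat.split)

lemma bij_case_nat_Suc: "bij p \<Longrightarrow> bij (case_nat 0 (Suc \<circ> p))"
proof (rule o_bij)
  assume p: "bij p"
  show "case_nat 0 (Suc \<circ> inv p) \<circ> case_nat 0 (Suc \<circ> p) = id"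
    using p by (auto simp: fun_eq_iff bij_is_inj split: nat.split)
  show "case_nat 0 (Suc \<circ> p) \<circ> case_nat 0 (Suc \<circ> inv p) = id"
    using p by (auto simp: fun_eq_iff bij_is_surj surj_f_inv_f split: nat.split)
qed

lemma residual_prepend_stick:
  "1 - (\<Sum>i<Suc n. prepend_stick v x i) = (1 - v) * (1 - (\<Sum>i<n. x i))"
  by (simp add: sum.lessThan_Suc_shift algebra_simps sum_distrib_left del: sum.lessThan_Suc)

lemma stick_breaking_case_nat:
  "stick_breaking (case_nat v b) = prepend_stick v (stick_breaking b)"
proof
  fix n show "stick_breaking (case_nat v b) n = prepend_stick v (stick_breaking b) n"
    by (cases n) (auto simp: stick_breaking_def prod.lessThan_Suc_shift simp del: prod.lessThan_Suc)
qed

text \<open>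
  Each break keeps the proportion \<open>1 - b i\<close> of what is left.
\<close>

lemma residual_stick_breaking: "1 - (\<Sum>i<n. stick_breaking b i) = (\<Prod>i<n. 1 - b i)"
  by (induction n) (auto simp: stick_breaking_def algebra_simps)

lemma measurable_stick_breaking[measurable]: "stick_breaking \<in> seq_space \<rightarrow>\<^sub>M seq_space"
  unfolding stick_breaking_def[abs_def]
  by (rule measurable_seq_spaceI) measurable

text \<open>
  The law of the sticks in their order of appearance, the GEM (size-biased) form of the
  Poisson--Dirichlet law.
\<close>

definition GEM :: "real \<Rightarrow> real \<Rightarrow> (nat \<Rightarrow> real) measure" where
  "GEM \<alpha> \<theta> =
     distr (PiM UNIV (\<lambda>n. beta_law (1 - \<alpha>) (\<theta> + real (Suc n) * \<alpha>))) seq_space stick_breaking"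

lemma sets_PiM_beta_law: 
  "sets (PiM UNIV (\<lambda>n. beta_law (1 - \<alpha>) (\<theta> + real (Suc n) * \<alpha>))) = sets seq_space"
  unfolding sets_seq_space by (rule sets_PiM_cong) auto

lemma measurable_stick_breaking_PiM:
  "stick_breaking \<in> PiM UNIV (\<lambda>n. beta_law (1 - \<alpha>) (\<theta> + real (Suc n) * \<alpha>)) \<rightarrow>\<^sub>M seq_space"
  using measurable_stick_breaking measurable_cong_sets[OF sets_PiM_beta_law refl] by blast

lemma sets_GEM[measurable_cong, simp]: "sets (GEM \<alpha> \<theta>) = sets seq_space"
  by (simp add: GEM_def)

lemma space_GEM[simp]: "space (GEM \<alpha> \<theta>) = UNIV"
  by (simp add: GEM_def)

text \<open>
  The unranked counterpart of \<open>ranked_simplex\<close>.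
\<close>

definition unit_sequence :: "(nat \<Rightarrow> real) \<Rightarrow> bool" where
  "unit_sequence x \<longleftrightarrow> (\<forall>i. 0 < x i) \<and> x sums 1"

text \<open>
  The expected length that remains after \<open>n\<close> sticks, by recursion on the first stick: that stick
  leaves the mean proportion \<open>(\<theta> + \<alpha>) / (\<theta> + 1)\<close>, and \<open>\<theta>\<close> moves on to \<open>\<theta> + \<alpha>\<close>.
\<close>

primrec mean_residual :: "real \<Rightarrow> nat \<Rightarrow> real \<Rightarrow> real" where
  "mean_residual \<alpha> 0 \<theta> = 1"
| "mean_residual \<alpha> (Suc n) \<theta> = (\<theta> + \<alpha>) / (\<theta> + 1) * mean_residual \<alpha> n (\<theta> + \<alpha>)"

context
  fixes \<alpha> :: real
  assumes \<alpha>: "0 \<le> \<alpha>" "\<alpha> < 1"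
begin

lemma prob_space_beta_law_stick: "0 < \<theta> + \<alpha> \<Longrightarrow> prob_space (beta_law (1 - \<alpha>) (\<theta> + real (Suc n) * \<alpha>))"
proof (rule prob_space_beta_law)
  assume "0 < \<theta> + \<alpha>"
  moreover have "0 \<le> real n * \<alpha>" using \<alpha> by simp
  ultimately show "0 < \<theta> + real (Suc n) * \<alpha>" by (simp add: algebra_simps)
qed (use \<alpha> in simp)

lemma prob_space_GEM: "0 < \<theta> + \<alpha> \<Longrightarrow> prob_space (GEM \<alpha> \<theta>)"
  unfolding GEM_def
  by (intro prob_space.prob_space_distr prob_space_PiM prob_space_beta_law_stick measurable_stick_breaking_PiM)

text \<open>
  Self-similarity of stick breaking: after the first stick the rest is a rescaled GEM sequence with
  \<open>\<theta>\<close> replaced by \<open>\<theta> + \<alpha>\<close>.  All the facts about GEM below use only this recursion and the fact that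
  the residual length vanishes.
\<close>

lemma nn_integral_GEM_rec:
  assumes \<theta>: "0 < \<theta> + \<alpha>" and f[measurable]: "f \<in> borel_measurable seq_space"
  shows "(\<integral>\<^sup>+x. f x \<partial>GEM \<alpha> \<theta>) =
    (\<integral>\<^sup>+v. \<integral>\<^sup>+x. f (prepend_stick v x) \<partial>GEM \<alpha> (\<theta> + \<alpha>) \<partial>beta_law (1 - \<alpha>) (\<theta> + \<alpha>))"
proof -
  let ?M = "\<lambda>\<theta> n. beta_law (1 - \<alpha>) (\<theta> + real (Suc n) * \<alpha>)"
  have fm: "(\<lambda>b. f (stick_breaking b)) \<in> borel_measurable (PiM UNIV (?M \<theta>))"
    using measurable_compose[OF measurable_stick_breaking_PiM f] .
  have shift: "(\<lambda>n. ?M \<theta> (Suc n)) = ?M (\<theta> + \<alpha>)"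
    by (auto simp: algebra_simps)
  have "(\<integral>\<^sup>+x. f x \<partial>GEM \<alpha> \<theta>) = (\<integral>\<^sup>+b. f (stick_breaking b) \<partial>PiM UNIV (?M \<theta>))"
    unfolding GEM_def by (rule nn_integral_distr[OF measurable_stick_breaking_PiM]) simp
  also have "\<dots> = (\<integral>\<^sup>+v. \<integral>\<^sup>+b. f (stick_breaking (case_nat v b)) \<partial>PiM UNIV (\<lambda>n. ?M \<theta> (Suc n)) \<partial>?M \<theta> 0)"
    by (rule nn_integral_PiM_case_nat[OF prob_space_beta_law_stick[OF \<theta>] fm])
  also have "\<dots> = (\<integral>\<^sup>+v. \<integral>\<^sup>+b. f (prepend_stick v (stick_breaking b)) \<partial>PiM UNIV (?M (\<theta> + \<alpha>)) \<partial>beta_law (1 - \<alpha>) (\<theta> + \<alpha>))"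
    unfolding shift stick_breaking_case_nat by simp
  also have "\<dots> = (\<integral>\<^sup>+v. \<integral>\<^sup>+x. f (prepend_stick v x) \<partial>GEM \<alpha> (\<theta> + \<alpha>) \<partial>beta_law (1 - \<alpha>) (\<theta> + \<alpha>))"
    unfolding GEM_def 
    by (intro nn_integral_cong nn_integral_distr[symmetric] measurable_stick_breaking_PiM) measurable
  finally show ?thesis .
qed

lemma AE_GEM_pos:
  assumes \<theta>: "0 < \<theta> + \<alpha>"
  shows "AE x in GEM \<alpha> \<theta>. (\<forall>i. 0 < x i) \<and> (\<forall>n. (\<Sum>i<n. x i) < 1)"
proof -
  let ?M = "\<lambda>n. beta_law (1 - \<alpha>) (\<theta> + real (Suc n) * \<alpha>)"
  have "AE b in PiM UNIV ?M. 0 < b i \<and> b i < 1" for i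
    by (rule AE_PiM_component[OF prob_space_beta_law_stick[OF \<theta>] UNIV_I AE_beta_law])
  then have "AE b in PiM UNIV ?M. \<forall>i. 0 < b i \<and> b i < 1"
    by (subst AE_all_countable) auto
  then have "AE b in PiM UNIV ?M. (\<forall>i. 0 < stick_breaking b i) \<and> (\<forall>n. (\<Sum>i<n. stick_breaking b i) < 1)"
  proof eventually_elim
    case (elim b)
    have "0 < 1 - (\<Sum>i<n. stick_breaking b i)" for n
      unfolding residual_stick_breaking using elim by (intro prod_pos) auto
    moreover have "0 < stick_breaking b i" for i
      unfolding stick_breaking_def using elim by (intro mult_pos_pos prod_pos) auto
    ultimately show ?case by auto
  qed
  moreover have "{x \<in> space seq_space. (\<forall>i. 0 < x i) \<and> (\<forall>n. (\<Sum>i<n. x i) < 1)} \<in> sets seq_space"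
    by measurable
  ultimately show ?thesis
    unfolding GEM_def by (subst AE_distr_iff[OF measurable_stick_breaking_PiM]) auto
qed

lemma nn_integral_GEM_residual:
  "0 < \<theta> + \<alpha> \<Longrightarrow> (\<integral>\<^sup>+x. ennreal (1 - (\<Sum>i<n. x i)) \<partial>GEM \<alpha> \<theta>) = ennreal (mean_residual \<alpha> n \<theta>)"
proof (induction n arbitrary: \<theta>)
  case 0
  interpret prob_space "GEM \<alpha> \<theta>" by (rule prob_space_GEM) fact
  show ?case using emeasure_space_1 by simp
next
  case (Suc n)
  have \<theta>': "0 < \<theta> + \<alpha> + \<alpha>" using Suc.prems \<alpha> by simp
  interpret B: prob_space "beta_law (1 - \<alpha>) (\<theta> + \<alpha> + 1)"
    using Suc.prems \<alpha> by (intro prob_space_beta_law) auto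
  have "(\<integral>\<^sup>+x. ennreal (1 - (\<Sum>i<Suc n. x i)) \<partial>GEM \<alpha> \<theta>) =
     (\<integral>\<^sup>+v. \<integral>\<^sup>+x. ennreal (1 - (\<Sum>i<Suc n. prepend_stick v x i)) \<partial>GEM \<alpha> (\<theta> + \<alpha>) \<partial>beta_law (1 - \<alpha>) (\<theta> + \<alpha>))"
    using Suc.prems by (intro nn_integral_GEM_rec) measurable
  also have "\<dots> = (\<integral>\<^sup>+v. ennreal (1 - v) * ennreal (mean_residual \<alpha> n (\<theta> + \<alpha>)) \<partial>beta_law (1 - \<alpha>) (\<theta> + \<alpha>))"
  proof (rule nn_integral_cong_AE, use AE_beta_law[of "1 - \<alpha>" "\<theta> + \<alpha>"] in eventually_elim)
    case (elim v)
    have "(\<integral>\<^sup>+x. ennreal (1 - (\<Sum>i<Suc n. prepend_stick v x i)) \<partial>GEM \<alpha> (\<theta> + \<alpha>)) =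
        (\<integral>\<^sup>+x. ennreal (1 - v) * ennreal (1 - (\<Sum>i<n. x i)) \<partial>GEM \<alpha> (\<theta> + \<alpha>))"
      unfolding residual_prepend_stick using elim by (simp add: ennreal_mult')
    also have "\<dots> = ennreal (1 - v) * (\<integral>\<^sup>+x. ennreal (1 - (\<Sum>i<n. x i)) \<partial>GEM \<alpha> (\<theta> + \<alpha>))"
      by (rule nn_integral_cmult) measurable
    finally show ?case using Suc.IH[OF \<theta>'] by simp
  qed
  also have "\<dots> = ennreal ((\<theta> + \<alpha>) / (\<theta> + 1)) * ennreal (mean_residual \<alpha> n (\<theta> + \<alpha>))"
    using Suc.prems \<alpha> B.emeasure_space_1 by (subst nn_integral_beta_law_size_biased_complement) (auto simp: algebra_simps)
  also have "\<dots> = ennreal (mean_residual \<alpha> (Suc n) \<theta>)"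
    using Suc.prems \<alpha> by (simp add: ennreal_mult'[symmetric])
  finally show ?case .
qed

lemma mean_residual_nonneg: "0 < \<theta> + \<alpha> \<Longrightarrow> 0 \<le> mean_residual \<alpha> n \<theta>"
  using \<alpha> by (induction n arbitrary: \<theta>) auto

lemma mean_residual_eq_prod:
  "mean_residual \<alpha> n \<theta> = (\<Prod>k<n. (\<theta> + real (Suc k) * \<alpha>) / (\<theta> + real k * \<alpha> + 1))"
proof (induction n arbitrary: \<theta>)
  case (Suc n)
  show ?case
    by (simp add: prod.lessThan_Suc_shift Suc algebra_simps del: prod.lessThan_Suc)
qed simp

text \<open>
  The factors are \<open>1 - (1 - \<alpha>) / (\<theta> + k * \<alpha> + 1)\<close>, and the subtracted terms are at least a constant
  multiple of the harmonic terms \<open>1 / (k + 1)\<close>, whose sum diverges.  The rate plays the part of a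
  contraction in both limit arguments below.
\<close>

lemma mean_residual_tendsto_0:
  assumes \<theta>: "0 < \<theta> + \<alpha>"
  shows "(\<lambda>n. mean_residual \<alpha> n \<theta>) \<longlonglongrightarrow> 0"
proof -
  \<comment> \<open>\<open>\<theta> + k * \<alpha> + 1 \<le> (\<theta> + 2) * (k + 1)\<close> because \<open>\<alpha> < 1\<close> and \<open>\<theta> > -1\<close>.\<close>
  define c where "c = (1 - \<alpha>) / (\<theta> + 2)"
  have c: "0 < c" using \<alpha> \<theta> by (simp add: c_def)
  have le: "mean_residual \<alpha> n \<theta> \<le> exp (- c * harm n)" for n
  proof -
    have "mean_residual \<alpha> n \<theta> \<le> (\<Prod>k<n. exp (- c * inverse (real (Suc k))))"
      unfolding mean_residual_eq_prod
    proof (intro prod_mono conjI)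
      fix k
      have k: "0 \<le> real k * \<alpha>" "real k * \<alpha> \<le> real k" using \<alpha> by (auto intro: mult_left_le)
      have pos: "0 < \<theta> + real k * \<alpha> + 1" using \<alpha> \<theta> k by linarith
      show "0 \<le> (\<theta> + real (Suc k) * \<alpha>) / (\<theta> + real k * \<alpha> + 1)"
        using pos k \<theta> by (auto simp: algebra_simps intro!: divide_nonneg_pos)
      have "\<theta> + real k * \<alpha> + 1 \<le> (\<theta> + 2) * real (Suc k)"
      proof -
        have "0 \<le> (\<theta> + 1) * real k" using \<alpha> \<theta> by simp
        then show ?thesis using k by (simp add: algebra_simps)
      qed
      then have "(1 - \<alpha>) / ((\<theta> + 2) * real (Suc k)) \<le> (1 - \<alpha>) / (\<theta> + real k * \<alpha> + 1)"
        using \<alpha> \<theta> pos by (intro divide_left_mono mult_pos_pos) auto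
      moreover have "(\<theta> + real (Suc k) * \<alpha>) / (\<theta> + real k * \<alpha> + 1) = 1 - (1 - \<alpha>) / (\<theta> + real k * \<alpha> + 1)"
        using pos by (simp add: field_simps)
      ultimately have "(\<theta> + real (Suc k) * \<alpha>) / (\<theta> + real k * \<alpha> + 1) \<le> 1 + - c * inverse (real (Suc k))"
        by (simp add: c_def divide_inverse mult.assoc)
      also have "\<dots> \<le> exp (- c * inverse (real (Suc k)))"
        by (rule exp_ge_add_one_self)
      finally show "(\<theta> + real (Suc k) * \<alpha>) / (\<theta> + real k * \<alpha> + 1) \<le> exp (- c * inverse (real (Suc k)))" .
    qed
    also have "\<dots> = exp (- c * harm n)"
      by (induction n) (auto simp: harm_Suc exp_add[symmetric] algebra_simps harm_expand(1))
    finally show ?thesis .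
  qed
  have "filterlim (\<lambda>n. c * harm n :: real) at_top sequentially"
    by (rule filterlim_tendsto_pos_mult_at_top[OF tendsto_const c harm_at_top])
  then have "(\<lambda>n. exp (- c * harm n)) \<longlonglongrightarrow> 0"
    by (intro filterlim_compose[OF exp_at_bot]) (simp add: filterlim_uminus_at_bot)
  then show ?thesis
    by (rule real_tendsto_sandwich[rotated 3]) (use le mean_residual_nonneg[OF \<theta>] in auto)
qed

text \<open>
  The expected mass missing from the sum is below every \<open>mean_residual \<alpha> n \<theta>\<close>, hence zero.
\<close>

lemma AE_GEM_unit_sequence:
  assumes \<theta>: "0 < \<theta> + \<alpha>"
  shows "AE x in GEM \<alpha> \<theta>. unit_sequence x"
proof -
  have summ: "summable x \<and> suminf x \<le> 1 \<and> (\<forall>n. (\<Sum>i<n. x i) \<le> suminf x)" 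
    if "(\<forall>i. 0 < x i) \<and> (\<forall>n. (\<Sum>i<n. x i) < 1)" for x :: "nat \<Rightarrow> real"
  proof -
    have "summable x"
      by (rule summableI_nonneg_bounded[of x 1]) (use that in \<open>auto intro: less_imp_le\<close>)
    then show ?thesis
      using that by (auto intro!: suminf_le_const sum_le_suminf intro: less_imp_le)
  qed
  have "(\<integral>\<^sup>+x. ennreal (1 - suminf x) \<partial>GEM \<alpha> \<theta>) \<le> ennreal (mean_residual \<alpha> n \<theta>)" for n
    unfolding nn_integral_GEM_residual[OF \<theta>, symmetric]
  proof (rule nn_integral_mono_AE, use AE_GEM_pos[OF \<theta>] in eventually_elim)
    case (elim x)
    show ?case using summ[OF elim] by (intro ennreal_leI) auto
  qed
  then have "(\<integral>\<^sup>+x. ennreal (1 - suminf x) \<partial>GEM \<alpha> \<theta>) \<le> ennreal 0"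
    by (intro LIMSEQ_le_const[OF tendsto_ennrealI[OF mean_residual_tendsto_0[OF \<theta>]]]) auto
  then have "AE x in GEM \<alpha> \<theta>. ennreal (1 - suminf x) = 0"
    by (subst nn_integral_0_iff_AE[symmetric]) auto
  with AE_GEM_pos[OF \<theta>] show ?thesis
  proof eventually_elim
    case (elim x)
    then have "suminf x = 1" using summ[OF elim(1)] by (auto simp: ennreal_eq_0_iff)
    then show ?case
      using elim summ[OF elim(1)] summable_sums[of x] by (simp add: unit_sequence_def)
  qed
qed

text \<open>
  Induction on \<open>n\<close> for all \<open>\<theta>\<close> and \<open>F\<close> at once.  Conditionally on the first stick \<open>v\<close>, the sum consists of
  the term \<open>v * F\<close> at that stick and \<open>1 - v\<close> times the same expression for the remaining sequence,
  which by induction may be evaluated at the second stick.  The weight \<open>1 - v\<close> makes the first two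
  sticks exchangeable, so the second stick can be replaced by the first, and the weights \<open>v\<close> and
  \<open>1 - v\<close> recombine to 1.
\<close>

lemma GEM_size_biased_truncated:
  fixes F :: "(nat \<Rightarrow> real) \<Rightarrow> nat \<Rightarrow> ennreal"
  assumes \<theta>: "0 < \<theta> + \<alpha>"
    and "\<And>i. (\<lambda>x. F x i) \<in> borel_measurable seq_space"
    and "\<And>x p i. bij p \<Longrightarrow> F (x \<circ> p) i = F x (p i)"
  shows "(\<integral>\<^sup>+x. (\<Sum>i<n. ennreal (x i) * F x i) + ennreal (1 - (\<Sum>i<n. x i)) * F x n \<partial>GEM \<alpha> \<theta>) =
    (\<integral>\<^sup>+x. F x 0 \<partial>GEM \<alpha> \<theta>)"
  using assms
proof (induction n arbitrary: \<theta> F)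
  case (Suc n)
  note \<theta> = Suc.prems(1) and F[measurable] = Suc.prems(2) and sym = Suc.prems(3)
  have \<theta>': "0 < \<theta> + \<alpha> + \<alpha>" using \<theta> \<alpha> by simp
  interpret G: prob_space "GEM \<alpha> (\<theta> + \<alpha>)" by (rule prob_space_GEM[OF \<theta>'])
  interpret G': prob_space "GEM \<alpha> (\<theta> + \<alpha> + \<alpha>)" using \<theta>' \<alpha> by (intro prob_space_GEM) auto
  let ?B = "beta_law (1 - \<alpha>) (\<theta> + \<alpha>)"
  define H where "H i v = (\<integral>\<^sup>+x. F (prepend_stick v x) i \<partial>GEM \<alpha> (\<theta> + \<alpha>))" for i v
  have H[measurable]: "H i \<in> borel_measurable borel" for i
    unfolding H_def by measurable
  have step: "(\<Sum>i<Suc n. ennreal (prepend_stick v x i) * F (prepend_stick v x) i)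
        + ennreal (1 - (\<Sum>i<Suc n. prepend_stick v x i)) * F (prepend_stick v x) (Suc n) =
      ennreal v * F (prepend_stick v x) 0 + ennreal (1 - v) *
        ((\<Sum>i<n. ennreal (x i) * F (prepend_stick v x) (Suc i))
         + ennreal (1 - (\<Sum>i<n. x i)) * F (prepend_stick v x) (Suc n))" if "v < 1" for v x
    unfolding residual_prepend_stick using that
    by (simp add: sum.lessThan_Suc_shift ennreal_mult' distrib_left sum_distrib_left mult.assoc add.assoc
        del: sum.lessThan_Suc)
  have IH: "(\<integral>\<^sup>+x. (\<Sum>i<n. ennreal (x i) * F (prepend_stick v x) (Suc i))
        + ennreal (1 - (\<Sum>i<n. x i)) * F (prepend_stick v x) (Suc n) \<partial>GEM \<alpha> (\<theta> + \<alpha>)) = H 1 v" for v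
    unfolding H_def One_nat_def
  proof (rule Suc.IH[OF \<theta>', of "\<lambda>x i. F (prepend_stick v x) (Suc i)"])
    show "F (prepend_stick v (x \<circ> p)) (Suc i) = F (prepend_stick v x) (Suc (p i))" if "bij p" for x p i
      unfolding prepend_stick_compose by (subst sym[OF bij_case_nat_Suc[OF that]]) simp
  qed measurable
  have "(\<integral>\<^sup>+x. (\<Sum>i<Suc n. ennreal (x i) * F x i) + ennreal (1 - (\<Sum>i<Suc n. x i)) * F x (Suc n) \<partial>GEM \<alpha> \<theta>) =
    (\<integral>\<^sup>+v. \<integral>\<^sup>+x. (\<Sum>i<Suc n. ennreal (prepend_stick v x i) * F (prepend_stick v x) i)
        + ennreal (1 - (\<Sum>i<Suc n. prepend_stick v x i)) * F (prepend_stick v x) (Suc n) \<partial>GEM \<alpha> (\<theta> + \<alpha>) \<partial>?B)"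
    by (rule nn_integral_GEM_rec[OF \<theta>]) measurable
  also have "\<dots> = (\<integral>\<^sup>+v. ennreal v * H 0 v + ennreal (1 - v) * H 1 v \<partial>?B)"
  proof (rule nn_integral_cong_AE, use AE_beta_law[of "1 - \<alpha>" "\<theta> + \<alpha>"] in eventually_elim)
    case (elim v)
    then have "v < 1" by simp
    define S where "S x = (\<Sum>i<n. ennreal (x i) * F (prepend_stick v x) (Suc i))
         + ennreal (1 - (\<Sum>i<n. x i)) * F (prepend_stick v x) (Suc n)" for x
    have [measurable]: "S \<in> borel_measurable seq_space"
      unfolding S_def by measurable
    have "(\<integral>\<^sup>+x. S x \<partial>GEM \<alpha> (\<theta> + \<alpha>)) = H 1 v"
      unfolding S_def by (rule IH)
    then show ?case
      unfolding step[OF \<open>v < 1\<close>] S_def[symmetric]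
      by (subst nn_integral_add) (auto simp: nn_integral_cmult H_def[of 0])
  qed
  also have "\<dots> = (\<integral>\<^sup>+v. ennreal v * H 0 v \<partial>?B) + (\<integral>\<^sup>+v. ennreal (1 - v) * H 1 v \<partial>?B)"
    by (rule nn_integral_add) measurable
  also have "(\<integral>\<^sup>+v. ennreal (1 - v) * H 1 v \<partial>?B) = (\<integral>\<^sup>+v. ennreal (1 - v) * H 0 v \<partial>?B)"
  proof -
    define G where "G i v s = (\<integral>\<^sup>+x. F (case_nat v (case_nat s (\<lambda>n. (1 - v - s) * x n))) i
        \<partial>GEM \<alpha> (\<theta> + \<alpha> + \<alpha>))" for i v s
    have scale[measurable (raw)]: "(\<lambda>x n. c x * g x n) \<in> M \<rightarrow>\<^sub>M seq_space"
      if [measurable]: "c \<in> borel_measurable M" "g \<in> M \<rightarrow>\<^sub>M seq_space" for c g and M :: "((real \<times> real) \<times> (nat \<Rightarrow> real)) measure"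
      by (rule measurable_seq_spaceI) measurable
    have Gm: "(\<lambda>(v, s). G i v s) \<in> borel_measurable (borel \<Otimes>\<^sub>M borel)" for i
      unfolding G_def by measurable
    have HG: "H i v = (\<integral>\<^sup>+w. G i v ((1 - v) * w) \<partial>beta_law (1 - \<alpha>) (\<theta> + \<alpha> + \<alpha>))" for i v
    proof -
      have "prepend_stick v (prepend_stick w x) =
          case_nat v (case_nat ((1 - v) * w) (\<lambda>n. (1 - v - (1 - v) * w) * x n))" for w x
        by (auto simp: fun_eq_iff prepend_stick_def algebra_simps split: nat.split)
      then show ?thesis
        unfolding H_def G_def by (subst nn_integral_GEM_rec[OF \<theta>']) auto
    qed
    have swap: "G 1 s v = G 0 v s" for v s
    proof -
      let ?p = "Transposition.transpose 0 (1::nat)"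
      have "case_nat s (case_nat v (\<lambda>n. (1 - s - v) * x n)) =
            case_nat v (case_nat s (\<lambda>n. (1 - v - s) * x n)) \<circ> ?p" for x :: "nat \<Rightarrow> real"
        by (auto simp: fun_eq_iff Transposition.transpose_def algebra_simps split: nat.split)
      then show ?thesis
        unfolding G_def by (simp add: sym)
    qed
    have pos: "0 < 1 - \<alpha>" "0 < \<theta> + \<alpha> + \<alpha>" using \<alpha> \<theta>' by auto
    \<comment> \<open>The weight \<open>1 - v\<close> turns \<open>beta_law (1 - \<alpha>) (\<theta> + \<alpha>)\<close> into \<open>beta_law (1 - \<alpha>) (\<theta> + \<alpha> + 1)\<close>, which is
        exactly the first law in the swap lemma.\<close>
    have e: "1 - \<alpha> + (\<theta> + \<alpha> + \<alpha>) = \<theta> + \<alpha> + 1" by simp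
    have "(\<integral>\<^sup>+v. H 1 v \<partial>beta_law (1 - \<alpha>) (\<theta> + \<alpha> + 1)) = (\<integral>\<^sup>+v. H 0 v \<partial>beta_law (1 - \<alpha>) (\<theta> + \<alpha> + 1))"
      unfolding HG using nn_integral_beta_stick_swap[OF pos Gm[of 1]] unfolding e swap .
    then show ?thesis
      using \<alpha> \<theta> by (simp add: nn_integral_beta_law_size_biased_complement)
  qed
  also have "(\<integral>\<^sup>+v. ennreal v * H 0 v \<partial>?B) + (\<integral>\<^sup>+v. ennreal (1 - v) * H 0 v \<partial>?B) = 
      (\<integral>\<^sup>+v. ennreal v * H 0 v + ennreal (1 - v) * H 0 v \<partial>?B)"
    by (rule nn_integral_add[symmetric]) measurable
  also have "\<dots> = (\<integral>\<^sup>+v. H 0 v \<partial>?B)"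
  proof (rule nn_integral_cong_AE, use AE_beta_law[of "1 - \<alpha>" "\<theta> + \<alpha>"] in eventually_elim)
    case (elim v)
    then have "ennreal v + ennreal (1 - v) = 1" by (simp flip: ennreal_plus)
    then show ?case by (simp add: distrib_right[symmetric])
  qed
  also have "\<dots> = (\<integral>\<^sup>+x. F x 0 \<partial>GEM \<alpha> \<theta>)"
    unfolding H_def by (rule nn_integral_GEM_rec[OF \<theta>, symmetric]) measurable
  finally show ?case .
qed simp

text \<open>
  In the stick-breaking order the first stick is a size-biased pick: choosing an index \<open>i\<close> with
  probability \<open>x i\<close> and forgetting the order gives the same law as choosing the first index.  The
  symmetry assumption says that \<open>F\<close> sees only the collection of sticks and the selected one.  The
  truncated identity passes to the limit because its error term is at most \<open>mean_residual \<alpha> n \<theta>\<close>.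
\<close>

lemma GEM_size_biased:
  fixes F :: "(nat \<Rightarrow> real) \<Rightarrow> nat \<Rightarrow> ennreal"
  assumes \<theta>: "0 < \<theta> + \<alpha>"
    and F[measurable]: "\<And>i. (\<lambda>x. F x i) \<in> borel_measurable seq_space"
    and sym: "\<And>x p i. bij p \<Longrightarrow> F (x \<circ> p) i = F x (p i)"
    and le1: "\<And>x i. F x i \<le> 1"
  shows "(\<integral>\<^sup>+x. (\<Sum>i. ennreal (x i) * F x i) \<partial>GEM \<alpha> \<theta>) = (\<integral>\<^sup>+x. F x 0 \<partial>GEM \<alpha> \<theta>)"
proof -
  define a where "a i = (\<integral>\<^sup>+x. ennreal (x i) * F x i \<partial>GEM \<alpha> \<theta>)" for i
  define r where "r n = (\<integral>\<^sup>+x. ennreal (1 - (\<Sum>i<n. x i)) * F x n \<partial>GEM \<alpha> \<theta>)" for n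
  have L: "(\<integral>\<^sup>+x. (\<Sum>i. ennreal (x i) * F x i) \<partial>GEM \<alpha> \<theta>) = (\<Sum>i. a i)"
    unfolding a_def by (rule nn_integral_suminf) measurable
  have R: "(\<Sum>i<n. a i) + r n = (\<integral>\<^sup>+x. F x 0 \<partial>GEM \<alpha> \<theta>)" for n
    unfolding a_def r_def
    by (subst GEM_size_biased_truncated[OF \<theta> F sym, symmetric]) (auto simp: nn_integral_add nn_integral_sum)
  have "r n \<le> ennreal (mean_residual \<alpha> n \<theta>)" for n
    unfolding r_def nn_integral_GEM_residual[OF \<theta>, symmetric]
  proof (rule nn_integral_mono)
    fix x :: "nat \<Rightarrow> real"
    show "ennreal (1 - (\<Sum>i<n. x i)) * F x n \<le> ennreal (1 - (\<Sum>i<n. x i))"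
      using mult_left_mono[OF le1, of "ennreal (1 - (\<Sum>i<n. x i))" x n] by simp
  qed
  moreover have "(\<lambda>n. ennreal (mean_residual \<alpha> n \<theta>)) \<longlonglongrightarrow> 0"
    using tendsto_ennrealI[OF mean_residual_tendsto_0[OF \<theta>]] by simp
  ultimately have "r \<longlonglongrightarrow> 0"
    by (intro tendsto_sandwich[of "\<lambda>_. 0" r sequentially, OF _ _ tendsto_const]) auto
  moreover have "(\<lambda>n. \<Sum>i<n. a i) \<longlonglongrightarrow> (\<Sum>i. a i)"
    by (rule summable_LIMSEQ) simp
  ultimately have "(\<lambda>n. (\<Sum>i<n. a i) + r n) \<longlonglongrightarrow> (\<Sum>i. a i) + 0"
    by (intro tendsto_add)
  then show ?thesis
    unfolding R L by (simp add: LIMSEQ_const_iff)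
qed

end

section \<open>Marked sticks and their recursion\<close>

type_synonym marked_seq = "(nat \<Rightarrow> real) \<times> (nat \<Rightarrow> bool)"

definition mark_space :: "(nat \<Rightarrow> bool) measure" where
  "mark_space = PiM UNIV (\<lambda>_. count_space UNIV)"

definition marked_space :: "marked_seq measure" where
  "marked_space = seq_space \<Otimes>\<^sub>M mark_space"

lemma space_mark_space[simp]: "space mark_space = UNIV"
  by (simp add: mark_space_def space_PiM)

lemma space_marked_space[simp]: "space marked_space = UNIV"
  by (simp add: marked_space_def space_pair_measure)

lemma sets_mark_space[measurable_cong]: "sets mark_space = sets (PiM UNIV (\<lambda>_. count_space UNIV))"
  by (simp add: mark_space_def)

lemma sets_marked_space[measurable_cong]: "sets marked_space = sets (seq_space \<Otimes>\<^sub>M mark_space)"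
  by (simp add: marked_space_def)

lemma measurable_mark_space_component[measurable (raw)]: "(\<lambda>x. x i) \<in> mark_space \<rightarrow>\<^sub>M count_space UNIV"
  unfolding mark_space_def by (rule measurable_component_singleton) simp

lemma measurable_mark_space_apply'[measurable_dest]:
  "f \<in> M \<rightarrow>\<^sub>M mark_space \<Longrightarrow> g \<in> N \<rightarrow>\<^sub>M M \<Longrightarrow> (\<lambda>x. f (g x) i) \<in> N \<rightarrow>\<^sub>M count_space UNIV"
  by (rule measurable_compose[OF measurable_compose measurable_mark_space_component])

lemma measurable_mark_spaceI:
  "(\<And>i. (\<lambda>x. f x i) \<in> M \<rightarrow>\<^sub>M count_space UNIV) \<Longrightarrow> f \<in> M \<rightarrow>\<^sub>M mark_space"
  unfolding mark_space_def by (rule measurable_PiM_single') (auto simp: space_PiM)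

text \<open>
  Prepend a stick of length \<open>v\<close> carrying the mark \<open>m\<close>; the other sticks are rescaled and keep their
  marks.
\<close>

definition extend_marked :: "real \<Rightarrow> bool \<Rightarrow> marked_seq \<Rightarrow> marked_seq" where
  "extend_marked v m z = (prepend_stick v (fst z), case_nat m (snd z))"

lemma measurable_case_nat_mark_space[measurable (raw)]:
  assumes [measurable]: "g \<in> M \<rightarrow>\<^sub>M mark_space" "Measurable.pred M P"
  shows "(\<lambda>x. case_nat (P x) (g x)) \<in> M \<rightarrow>\<^sub>M mark_space"
  by (rule measurable_mark_spaceI) (auto split: nat.split)

lemma measurable_extend_marked[measurable (raw)]:
  assumes [measurable]: "f \<in> borel_measurable M" "g \<in> M \<rightarrow>\<^sub>M marked_space" 
  shows "(\<lambda>x. extend_marked (f x) m (g x)) \<in> M \<rightarrow>\<^sub>M marked_space"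
proof -
  have [measurable]: "(\<lambda>x. fst (g x)) \<in> M \<rightarrow>\<^sub>M seq_space" "(\<lambda>x. snd (g x)) \<in> M \<rightarrow>\<^sub>M mark_space"
    using assms(2) unfolding marked_space_def by measurable
  show ?thesis
    unfolding extend_marked_def marked_space_def by measurable
qed

definition symmetric_functional :: "(marked_seq \<Rightarrow> 'b) \<Rightarrow> bool" where
  "symmetric_functional \<Phi> \<longleftrightarrow> (\<forall>y I p. bij p \<longrightarrow> \<Phi> (y \<circ> p, I \<circ> p) = \<Phi> (y, I))"

lemma symmetric_functional_extend:
  assumes "symmetric_functional \<Phi>"
  shows "symmetric_functional (\<lambda>z. \<Phi> (extend_marked v m z))"
  unfolding symmetric_functional_def
proof (intro allI impI)
  fix y :: "nat \<Rightarrow> real" and I :: "nat \<Rightarrow> bool" and p :: "nat \<Rightarrow> nat"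
  assume p: "bij p"
  have "case_nat m (I \<circ> p) = case_nat m I \<circ> case_nat 0 (Suc \<circ> p)"
    by (auto simp: fun_eq_iff split: nat.split)
  then show "\<Phi> (extend_marked v m (y \<circ> p, I \<circ> p)) = \<Phi> (extend_marked v m (y, I))"
    using assms bij_case_nat_Suc[OF p]
    by (simp add: symmetric_functional_def extend_marked_def prepend_stick_compose)
qed

text \<open>
  Two laws of marked sticks with parameters \<open>a\<close> and \<open>b\<close> will be compared through a common recursion.
  A stick of law \<open>beta_law (1 - \<alpha>) (a + b + \<alpha>)\<close> appears; it is marked with probability
  \<open>a / (a + b)\<close>, in which case \<open>a\<close> becomes \<open>a + \<alpha>\<close>, and otherwise \<open>b\<close> becomes \<open>b + \<alpha>\<close>, as in an
  urn scheme.  The recursion is only required for functionals that ignore the order of the sticks,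
  since the order in which the sticks of \<open>split_law\<close> are listed is arbitrary.  The two
  measurability clauses make the outer integral meaningful.
\<close>

definition stick_recursive ::
    "real \<Rightarrow> (real \<Rightarrow> real \<Rightarrow> marked_seq measure) \<Rightarrow> bool" where
  "stick_recursive \<alpha> P \<longleftrightarrow> (\<forall>a>0. \<forall>b>0.
     prob_space (P a b) \<and> sets (P a b) = sets marked_space \<and>
     (AE z in P a b. unit_sequence (fst z)) \<and>
     (\<forall>\<Phi>\<in>borel_measurable marked_space. symmetric_functional \<Phi> \<longrightarrow>
       (\<lambda>v. \<integral>\<^sup>+z. \<Phi> (extend_marked v True z) \<partial>P (a + \<alpha>) b) \<in> borel_measurable borel \<and>
       (\<lambda>v. \<integral>\<^sup>+z. \<Phi> (extend_marked v False z) \<partial>P a (b + \<alpha>)) \<in> borel_measurable borel \<and>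
       (\<integral>\<^sup>+z. \<Phi> z \<partial>P a b) =
         (\<integral>\<^sup>+v. ennreal (a / (a + b)) * (\<integral>\<^sup>+z. \<Phi> (extend_marked v True z) \<partial>P (a + \<alpha>) b) +
               ennreal (b / (a + b)) * (\<integral>\<^sup>+z. \<Phi> (extend_marked v False z) \<partial>P a (b + \<alpha>))
          \<partial>beta_law (1 - \<alpha>) (a + b + \<alpha>))))"

text \<open>
  Functionals that depend on all but the first \<open>n\<close> sticks only up to a multiple of the length that
  these leave over.
\<close>

definition tail_lipschitz :: "nat \<Rightarrow> real \<Rightarrow> (marked_seq \<Rightarrow> ennreal) \<Rightarrow> bool" where
  "tail_lipschitz n L \<Phi> \<longleftrightarrow> (\<forall>y y' I I'. unit_sequence y \<longrightarrow> unit_sequence y' \<longrightarrow>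
     (\<forall>i<n. y i = y' i \<and> I i = I' i) \<longrightarrow>
     \<Phi> (y, I) \<le> \<Phi> (y', I') + ennreal (L * (1 - (\<Sum>i<n. y i))))"

lemma unit_sequence_prepend_stick:
  assumes "unit_sequence y" "0 < v" "v < 1"
  shows "unit_sequence (prepend_stick v y)"
proof -
  have "(\<lambda>n. prepend_stick v y (Suc n)) sums ((1 - v) * 1)"
    using assms sums_mult[of y 1 "1 - v"] by (simp add: unit_sequence_def)
  then have "prepend_stick v y sums ((1 - v) * 1 + prepend_stick v y 0)"
    by (rule sums_Suc)
  moreover have "0 < prepend_stick v y i" for i
    using assms by (cases i) (auto simp: unit_sequence_def)
  ultimately show ?thesis by (simp add: unit_sequence_def)
qed

lemma tail_lipschitz_extend:
  assumes T: "tail_lipschitz (Suc n) L \<Phi>" and v: "0 < v" "v < 1"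
  shows "tail_lipschitz n (L * (1 - v)) (\<lambda>z. \<Phi> (extend_marked v m z))"
  unfolding tail_lipschitz_def
proof (intro allI impI)
  fix y y' :: "nat \<Rightarrow> real" and I I' :: "nat \<Rightarrow> bool"
  assume u: "unit_sequence y" "unit_sequence y'" and eq: "\<forall>i<n. y i = y' i \<and> I i = I' i"
  have eq': "\<forall>i<Suc n. prepend_stick v y i = prepend_stick v y' i \<and> case_nat m I i = case_nat m I' i"
  proof (intro allI impI)
    fix i assume "i < Suc n"
    then show "prepend_stick v y i = prepend_stick v y' i \<and> case_nat m I i = case_nat m I' i"
      using eq by (cases i) auto
  qed
  have e: "L * (1 - (\<Sum>i<Suc n. prepend_stick v y i)) = L * (1 - v) * (1 - (\<Sum>i<n. y i))"
    unfolding residual_prepend_stick by simp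
  have "\<Phi> (prepend_stick v y, case_nat m I)
      \<le> \<Phi> (prepend_stick v y', case_nat m I') + ennreal (L * (1 - (\<Sum>i<Suc n. prepend_stick v y i)))"
    using T unit_sequence_prepend_stick[OF u(1) v] unit_sequence_prepend_stick[OF u(2) v] eq'
    unfolding tail_lipschitz_def by blast
  then show "\<Phi> (extend_marked v m (y, I)) \<le> \<Phi> (extend_marked v m (y', I')) +
      ennreal (L * (1 - v) * (1 - (\<Sum>i<n. y i)))"
    unfolding e extend_marked_def by simp
qed

context
  fixes \<alpha> :: real
  assumes \<alpha>: "0 \<le> \<alpha>" "\<alpha> < 1"
begin

text \<open>
  After \<open>n\<close> steps of the common recursion both laws have produced the same \<open>n\<close> marked sticks, and the
  functional can differ by at most \<open>L\<close> times the length left over.  The induction needs all \<open>a\<close>, \<open>b\<close>,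
  \<open>L\<close> and \<open>\<Phi>\<close> because one step changes each of them; the Lipschitz constant shrinks by \<open>1 - v\<close>,
  the mean of which is the factor in \<open>mean_residual\<close>.
\<close>

lemma stick_recursive_le:
  assumes P: "stick_recursive \<alpha> P" and Q: "stick_recursive \<alpha> Q"
  shows "0 < a \<Longrightarrow> 0 < b \<Longrightarrow> 0 \<le> L \<Longrightarrow> \<Phi> \<in> borel_measurable marked_space \<Longrightarrow> symmetric_functional \<Phi> \<Longrightarrow>
    tail_lipschitz n L \<Phi> \<Longrightarrow>
    (\<integral>\<^sup>+z. \<Phi> z \<partial>P a b) \<le> (\<integral>\<^sup>+z. \<Phi> z \<partial>Q a b) + ennreal (L * mean_residual \<alpha> n (a + b))"
proof (induction n arbitrary: a b L \<Phi>)
  case 0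
  note [measurable] = 0(4)
  interpret P: prob_space "P a b" using P 0 by (simp add: stick_recursive_def)
  interpret Q: prob_space "Q a b" using Q 0 by (simp add: stick_recursive_def)
  have sQ[measurable_cong]: "sets (Q a b) = sets marked_space" using Q 0 by (simp add: stick_recursive_def)
  have uP: "AE z in P a b. unit_sequence (fst z)" using P 0 by (simp add: stick_recursive_def)
  have uQ: "AE z in Q a b. unit_sequence (fst z)" using Q 0 by (simp add: stick_recursive_def)
  have "\<Phi> z \<le> (\<integral>\<^sup>+z. \<Phi> z \<partial>Q a b) + ennreal L" if "unit_sequence (fst z)" for z
  proof -
    have "\<Phi> z = (\<integral>\<^sup>+z'. \<Phi> z \<partial>Q a b)"
      using Q.emeasure_space_1 by simp
    also have "\<dots> \<le> (\<integral>\<^sup>+z'. \<Phi> z' + ennreal L \<partial>Q a b)"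
    proof (rule nn_integral_mono_AE, use uQ in eventually_elim)
      case (elim z')
      obtain y I y' I' where z: "z = (y, I)" "z' = (y', I')" by fastforce
      then show ?case
        using 0(6) that elim unfolding tail_lipschitz_def by fastforce
    qed
    also have "\<dots> = (\<integral>\<^sup>+z. \<Phi> z \<partial>Q a b) + ennreal L"
      using Q.emeasure_space_1 by (subst nn_integral_add) auto
    finally show ?thesis .
  qed
  then have "(\<integral>\<^sup>+z. \<Phi> z \<partial>P a b) \<le> (\<integral>\<^sup>+z. (\<integral>\<^sup>+z. \<Phi> z \<partial>Q a b) + ennreal L \<partial>P a b)"
    by (intro nn_integral_mono_AE) (use uP in auto)
  also have "\<dots> = (\<integral>\<^sup>+z. \<Phi> z \<partial>Q a b) + ennreal L"
    using P.emeasure_space_1 by simp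
  finally show ?case by simp
next
  case (Suc n)
  note ab = Suc.prems(1,2)
  have ab': "0 < a + \<alpha>" "0 < b + \<alpha>" using ab \<alpha> by auto
  let ?B = "beta_law (1 - \<alpha>) (a + b + \<alpha>)" and ?\<Phi> = "\<lambda>v m z. \<Phi> (extend_marked v m z)"
  let ?c = "mean_residual \<alpha> n (a + b + \<alpha>)"
  define p q where "p = a / (a + b)" and "q = b / (a + b)"
  have pq: "0 \<le> p" "0 \<le> q" "p + q = 1" using ab by (auto simp: p_def q_def add_divide_distrib[symmetric])
  define e r where "e v m = (if m then \<integral>\<^sup>+z. ?\<Phi> v m z \<partial>P (a + \<alpha>) b else \<integral>\<^sup>+z. ?\<Phi> v m z \<partial>P a (b + \<alpha>))"
    and "r v m = (if m then \<integral>\<^sup>+z. ?\<Phi> v m z \<partial>Q (a + \<alpha>) b else \<integral>\<^sup>+z. ?\<Phi> v m z \<partial>Q a (b + \<alpha>))" for v m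
  interpret B: prob_space "beta_law (1 - \<alpha>) (a + b + \<alpha> + 1)"
    using ab \<alpha> by (intro prob_space_beta_law) auto
  have c: "0 \<le> ?c" using ab \<alpha> by (intro mean_residual_nonneg) auto
  \<comment> \<open>After a stick \<open>v\<close> the functional has Lipschitz constant \<open>L * (1 - v)\<close> and one step fewer to go.\<close>
  have le: "e v m \<le> r v m + ennreal (1 - v) * ennreal (L * ?c)" if v: "0 < v" "v < 1" for v m
  proof -
    have meas: "?\<Phi> v m \<in> borel_measurable marked_space" using Suc.prems(4) by measurable
    have s: "symmetric_functional (?\<Phi> v m)" by (rule symmetric_functional_extend) fact
    have t: "tail_lipschitz n (L * (1 - v)) (?\<Phi> v m)" by (rule tail_lipschitz_extend) fact+
    have L: "0 \<le> L * (1 - v)" using Suc.prems v by simp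
    have "ennreal (L * (1 - v) * ?c) = ennreal ((1 - v) * (L * ?c))" by (simp add: mult_ac)
    also have "\<dots> = ennreal (1 - v) * ennreal (L * ?c)"
      using v by (intro ennreal_mult') auto
    finally show ?thesis
      using Suc.IH[OF ab'(1) ab(2) L meas s t] Suc.IH[OF ab(1) ab'(2) L meas s t]
      by (cases m) (auto simp: e_def r_def algebra_simps)
  qed
  have me[measurable]: "(\<lambda>v. e v m) \<in> borel_measurable borel" for m
    using P ab Suc.prems unfolding stick_recursive_def by (cases m) (auto simp: e_def[abs_def])
  have mr[measurable]: "(\<lambda>v. r v m) \<in> borel_measurable borel" for m
    using Q ab Suc.prems unfolding stick_recursive_def by (cases m) (auto simp: r_def[abs_def])
  have "(\<integral>\<^sup>+z. \<Phi> z \<partial>P a b) = (\<integral>\<^sup>+v. ennreal p * e v True + ennreal q * e v False \<partial>?B)"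
    using P ab Suc.prems unfolding stick_recursive_def by (simp add: e_def p_def q_def)
  also have "\<dots> \<le> (\<integral>\<^sup>+v. (ennreal p * r v True + ennreal q * r v False) + ennreal (1 - v) * ennreal (L * ?c) \<partial>?B)"
  proof (rule nn_integral_mono_AE, use AE_beta_law[of "1 - \<alpha>" "a + b + \<alpha>"] in eventually_elim)
    case (elim v)
    let ?d = "ennreal (1 - v) * ennreal (L * ?c)"
    have "ennreal p * e v True + ennreal q * e v False \<le> ennreal p * (r v True + ?d) + ennreal q * (r v False + ?d)"
      using elim by (intro add_mono mult_left_mono le) auto
    also have "\<dots> = (ennreal p * r v True + ennreal q * r v False) + (ennreal p + ennreal q) * ?d"
      by (simp add: distrib_left distrib_right add_ac)
    also have "ennreal p + ennreal q = 1"
      using pq by (simp flip: ennreal_plus)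
    finally show ?case by simp
  qed
  also have "\<dots> = (\<integral>\<^sup>+v. ennreal p * r v True + ennreal q * r v False \<partial>?B) +
      (\<integral>\<^sup>+v. ennreal (1 - v) * ennreal (L * ?c) \<partial>?B)"
    by (rule nn_integral_add) measurable
  also have "(\<integral>\<^sup>+v. ennreal p * r v True + ennreal q * r v False \<partial>?B) = (\<integral>\<^sup>+z. \<Phi> z \<partial>Q a b)"
    using Q ab Suc.prems unfolding stick_recursive_def by (simp add: r_def p_def q_def)
  also have "(\<integral>\<^sup>+v. ennreal (1 - v) * ennreal (L * ?c) \<partial>?B) = ennreal (L * mean_residual \<alpha> (Suc n) (a + b))"
  proof -
    have "(\<integral>\<^sup>+v. ennreal (1 - v) * ennreal (L * ?c) \<partial>?B) = ennreal ((a + b + \<alpha>) / (1 - \<alpha> + (a + b + \<alpha>))) * ennreal (L * ?c)"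
      using ab \<alpha> B.emeasure_space_1 by (subst nn_integral_beta_law_size_biased_complement) auto
    also have "\<dots> = ennreal ((a + b + \<alpha>) / (1 - \<alpha> + (a + b + \<alpha>)) * (L * ?c))"
      using ab \<alpha> by (intro ennreal_mult'[symmetric]) auto
    finally show ?thesis by (simp add: algebra_simps)
  qed
  finally show ?case .
qed

proposition stick_recursive_unique:
  assumes P: "stick_recursive \<alpha> P" and Q: "stick_recursive \<alpha> Q" and ab: "0 < a" "0 < b"
    and \<Phi>: "\<Phi> \<in> borel_measurable marked_space" "symmetric_functional \<Phi>"
    and L: "0 \<le> L" "\<And>n. tail_lipschitz n L \<Phi>"
  shows "(\<integral>\<^sup>+z. \<Phi> z \<partial>P a b) = (\<integral>\<^sup>+z. \<Phi> z \<partial>Q a b)"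
proof -
  have "(\<lambda>n. L * mean_residual \<alpha> n (a + b)) \<longlonglongrightarrow> L * 0"
    using ab \<alpha> by (intro tendsto_mult tendsto_const mean_residual_tendsto_0) auto
  then have lim: "(\<lambda>n. x + ennreal (L * mean_residual \<alpha> n (a + b))) \<longlonglongrightarrow> x + ennreal 0" for x
    by (intro tendsto_add tendsto_const tendsto_ennrealI) simp
  have "(\<integral>\<^sup>+z. \<Phi> z \<partial>P a b) \<le> (\<integral>\<^sup>+z. \<Phi> z \<partial>Q a b) + ennreal 0"
    by (rule LIMSEQ_le_const[OF lim]) (use stick_recursive_le[OF P Q ab L(1) \<Phi> L(2)] in blast)
  moreover have "(\<integral>\<^sup>+z. \<Phi> z \<partial>Q a b) \<le> (\<integral>\<^sup>+z. \<Phi> z \<partial>P a b) + ennreal 0"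
    by (rule LIMSEQ_le_const[OF lim]) (use stick_recursive_le[OF Q P ab L(1) \<Phi> L(2)] in blast)
  ultimately show ?thesis by simp
qed

end

section \<open>Splitting and marking satisfy the recursion\<close>

lemma nn_integral_triple:
  assumes "prob_space B" "prob_space C" and f: "f \<in> borel_measurable (A \<Otimes>\<^sub>M (B \<Otimes>\<^sub>M C))"
  shows "(\<integral>\<^sup>+w. f w \<partial>(A \<Otimes>\<^sub>M (B \<Otimes>\<^sub>M C))) = (\<integral>\<^sup>+x. \<integral>\<^sup>+y. \<integral>\<^sup>+z. f (x, y, z) \<partial>C \<partial>B \<partial>A)"
proof -
  interpret B: prob_space B by fact
  interpret C: prob_space C by fact
  interpret BC: pair_prob_space B C ..
  have "(\<integral>\<^sup>+w. f w \<partial>(A \<Otimes>\<^sub>M (B \<Otimes>\<^sub>M C))) = (\<integral>\<^sup>+x. \<integral>\<^sup>+w. f (x, w) \<partial>(B \<Otimes>\<^sub>M C) \<partial>A)"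
    by (rule BC.nn_integral_fst[symmetric]) fact
  also have "\<dots> = (\<integral>\<^sup>+x. \<integral>\<^sup>+y. \<integral>\<^sup>+z. f (x, y, z) \<partial>C \<partial>B \<partial>A)"
    by (intro nn_integral_cong C.nn_integral_fst[symmetric] measurable_compose[OF measurable_Pair1' f]) auto
  finally show ?thesis .
qed

lemma AE_triple:
  assumes ABC: "prob_space A" "prob_space B" "prob_space C"
    and P: "Measurable.pred (A \<Otimes>\<^sub>M (B \<Otimes>\<^sub>M C)) P"
    and AE: "AE x in A. AE y in B. AE z in C. P (x, y, z)"
  shows "AE w in A \<Otimes>\<^sub>M (B \<Otimes>\<^sub>M C). P w"
proof -
  interpret A: prob_space A by fact
  interpret B: prob_space B by fact
  interpret C: prob_space C by fact
  interpret BC: pair_prob_space B C ..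
  interpret ABC: pair_prob_space A "B \<Otimes>\<^sub>M C" ..
  have "AE x in A. AE w in B \<Otimes>\<^sub>M C. P (x, w)"
    using AE AE_space
  proof eventually_elim
    case (elim x)
    show ?case
      by (rule BC.AE_pair_measure) (use elim P in measurable)
  qed
  then show ?thesis
    by (intro ABC.AE_pair_measure) (use P in measurable)
qed

text \<open>
  Stated with a sum in \<open>ennreal\<close>, being a unit sequence is a measurable condition, and invariance of
  the total under permutations is immediate.
\<close>

lemma unit_sequence_iff_ennreal:
  "unit_sequence x \<longleftrightarrow> (\<forall>i. 0 < x i) \<and> (\<Sum>i. ennreal (x i)) = 1"
proof (cases "\<forall>i. 0 < x i")
  case True
  then have nn: "0 \<le> x i" for i by (simp add: less_imp_le)
  have "x sums 1 \<longleftrightarrow> (\<Sum>i. ennreal (x i)) = 1"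
  proof
    assume "x sums 1"
    from suminf_ennreal_eq[OF nn this] show "(\<Sum>i. ennreal (x i)) = 1"
      by simp
  next
    assume eq: "(\<Sum>i. ennreal (x i)) = 1"
    then have summ: "summable x"
      by (intro summable_suminf_not_top nn) simp
    have "ennreal (suminf x) = ennreal 1"
      using eq suminf_ennreal_eq[OF nn summable_sums[OF summ]] by simp
    then have "suminf x = 1"
      using suminf_nonneg[OF summ nn] by (subst (asm) ennreal_inj) auto
    then show "x sums 1"
      using summable_sums[OF summ] by simp
  qed
  then show ?thesis using True by (simp add: unit_sequence_def)
qed (auto simp: unit_sequence_def)

lemma measurable_unit_sequence[measurable]: "Measurable.pred seq_space unit_sequence"
  unfolding unit_sequence_iff_ennreal[abs_def] by measurable

lemma measurable_Pair_marked_space[measurable (raw)]: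
  assumes [measurable]: "f \<in> M \<rightarrow>\<^sub>M seq_space" "g \<in> M \<rightarrow>\<^sub>M mark_space"
  shows "(\<lambda>x. (f x, g x)) \<in> M \<rightarrow>\<^sub>M marked_space"
  unfolding marked_space_def by measurable

text \<open>
  The sticks of \<open>x\<close>, scaled to total length \<open>W\<close>, occupy the even positions, those of \<open>x'\<close>, scaled to
  \<open>1 - W\<close>, the odd positions; the predicate \<open>even\<close> then marks the sticks that come from \<open>x\<close>.
\<close>

definition merge_seq :: "real \<Rightarrow> (nat \<Rightarrow> real) \<Rightarrow> (nat \<Rightarrow> real) \<Rightarrow> nat \<Rightarrow> real" where
  "merge_seq W x x' n = (if even n then W * x (n div 2) else (1 - W) * x' (n div 2))"

lemma measurable_merge_seq[measurable (raw)]: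
  assumes [measurable]: "f \<in> borel_measurable M" "g \<in> M \<rightarrow>\<^sub>M seq_space" "h \<in> M \<rightarrow>\<^sub>M seq_space"
  shows "(\<lambda>w. merge_seq (f w) (g w) (h w)) \<in> M \<rightarrow>\<^sub>M seq_space"
  unfolding merge_seq_def[abs_def] by (rule measurable_seq_spaceI) measurable

lemma unit_sequence_merge_seq:
  assumes "0 < W" "W < 1" "unit_sequence x" "unit_sequence x'"
  shows "unit_sequence (merge_seq W x x')"
proof -
  have "(\<lambda>n. W * x n) sums (W * 1)" "(\<lambda>n. (1 - W) * x' n) sums ((1 - W) * 1)"
    using assms by (auto simp only: unit_sequence_def intro!: sums_mult)
  from sums_if[OF this(2) this(1)] 
  have "(\<lambda>n. if even n then W * x (n div 2) else (1 - W) * x' ((n - 1) div 2)) sums 1"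
    by simp
  moreover have "merge_seq W x x' = (\<lambda>n. if even n then W * x (n div 2) else (1 - W) * x' ((n - 1) div 2))"
    by (auto simp: fun_eq_iff merge_seq_def elim!: oddE)
  ultimately show ?thesis
    using assms by (auto simp: unit_sequence_def merge_seq_def)
qed

text \<open>
  Thresholds for the marks: \<open>u i < B\<close> is a Bernoulli variable with parameter \<open>B\<close>, and all success
  probabilities \<open>B\<close> share one probability space, which makes measurability in \<open>B\<close> evident.
\<close>

definition uniform_seq :: "(nat \<Rightarrow> real) measure" where
  "uniform_seq = PiM UNIV (\<lambda>_. uniform_measure lborel {0<..<1})"

lemma sets_uniform_seq[measurable_cong]: "sets uniform_seq = sets seq_space"
  unfolding uniform_seq_def sets_seq_space by (rule sets_PiM_cong) auto

lemma prob_space_uniform: "prob_space (uniform_measure lborel {0<..<1::real})"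
  by (rule prob_space_uniform_measure) auto

lemma prob_space_uniform_seq: "prob_space uniform_seq"
  unfolding uniform_seq_def by (intro prob_space_PiM prob_space_uniform)

lemma emeasure_uniform_less:
  assumes "0 \<le> B" "B \<le> 1"
  shows "emeasure (uniform_measure lborel {0<..<1}) {u. u < B} = ennreal B"
    and "emeasure (uniform_measure lborel {0<..<1}) {u. \<not> u < B} = ennreal (1 - B)"
proof -
  have "{0<..<1} \<inter> {u. u < B} = {0<..<B}" using assms by auto
  then show "emeasure (uniform_measure lborel {0<..<1}) {u. u < B} = ennreal B"
    using assms by (simp add: divide_ennreal_def)
  have "{0<..<1} \<inter> {u. \<not> u < B} = (if B = 0 then {0<..<1} else {B..<1})" using assms by auto
  then show "emeasure (uniform_measure lborel {0<..<1}) {u. \<not> u < B} = ennreal (1 - B)"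
    using assms by (simp add: divide_ennreal_def)
qed

lemma measurable_threshold[measurable (raw)]:
  assumes [measurable]: "f \<in> M \<rightarrow>\<^sub>M seq_space" "g \<in> borel_measurable M"
  shows "(\<lambda>x i. f x i < g x) \<in> M \<rightarrow>\<^sub>M mark_space"
  by (rule measurable_mark_spaceI) measurable

lemma nn_integral_threshold_rec:
  assumes B: "0 \<le> B" "B \<le> 1" and f[measurable]: "f \<in> borel_measurable mark_space"
  shows "(\<integral>\<^sup>+u. f (\<lambda>i. u i < B) \<partial>uniform_seq) =
     ennreal B * (\<integral>\<^sup>+u. f (case_nat True (\<lambda>i. u i < B)) \<partial>uniform_seq) +
     ennreal (1 - B) * (\<integral>\<^sup>+u. f (case_nat False (\<lambda>i. u i < B)) \<partial>uniform_seq)"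
proof -
  let ?U = "uniform_measure lborel {0<..<1::real}"
  define g where "g m = (\<integral>\<^sup>+u. f (case_nat m (\<lambda>i. u i < B)) \<partial>uniform_seq)" for m
  have m: "(\<lambda>u. f (\<lambda>i. u i < B)) \<in> borel_measurable uniform_seq"
    by measurable
  have *: "(\<lambda>i. (case i of 0 \<Rightarrow> x | Suc i \<Rightarrow> u i) < B) = case_nat (x < B) (\<lambda>i. u i < B)" for x u
    by (auto simp: fun_eq_iff split: nat.split)
  have "(\<integral>\<^sup>+u. f (\<lambda>i. u i < B) \<partial>uniform_seq) = (\<integral>\<^sup>+x. g (x < B) \<partial>?U)"
    using nn_integral_PiM_case_nat[OF prob_space_uniform m[unfolded uniform_seq_def]]
    by (simp add: g_def uniform_seq_def *)
  also have "\<dots> = (\<integral>\<^sup>+x. g True * indicator {u. u < B} x + g False * indicator {u. \<not> u < B} x \<partial>?U)"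
    by (intro nn_integral_cong) (auto split: split_indicator)
  also have "\<dots> = g True * emeasure ?U {u. u < B} + g False * emeasure ?U {u. \<not> u < B}"
    by (subst nn_integral_add) (auto simp: nn_integral_cmult_indicator)
  finally show ?thesis
    unfolding emeasure_uniform_less[OF B] g_def by (simp add: mult.commute)
qed

text \<open>
  Merging the marked sticks then gives a positive block and leaves infinitely many blocks, so that
  the result can be ranked.
\<close>

definition proper_marks :: "(nat \<Rightarrow> bool) \<Rightarrow> bool" where
  "proper_marks I \<longleftrightarrow> (\<exists>i. I i) \<and> infinite {i. \<not> I i}"

text \<open>
  The event that all thresholds from \<open>n\<close> on lie in \<open>S\<close> has probability at most \<open>c ^ N\<close> for every \<open>N\<close>.
\<close>

lemma AE_uniform_seq_infinitely_often:
  assumes S: "S \<in> sets borel" and c: "0 \<le> c" "c < 1" "emeasure (uniform_measure lborel {0<..<1}) S = ennreal c"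
  shows "AE u in uniform_seq. \<exists>i\<ge>n. u i \<notin> S"
proof -
  let ?U = "uniform_measure lborel {0<..<1::real}"
  interpret prob_space uniform_seq by (rule prob_space_uniform_seq)
  have [measurable]: "S \<in> sets borel" by fact
  let ?E = "{u \<in> space seq_space. \<forall>i\<ge>n. u i \<in> S}"
  have E[measurable]: "?E \<in> sets seq_space" by measurable
  have "emeasure uniform_seq ?E \<le> ennreal (c ^ N)" for N
  proof -
    let ?J = "{n..<n + N}"
    have "emeasure uniform_seq ?E \<le> emeasure uniform_seq (prod_emb UNIV (\<lambda>_. ?U) ?J (\<Pi>\<^sub>E j\<in>?J. S))"
    proof (rule emeasure_mono)
      show "?E \<subseteq> prod_emb UNIV (\<lambda>_. ?U) ?J (\<Pi>\<^sub>E j\<in>?J. S)"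
        by (auto simp: prod_emb_def)
      show "prod_emb UNIV (\<lambda>_. ?U) ?J (\<Pi>\<^sub>E j\<in>?J. S) \<in> sets uniform_seq"
        unfolding uniform_seq_def by (rule sets_PiM_I) auto
    qed
    also have "\<dots> = (\<Prod>j\<in>?J. emeasure ?U S)"
      unfolding uniform_seq_def by (rule emeasure_PiM_emb) (auto intro: prob_space_uniform)
    also have "\<dots> = ennreal (c ^ N)"
      using c by (simp add: ennreal_power)
    finally show ?thesis .
  qed
  moreover have "(\<lambda>N. ennreal (c ^ N)) \<longlonglongrightarrow> ennreal 0"
    using c by (intro tendsto_ennrealI LIMSEQ_realpow_zero) auto
  ultimately have "emeasure uniform_seq ?E \<le> ennreal 0"
    by (intro LIMSEQ_le_const) auto
  then have "emeasure uniform_seq ?E = 0" by simp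
  then have "?E \<in> null_sets uniform_seq"
    using E sets_uniform_seq by (auto simp: null_sets_def)
  from AE_not_in[OF this] show ?thesis
    by eventually_elim auto
qed

lemma AE_uniform_seq_proper_marks:
  assumes B: "0 < B" "B < 1"
  shows "AE u in uniform_seq. proper_marks (\<lambda>i. u i < B)"
proof -
  have "AE u in uniform_seq. \<exists>i\<ge>n. u i \<notin> {u. u < B}" for n
    by (rule AE_uniform_seq_infinitely_often[OF _ _ _ emeasure_uniform_less(1)]) (use B in auto)
  then have "AE u in uniform_seq. \<forall>n. \<exists>i\<ge>n. u i \<notin> {u. u < B}"
    by (subst AE_all_countable) auto
  moreover have "AE u in uniform_seq. \<exists>i\<ge>0. u i \<notin> {u. \<not> u < B}"
    by (rule AE_uniform_seq_infinitely_often[OF _ _ _ emeasure_uniform_less(2)]) (use B in auto)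
  ultimately show ?thesis
    by eventually_elim (auto simp: proper_marks_def infinite_nat_iff_unbounded_le)
qed

lemma measurable_proper_marks[measurable]: "Measurable.pred mark_space proper_marks"
  unfolding proper_marks_def[abs_def] infinite_nat_iff_unbounded_le mem_Collect_eq by measurable

text \<open>
  The law of the merging probability with \<open>a\<close> and \<open>b\<close> as free parameters; \<open>coag_parameter_law \<alpha> \<theta>\<close>
  is the case \<open>a = 1 - \<alpha>\<close>, \<open>b = \<theta> + \<alpha>\<close>.  It mixes i.i.d. marks into a Polya urn scheme with
  reinforcement \<open>\<alpha>\<close>, which degenerates to independent marks when \<open>\<alpha> = 0\<close>.
\<close>

definition success_law :: "real \<Rightarrow> real \<Rightarrow> real \<Rightarrow> real measure" where
  "success_law \<alpha> a b = (if \<alpha> = 0 then return borel (a / (a + b)) else beta_law (a / \<alpha>) (b / \<alpha>))"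

lemma sets_success_law[measurable_cong, simp]: "sets (success_law \<alpha> a b) = sets borel"
  by (simp add: success_law_def)

text \<open>
  Sticks with parameter \<open>a + b\<close> that are marked independently, given the random success probability.
\<close>

definition mark_law :: "real \<Rightarrow> real \<Rightarrow> real \<Rightarrow> marked_seq measure" where
  "mark_law \<alpha> a b = distr (GEM \<alpha> (a + b) \<Otimes>\<^sub>M (success_law \<alpha> a b \<Otimes>\<^sub>M uniform_seq)) marked_space
     (\<lambda>(y, B, u). (y, \<lambda>i. u i < B))"

text \<open>
  A unit length split into \<open>W\<close> and \<open>1 - W\<close>, the two parts broken independently with parameters \<open>a\<close> and \<open>b\<close>;
  marks record the part of origin.
\<close>

definition split_law :: "real \<Rightarrow> real \<Rightarrow> real \<Rightarrow> marked_seq measure" where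
  "split_law \<alpha> a b = distr (beta_law a b \<Otimes>\<^sub>M (GEM \<alpha> a \<Otimes>\<^sub>M GEM \<alpha> b)) marked_space
     (\<lambda>(W, x, x'). (merge_seq W x x', even))"

lemma sets_mark_law[measurable_cong, simp]: "sets (mark_law \<alpha> a b) = sets marked_space"
  by (simp add: mark_law_def)

lemma sets_split_law[measurable_cong, simp]: "sets (split_law \<alpha> a b) = sets marked_space"
  by (simp add: split_law_def)

lemma measurable_mark_law_map[measurable]: "(\<lambda>(y, B, u). (y, \<lambda>i. u i < B)) \<in>
    (GEM \<alpha> (a + b) \<Otimes>\<^sub>M (success_law \<alpha> a b \<Otimes>\<^sub>M uniform_seq)) \<rightarrow>\<^sub>M marked_space"
  unfolding marked_space_def by measurable

lemma measurable_split_law_map[measurable]: "(\<lambda>(W, x, x'). (merge_seq W x x', even)) \<in>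
    (beta_law a b \<Otimes>\<^sub>M (GEM \<alpha> a \<Otimes>\<^sub>M GEM \<alpha> b)) \<rightarrow>\<^sub>M marked_space"
  unfolding marked_space_def by measurable

context
  fixes \<alpha> :: real
  assumes \<alpha>: "0 \<le> \<alpha>" "\<alpha> < 1"
begin

lemma prob_space_success_law: "0 < a \<Longrightarrow> 0 < b \<Longrightarrow> prob_space (success_law \<alpha> a b)"
  using \<alpha> by (auto simp: success_law_def intro!: prob_space_return prob_space_beta_law)

lemma AE_success_law: "0 < a \<Longrightarrow> 0 < b \<Longrightarrow> AE B in success_law \<alpha> a b. 0 < B \<and> B < 1"
proof (cases "\<alpha> = 0")
  case True
  assume "0 < a" "0 < b"
  then have ab: "0 < a / (a + b)" "a / (a + b) < 1" by auto
  have "success_law \<alpha> a b = return borel (a / (a + b))" by (simp add: success_law_def True)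
  then show ?thesis using ab by (simp only:) (subst AE_return, auto)
next
  case False
  then have "success_law \<alpha> a b = beta_law (a / \<alpha>) (b / \<alpha>)" by (simp add: success_law_def)
  then show ?thesis by (simp only: AE_beta_law)
qed

text \<open>
  One observed mark updates the urn: success replaces \<open>a\<close> by \<open>a + \<alpha>\<close>, failure replaces \<open>b\<close> by
  \<open>b + \<alpha>\<close>.
\<close>

lemma nn_integral_success_law:
  assumes ab: "0 < a" "0 < b" and [measurable]: "f \<in> borel_measurable borel"
  shows "(\<integral>\<^sup>+B. ennreal B * f B \<partial>success_law \<alpha> a b) = ennreal (a / (a + b)) * (\<integral>\<^sup>+B. f B \<partial>success_law \<alpha> (a + \<alpha>) b)"
    and "(\<integral>\<^sup>+B. ennreal (1 - B) * f B \<partial>success_law \<alpha> a b) = ennreal (b / (a + b)) * (\<integral>\<^sup>+B. f B \<partial>success_law \<alpha> a (b + \<alpha>))"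
proof -
  have "(\<integral>\<^sup>+B. ennreal B * f B \<partial>success_law \<alpha> a b) = ennreal (a / (a + b)) * (\<integral>\<^sup>+B. f B \<partial>success_law \<alpha> (a + \<alpha>) b) \<and>
    (\<integral>\<^sup>+B. ennreal (1 - B) * f B \<partial>success_law \<alpha> a b) = ennreal (b / (a + b)) * (\<integral>\<^sup>+B. f B \<partial>success_law \<alpha> a (b + \<alpha>))"
  proof (cases "\<alpha> = 0")
    case True
    have "1 - a / (a + b) = b / (a + b)" using ab by (simp add: field_simps)
    then show ?thesis using True by (simp add: success_law_def nn_integral_return)
  next
    case False
    then have pos: "0 < a / \<alpha>" "0 < b / \<alpha>" using \<alpha> ab by auto
    have e: "a / \<alpha> / (a / \<alpha> + b / \<alpha>) = a / (a + b)" "b / \<alpha> / (a / \<alpha> + b / \<alpha>) = b / (a + b)"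
      "a / \<alpha> + 1 = (a + \<alpha>) / \<alpha>" "b / \<alpha> + 1 = (b + \<alpha>) / \<alpha>"
      using False by (simp_all add: add_divide_distrib[symmetric], simp_all add: add_divide_distrib)
    show ?thesis
      using False nn_integral_beta_law_size_biased[OF pos assms(3), unfolded e]
        nn_integral_beta_law_size_biased_complement[OF pos assms(3), unfolded e]
      by (simp add: success_law_def)
  qed
  then show "(\<integral>\<^sup>+B. ennreal B * f B \<partial>success_law \<alpha> a b) = ennreal (a / (a + b)) * (\<integral>\<^sup>+B. f B \<partial>success_law \<alpha> (a + \<alpha>) b)"
    "(\<integral>\<^sup>+B. ennreal (1 - B) * f B \<partial>success_law \<alpha> a b) = ennreal (b / (a + b)) * (\<integral>\<^sup>+B. f B \<partial>success_law \<alpha> a (b + \<alpha>))"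
    by auto
qed

lemma nn_integral_mark_law:
  assumes ab: "0 < a" "0 < b" and [measurable]: "\<Phi> \<in> borel_measurable marked_space"
  shows "(\<integral>\<^sup>+z. \<Phi> z \<partial>mark_law \<alpha> a b) =
    (\<integral>\<^sup>+y. \<integral>\<^sup>+B. \<integral>\<^sup>+u. \<Phi> (y, \<lambda>i. u i < B) \<partial>uniform_seq \<partial>success_law \<alpha> a b \<partial>GEM \<alpha> (a + b))"
proof -
  have "(\<integral>\<^sup>+z. \<Phi> z \<partial>mark_law \<alpha> a b) =
     (\<integral>\<^sup>+w. \<Phi> ((\<lambda>(y, B, u). (y, \<lambda>i. u i < B)) w) \<partial>(GEM \<alpha> (a + b) \<Otimes>\<^sub>M (success_law \<alpha> a b \<Otimes>\<^sub>M uniform_seq)))"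
    unfolding mark_law_def by (rule nn_integral_distr) measurable
  also have "\<dots> = (\<integral>\<^sup>+y. \<integral>\<^sup>+B. \<integral>\<^sup>+u. \<Phi> (y, \<lambda>i. u i < B) \<partial>uniform_seq \<partial>success_law \<alpha> a b \<partial>GEM \<alpha> (a + b))"
    using ab by (subst nn_integral_triple) (auto intro!: prob_space_success_law prob_space_uniform_seq)
  finally show ?thesis .
qed

lemma nn_integral_split_law:
  assumes ab: "0 < a" "0 < b" and [measurable]: "\<Phi> \<in> borel_measurable marked_space"
  shows "(\<integral>\<^sup>+z. \<Phi> z \<partial>split_law \<alpha> a b) =
    (\<integral>\<^sup>+W. \<integral>\<^sup>+x. \<integral>\<^sup>+x'. \<Phi> (merge_seq W x x', even) \<partial>GEM \<alpha> b \<partial>GEM \<alpha> a \<partial>beta_law a b)"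
proof -
  have "(\<integral>\<^sup>+z. \<Phi> z \<partial>split_law \<alpha> a b) =
     (\<integral>\<^sup>+w. \<Phi> ((\<lambda>(W, x, x'). (merge_seq W x x', even)) w) \<partial>(beta_law a b \<Otimes>\<^sub>M (GEM \<alpha> a \<Otimes>\<^sub>M GEM \<alpha> b)))"
    unfolding split_law_def by (rule nn_integral_distr) measurable
  also have "\<dots> = (\<integral>\<^sup>+W. \<integral>\<^sup>+x. \<integral>\<^sup>+x'. \<Phi> (merge_seq W x x', even) \<partial>GEM \<alpha> b \<partial>GEM \<alpha> a \<partial>beta_law a b)"
    using ab \<alpha> by (subst nn_integral_triple) (auto intro!: prob_space_GEM)
  finally show ?thesis .
qed

lemma prob_space_mark_law: "0 < a \<Longrightarrow> 0 < b \<Longrightarrow> prob_space (mark_law \<alpha> a b)"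
  unfolding mark_law_def using \<alpha>
  by (intro prob_space.prob_space_distr measurable_mark_law_map prob_space_pair prob_space_GEM
      prob_space_success_law prob_space_uniform_seq) auto

lemma prob_space_split_law: "0 < a \<Longrightarrow> 0 < b \<Longrightarrow> prob_space (split_law \<alpha> a b)"
  unfolding split_law_def using \<alpha>
  by (intro prob_space.prob_space_distr measurable_split_law_map prob_space_pair prob_space_GEM
      prob_space_beta_law) auto

lemma AE_mark_law_proper:
  assumes ab: "0 < a" "0 < b"
  shows "AE z in mark_law \<alpha> a b. unit_sequence (fst z) \<and> proper_marks (snd z)"
proof -
  interpret S: prob_space "success_law \<alpha> a b" by (rule prob_space_success_law) fact+
  interpret U: prob_space uniform_seq by (rule prob_space_uniform_seq)
  interpret G: prob_space "GEM \<alpha> (a + b)" by (rule prob_space_GEM) (use \<alpha> ab in auto)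
  have "AE y in GEM \<alpha> (a + b). unit_sequence y"
    by (rule AE_GEM_unit_sequence) (use \<alpha> ab in auto)
  then have "AE y in GEM \<alpha> (a + b). AE B in success_law \<alpha> a b. AE u in uniform_seq.
      unit_sequence y \<and> proper_marks (\<lambda>i. u i < B)"
  proof eventually_elim
    case (elim y)
    show ?case using AE_success_law[OF ab]
    proof eventually_elim
      case (elim B)
      then show ?case using AE_uniform_seq_proper_marks[of B] \<open>unit_sequence y\<close> by auto
    qed
  qed
  then have "AE w in GEM \<alpha> (a + b) \<Otimes>\<^sub>M (success_law \<alpha> a b \<Otimes>\<^sub>M uniform_seq).
      unit_sequence (fst w) \<and> proper_marks (\<lambda>i. snd (snd w) i < fst (snd w))"
    by (intro AE_triple) (auto intro: G.prob_space_axioms S.prob_space_axioms U.prob_space_axioms)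
  moreover have "{z \<in> space marked_space. unit_sequence (fst z) \<and> proper_marks (snd z)} \<in> sets marked_space"
    by measurable
  ultimately show ?thesis
    unfolding mark_law_def by (subst AE_distr_iff[OF measurable_mark_law_map]) (auto simp: case_prod_beta')
qed

lemma AE_split_law_proper:
  assumes ab: "0 < a" "0 < b"
  shows "AE z in split_law \<alpha> a b. unit_sequence (fst z) \<and> proper_marks (snd z)"
proof -
  interpret A: prob_space "GEM \<alpha> a" by (rule prob_space_GEM) (use \<alpha> ab in auto)
  interpret B: prob_space "GEM \<alpha> b" by (rule prob_space_GEM) (use \<alpha> ab in auto)
  interpret W: prob_space "beta_law a b" by (rule prob_space_beta_law) fact+
  have x: "AE x in GEM \<alpha> a. unit_sequence x" and x': "AE x in GEM \<alpha> b. unit_sequence x"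
    by (rule AE_GEM_unit_sequence; use \<alpha> ab in simp)+
  have "infinite {i::nat. odd i}"
    unfolding infinite_nat_iff_unbounded_le by (metis even_Suc le_Suc_eq mem_Collect_eq order_refl)
  then have even: "proper_marks even" by (auto simp: proper_marks_def)
  have "AE W in beta_law a b. AE x in GEM \<alpha> a. AE x' in GEM \<alpha> b. unit_sequence (merge_seq W x x')"
    using AE_beta_law
  proof eventually_elim
    case (elim W)
    show ?case using x
    proof eventually_elim
      case (elim x)
      show ?case using x'
        by eventually_elim (use \<open>0 < W \<and> W < 1\<close> \<open>unit_sequence x\<close> in \<open>auto intro: unit_sequence_merge_seq\<close>)
    qed
  qed
  then have "AE w in beta_law a b \<Otimes>\<^sub>M (GEM \<alpha> a \<Otimes>\<^sub>M GEM \<alpha> b). unit_sequence (merge_seq (fst w) (fst (snd w)) (snd (snd w)))"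
    by (intro AE_triple) (auto intro: A.prob_space_axioms B.prob_space_axioms W.prob_space_axioms)
  moreover have "{z \<in> space marked_space. unit_sequence (fst z) \<and> proper_marks (snd z)} \<in> sets marked_space"
    by measurable
  ultimately show ?thesis
    using even unfolding split_law_def
    by (subst AE_distr_iff[OF measurable_split_law_map]) (auto simp: case_prod_beta')
qed

text \<open>
  The first stick comes from the GEM recursion, its mark from the first threshold, and conditioning
  on that mark is the urn update of \<open>success_law\<close>.
\<close>

lemma stick_recursive_mark_law: "stick_recursive \<alpha> (mark_law \<alpha>)"
  unfolding stick_recursive_def
proof (intro allI impI conjI ballI)
  fix a b :: real assume ab: "0 < a" "0 < b"
  then have ab': "0 < a + \<alpha>" "0 < b + \<alpha>" using \<alpha> by auto
  interpret U: prob_space uniform_seq by (rule prob_space_uniform_seq)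
  interpret T: prob_space "mark_law \<alpha> (a + \<alpha>) b" by (rule prob_space_mark_law) fact+
  interpret F: prob_space "mark_law \<alpha> a (b + \<alpha>)" by (rule prob_space_mark_law) fact+
  interpret S: prob_space "success_law \<alpha> a b" by (rule prob_space_success_law) fact+
  interpret ST: prob_space "success_law \<alpha> (a + \<alpha>) b" by (rule prob_space_success_law) fact+
  interpret SF: prob_space "success_law \<alpha> a (b + \<alpha>)" by (rule prob_space_success_law) fact+
  interpret G: prob_space "GEM \<alpha> (a + b)" by (rule prob_space_GEM) (use \<alpha> ab in auto)
  show "prob_space (mark_law \<alpha> a b)" by (rule prob_space_mark_law) fact+
  show "sets (mark_law \<alpha> a b) = sets marked_space" by simp
  show "AE z in mark_law \<alpha> a b. unit_sequence (fst z)"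
    using AE_mark_law_proper[OF ab] by eventually_elim simp
  fix \<Phi> :: "marked_seq \<Rightarrow> ennreal"
  assume \<Phi>[measurable]: "\<Phi> \<in> borel_measurable marked_space"
  show "(\<lambda>v. \<integral>\<^sup>+z. \<Phi> (extend_marked v True z) \<partial>mark_law \<alpha> (a + \<alpha>) b) \<in> borel_measurable borel"
    by measurable
  show "(\<lambda>v. \<integral>\<^sup>+z. \<Phi> (extend_marked v False z) \<partial>mark_law \<alpha> a (b + \<alpha>)) \<in> borel_measurable borel"
    by measurable
  let ?g = "\<lambda>v m y B. \<integral>\<^sup>+u. \<Phi> (extend_marked v m (y, \<lambda>i. u i < B)) \<partial>uniform_seq"
  have K: "(\<integral>\<^sup>+B. \<integral>\<^sup>+u. \<Phi> (prepend_stick v y, \<lambda>i. u i < B) \<partial>uniform_seq \<partial>success_law \<alpha> a b) =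
     ennreal (a / (a + b)) * (\<integral>\<^sup>+B. ?g v True y B \<partial>success_law \<alpha> (a + \<alpha>) b) +
     ennreal (b / (a + b)) * (\<integral>\<^sup>+B. ?g v False y B \<partial>success_law \<alpha> a (b + \<alpha>))" for v y
  proof -
    have "(\<integral>\<^sup>+B. \<integral>\<^sup>+u. \<Phi> (prepend_stick v y, \<lambda>i. u i < B) \<partial>uniform_seq \<partial>success_law \<alpha> a b) =
      (\<integral>\<^sup>+B. ennreal B * ?g v True y B + ennreal (1 - B) * ?g v False y B \<partial>success_law \<alpha> a b)"
    proof (rule nn_integral_cong_AE, use AE_success_law[OF ab] in eventually_elim)
      case (elim B)
      have "(\<lambda>I. \<Phi> (prepend_stick v y, I)) \<in> borel_measurable mark_space"
        by (rule measurable_compose[OF _ \<Phi>]) (simp add: marked_space_def)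
      from nn_integral_threshold_rec[OF _ _ this, of B] show ?case
        using elim by (simp add: extend_marked_def)
    qed
    also have "\<dots> = (\<integral>\<^sup>+B. ennreal B * ?g v True y B \<partial>success_law \<alpha> a b) + (\<integral>\<^sup>+B. ennreal (1 - B) * ?g v False y B \<partial>success_law \<alpha> a b)"
      by (rule nn_integral_add) measurable
    finally show ?thesis
      by (simp add: nn_integral_success_law[OF ab])
  qed
  have e: "a + \<alpha> + b = a + b + \<alpha>" "a + (b + \<alpha>) = a + b + \<alpha>" by auto
  have "(\<integral>\<^sup>+z. \<Phi> z \<partial>mark_law \<alpha> a b) = 
    (\<integral>\<^sup>+y. \<integral>\<^sup>+B. \<integral>\<^sup>+u. \<Phi> (y, \<lambda>i. u i < B) \<partial>uniform_seq \<partial>success_law \<alpha> a b \<partial>GEM \<alpha> (a + b))"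
    by (rule nn_integral_mark_law[OF ab \<Phi>])
  also have "\<dots> = (\<integral>\<^sup>+v. \<integral>\<^sup>+y. \<integral>\<^sup>+B. \<integral>\<^sup>+u. \<Phi> (prepend_stick v y, \<lambda>i. u i < B) \<partial>uniform_seq \<partial>success_law \<alpha> a b \<partial>GEM \<alpha> (a + b + \<alpha>)
      \<partial>beta_law (1 - \<alpha>) (a + b + \<alpha>))"
    using \<alpha> ab by (intro nn_integral_GEM_rec) auto
  also have "\<dots> = (\<integral>\<^sup>+v. ennreal (a / (a + b)) * (\<integral>\<^sup>+z. \<Phi> (extend_marked v True z) \<partial>mark_law \<alpha> (a + \<alpha>) b) +
      ennreal (b / (a + b)) * (\<integral>\<^sup>+z. \<Phi> (extend_marked v False z) \<partial>mark_law \<alpha> a (b + \<alpha>)) \<partial>beta_law (1 - \<alpha>) (a + b + \<alpha>))"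
    unfolding K using ab ab'
    by (intro nn_integral_cong) (simp add: nn_integral_add nn_integral_cmult nn_integral_mark_law e)
  finally show "(\<integral>\<^sup>+z. \<Phi> z \<partial>mark_law \<alpha> a b) = \<dots>" .
qed

text \<open>
  The conditional expectation of \<open>\<Phi>\<close> given the size \<open>W\<close> of the marked part.
\<close>

definition split_kernel :: "real \<Rightarrow> real \<Rightarrow> (marked_seq \<Rightarrow> ennreal) \<Rightarrow> real \<Rightarrow> ennreal" where
  "split_kernel a b \<Phi> W = (\<integral>\<^sup>+x. \<integral>\<^sup>+x'. \<Phi> (merge_seq W x x', even) \<partial>GEM \<alpha> b \<partial>GEM \<alpha> a)"

lemma measurable_split_kernel[measurable]:
  assumes "0 < a" "0 < b" and [measurable]: "\<Phi> \<in> borel_measurable marked_space"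
  shows "split_kernel a b \<Phi> \<in> borel_measurable borel"
proof -
  interpret A: prob_space "GEM \<alpha> a" by (rule prob_space_GEM) (use \<alpha> assms in auto)
  interpret B: prob_space "GEM \<alpha> b" by (rule prob_space_GEM) (use \<alpha> assms in auto)
  show ?thesis unfolding split_kernel_def[abs_def] by measurable
qed

definition flip_marks :: "marked_seq \<Rightarrow> marked_seq" where
  "flip_marks z = (fst z, \<lambda>i. \<not> snd z i)"

lemma measurable_flip_marks[measurable]: "flip_marks \<in> marked_space \<rightarrow>\<^sub>M marked_space"
proof -
  have "(\<lambda>z. (fst z, \<lambda>i. \<not> snd z i)) \<in> seq_space \<Otimes>\<^sub>M mark_space \<rightarrow>\<^sub>M seq_space \<Otimes>\<^sub>M mark_space"
    by (intro measurable_Pair measurable_fst measurable_mark_spaceI) measurable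
  then show ?thesis unfolding flip_marks_def[abs_def] marked_space_def .
qed

lemma symmetric_functional_flip: "symmetric_functional \<Phi> \<Longrightarrow> symmetric_functional (\<lambda>z. \<Phi> (flip_marks z))"
proof (unfold symmetric_functional_def, intro allI impI)
  fix y :: "nat \<Rightarrow> real" and I :: "nat \<Rightarrow> bool" and p :: "nat \<Rightarrow> nat"
  assume "\<forall>y I p. bij p \<longrightarrow> \<Phi> (y \<circ> p, I \<circ> p) = \<Phi> (y, I)" "bij p"
  then have "\<Phi> (y \<circ> p, (\<lambda>i. \<not> I i) \<circ> p) = \<Phi> (y, \<lambda>i. \<not> I i)" by blast
  then show "\<Phi> (flip_marks (y \<circ> p, I \<circ> p)) = \<Phi> (flip_marks (y, I))"
    by (simp add: flip_marks_def comp_def)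
qed

text \<open>
  Exchanging the roles of the two parts reverses the marks; up to the order of the sticks nothing
  else changes.  This reduces the case of an unmarked first stick to that of a marked one.
\<close>

lemma split_kernel_flip:
  assumes ab: "0 < a" "0 < b" and [measurable]: "\<Phi> \<in> borel_measurable marked_space"
    and sym: "symmetric_functional \<Phi>"
  shows "split_kernel a b \<Phi> (1 - V) = split_kernel b a (\<lambda>z. \<Phi> (flip_marks z)) V"
proof -
  interpret A: prob_space "GEM \<alpha> a" by (rule prob_space_GEM) (use \<alpha> assms in auto)
  interpret B: prob_space "GEM \<alpha> b" by (rule prob_space_GEM) (use \<alpha> assms in auto)
  interpret BA: pair_prob_space "GEM \<alpha> b" "GEM \<alpha> a" ..
  define p where "p n = (if even n then n + 1 else n - 1)" for n :: nat
  have p: "bij p"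
    by (rule involuntory_imp_bij) (auto simp: p_def elim!: oddE)
  have "\<Phi> (merge_seq (1 - V) x x', even) = \<Phi> (flip_marks (merge_seq V x' x, even))" for x x'
  proof -
    have "merge_seq V x' x = merge_seq (1 - V) x x' \<circ> p"
      by (auto simp: fun_eq_iff merge_seq_def p_def elim!: oddE)
    moreover have "(\<lambda>i. \<not> even i) = even \<circ> p"
      by (auto simp: fun_eq_iff p_def)
    ultimately show ?thesis
      using sym p by (simp add: symmetric_functional_def flip_marks_def)
  qed
  then have "split_kernel a b \<Phi> (1 - V) =
     (\<integral>\<^sup>+x. \<integral>\<^sup>+x'. \<Phi> (flip_marks (merge_seq V x' x, even)) \<partial>GEM \<alpha> b \<partial>GEM \<alpha> a)"
    by (simp add: split_kernel_def)
  also have "\<dots> = split_kernel b a (\<lambda>z. \<Phi> (flip_marks z)) V"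
    unfolding split_kernel_def by (rule BA.Fubini') measurable
  finally show ?thesis .
qed

lemma nn_integral_split_law_flip:
  assumes ab: "0 < a" "0 < b" and [measurable]: "\<Phi> \<in> borel_measurable marked_space"
    and sym: "symmetric_functional \<Phi>"
  shows "(\<integral>\<^sup>+z. \<Phi> (flip_marks z) \<partial>split_law \<alpha> b a) = (\<integral>\<^sup>+z. \<Phi> z \<partial>split_law \<alpha> a b)"
proof -
  have "(\<integral>\<^sup>+z. \<Phi> (flip_marks z) \<partial>split_law \<alpha> b a) = (\<integral>\<^sup>+V. split_kernel a b \<Phi> (1 - V) \<partial>beta_law b a)"
    using ab by (simp add: nn_integral_split_law split_kernel_flip[OF ab _ sym]) (simp add: split_kernel_def)
  also have "\<dots> = (\<integral>\<^sup>+W. split_kernel a b \<Phi> W \<partial>beta_law a b)"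
    using ab by (intro nn_integral_beta_law_reflect) measurable
  finally show ?thesis
    using ab by (simp add: nn_integral_split_law split_kernel_def)
qed

text \<open>
  Expose the first stick \<open>u\<close> of the marked part, after \<open>W\<close> has been size-biased.  Its absolute length
  is \<open>W * u\<close>, and what remains of the marked part has relative size \<open>W * (1 - u) / (1 - W * u)\<close>.
  By the beta algebra these are independent beta variables with the parameters that the recursion
  asks for.
\<close>

lemma nn_integral_split_kernel:
  assumes ab: "0 < a" "0 < b" and \<Phi>[measurable]: "\<Phi> \<in> borel_measurable marked_space"
    and sym: "symmetric_functional \<Phi>"
  shows "(\<integral>\<^sup>+W. split_kernel a b \<Phi> W \<partial>beta_law (a + 1) b) =
     (\<integral>\<^sup>+v. \<integral>\<^sup>+z. \<Phi> (extend_marked v True z) \<partial>split_law \<alpha> (a + \<alpha>) b \<partial>beta_law (1 - \<alpha>) (a + b + \<alpha>))"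
proof -
  have ab': "0 < a + \<alpha>" "0 < 1 - \<alpha>" using ab \<alpha> by auto
  interpret A: prob_space "GEM \<alpha> a" by (rule prob_space_GEM) (use \<alpha> assms in auto)
  interpret A': prob_space "GEM \<alpha> (a + \<alpha>)" by (rule prob_space_GEM) (use \<alpha> assms in auto)
  interpret B: prob_space "GEM \<alpha> b" by (rule prob_space_GEM) (use \<alpha> assms in auto)
  \<comment> \<open>The exposed stick sits at position 0 of the merged sequence; when it is listed in front of a newly
      merged sequence, the later marked sticks move by two positions and the unmarked ones stay.\<close>
  define p where "p = case_nat 0 (\<lambda>m::nat. if even m then m + 2 else m)"
  define g where "g v w = split_kernel (a + \<alpha>) b (\<lambda>z. \<Phi> (extend_marked v True z)) w" for v w
  have gm: "(\<lambda>(v, w). g v w) \<in> borel_measurable (borel \<Otimes>\<^sub>M borel)"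
    unfolding g_def split_kernel_def by measurable
  have p: "bij p"
  proof (rule o_bij)
    let ?q = "\<lambda>n::nat. if n = 0 then 0 else if even n then n - 1 else n + 1"
    show "?q \<circ> p = id" by (auto simp: fun_eq_iff p_def split: nat.split intro: odd_pos)
    show "p \<circ> ?q = id"
    proof
      fix n show "(p \<circ> ?q) n = id n"
      proof (cases n)
        case (Suc m)
        show ?thesis
        proof (cases "even m")
          case False
          then obtain k where "m = Suc k" "even k" by (cases m) auto
          then show ?thesis using Suc by (simp add: p_def)
        qed (use Suc in \<open>simp add: p_def\<close>)
      qed (simp add: p_def)
    qed
  qed
  have point: "\<Phi> (merge_seq W (prepend_stick u x) x', even) =
      \<Phi> (extend_marked (W * u) True (merge_seq (W * (1 - u) / (1 - W * u)) x x', even))"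
    if W: "0 < W" "W < 1" and u: "0 < u" "u < 1" for W u x x'
  proof -
    have "W * u < 1 * 1" using W u by (intro mult_strict_mono) auto
    then have Wu: "1 - W * u \<noteq> 0" by simp
    define w where "w = W * (1 - u) / (1 - W * u)"
    have w: "(1 - W * u) * w = W * (1 - u)" "(1 - W * u) * (1 - w) = 1 - W"
      using Wu by (auto simp: w_def field_simps)
    have "prepend_stick (W * u) (merge_seq w x x') = merge_seq W (prepend_stick u x) x' \<circ> p"
    proof
      fix n show "prepend_stick (W * u) (merge_seq w x x') n = (merge_seq W (prepend_stick u x) x' \<circ> p) n"
      proof (cases n)
        case (Suc m)
        show ?thesis
        proof (cases "even m")
          case True
          then obtain k where "m = 2 * k" by (elim evenE)
          then show ?thesis using Suc w(1)
            by (simp add: p_def merge_seq_def mult.assoc[symmetric])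
        next
          case False
          then show ?thesis using Suc w(2)
            by (simp add: p_def merge_seq_def mult.assoc[symmetric])
        qed
      qed (simp add: p_def merge_seq_def)
    qed
    moreover have "case_nat True even = even \<circ> p"
      by (auto simp: fun_eq_iff p_def split: nat.split)
    ultimately show ?thesis
      using sym p by (simp add: symmetric_functional_def extend_marked_def w_def)
  qed
  have "(\<integral>\<^sup>+W. split_kernel a b \<Phi> W \<partial>beta_law (a + 1) b) =
    (\<integral>\<^sup>+W. \<integral>\<^sup>+u. \<integral>\<^sup>+x. \<integral>\<^sup>+x'. \<Phi> (merge_seq W (prepend_stick u x) x', even) \<partial>GEM \<alpha> b \<partial>GEM \<alpha> (a + \<alpha>)
       \<partial>beta_law (1 - \<alpha>) (a + \<alpha>) \<partial>beta_law (a + 1) b)"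
    unfolding split_kernel_def using ab'
    by (intro nn_integral_cong nn_integral_GEM_rec[OF \<alpha>]) measurable
  also have "\<dots> = (\<integral>\<^sup>+W. \<integral>\<^sup>+u. g (W * u) (W * (1 - u) / (1 - W * u)) \<partial>beta_law (1 - \<alpha>) (a + \<alpha>) \<partial>beta_law (a + 1) b)"
  proof (rule nn_integral_cong_AE, use AE_beta_law[of "a + 1" b] in eventually_elim)
    case (elim W)
    show ?case
    proof (rule nn_integral_cong_AE, use AE_beta_law[of "1 - \<alpha>" "a + \<alpha>"] in eventually_elim)
      case (elim u)
      then show ?case
        using \<open>0 < W \<and> W < 1\<close> by (simp add: g_def split_kernel_def point)
    qed
  qed
  also have "\<dots> = (\<integral>\<^sup>+v. \<integral>\<^sup>+w. g v w \<partial>beta_law (a + \<alpha>) b \<partial>beta_law (1 - \<alpha>) (a + \<alpha> + b))"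
    using nn_integral_beta_split[OF ab'(2) ab'(1) ab(2) gm] by (simp add: add.commute)
  also have "\<dots> = (\<integral>\<^sup>+v. \<integral>\<^sup>+z. \<Phi> (extend_marked v True z) \<partial>split_law \<alpha> (a + \<alpha>) b \<partial>beta_law (1 - \<alpha>) (a + b + \<alpha>))"
    using ab' ab by (simp add: nn_integral_split_law g_def split_kernel_def add_ac)
  finally show ?thesis .
qed

text \<open>
  Write \<open>1 = W + (1 - W)\<close>.  The term with factor \<open>W\<close> exposes a marked stick, the term with factor
  \<open>1 - W\<close> an unmarked one.
\<close>

lemma stick_recursive_split_law: "stick_recursive \<alpha> (split_law \<alpha>)"
  unfolding stick_recursive_def
proof (intro allI impI conjI ballI)
  fix a b :: real assume ab: "0 < a" "0 < b"
  then have ab': "0 < a + \<alpha>" "0 < b + \<alpha>" using \<alpha> by auto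
  interpret T: prob_space "split_law \<alpha> (a + \<alpha>) b" by (rule prob_space_split_law) fact+
  interpret F: prob_space "split_law \<alpha> a (b + \<alpha>)" by (rule prob_space_split_law) fact+
  show "prob_space (split_law \<alpha> a b)" by (rule prob_space_split_law) fact+
  show "sets (split_law \<alpha> a b) = sets marked_space" by simp
  show "AE z in split_law \<alpha> a b. unit_sequence (fst z)"
    using AE_split_law_proper[OF ab] by eventually_elim simp
  fix \<Phi> :: "marked_seq \<Rightarrow> ennreal"
  assume \<Phi>[measurable]: "\<Phi> \<in> borel_measurable marked_space" and sym: "symmetric_functional \<Phi>"
  show mT[measurable]: "(\<lambda>v. \<integral>\<^sup>+z. \<Phi> (extend_marked v True z) \<partial>split_law \<alpha> (a + \<alpha>) b) \<in> borel_measurable borel"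
    by measurable
  show mF[measurable]: "(\<lambda>v. \<integral>\<^sup>+z. \<Phi> (extend_marked v False z) \<partial>split_law \<alpha> a (b + \<alpha>)) \<in> borel_measurable borel"
    by measurable
  let ?K = "split_kernel a b \<Phi>"
  have [measurable]: "?K \<in> borel_measurable borel" using ab by measurable
  have T: "(\<integral>\<^sup>+W. ?K W \<partial>beta_law (a + 1) b) =
     (\<integral>\<^sup>+v. \<integral>\<^sup>+z. \<Phi> (extend_marked v True z) \<partial>split_law \<alpha> (a + \<alpha>) b \<partial>beta_law (1 - \<alpha>) (a + b + \<alpha>))"
    by (rule nn_integral_split_kernel[OF ab \<Phi> sym])
  have F: "(\<integral>\<^sup>+W. ?K W \<partial>beta_law a (b + 1)) =
     (\<integral>\<^sup>+v. \<integral>\<^sup>+z. \<Phi> (extend_marked v False z) \<partial>split_law \<alpha> a (b + \<alpha>) \<partial>beta_law (1 - \<alpha>) (a + b + \<alpha>))"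
  proof -
    have "(\<integral>\<^sup>+W. ?K W \<partial>beta_law a (b + 1)) = (\<integral>\<^sup>+V. ?K (1 - V) \<partial>beta_law (b + 1) a)"
      by (rule nn_integral_beta_law_reflect[symmetric]) measurable
    also have "\<dots> = (\<integral>\<^sup>+V. split_kernel b a (\<lambda>z. \<Phi> (flip_marks z)) V \<partial>beta_law (b + 1) a)"
      unfolding split_kernel_flip[OF ab \<Phi> sym] ..
    also have "\<dots> = (\<integral>\<^sup>+v. \<integral>\<^sup>+z. \<Phi> (flip_marks (extend_marked v True z)) \<partial>split_law \<alpha> (b + \<alpha>) a \<partial>beta_law (1 - \<alpha>) (b + a + \<alpha>))"
      by (rule nn_integral_split_kernel[OF ab(2,1) _ symmetric_functional_flip[OF sym]]) measurable
    also have "\<dots> = (\<integral>\<^sup>+v. \<integral>\<^sup>+z. \<Phi> (extend_marked v False z) \<partial>split_law \<alpha> a (b + \<alpha>) \<partial>beta_law (1 - \<alpha>) (a + b + \<alpha>))"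
    proof -
      have "flip_marks (extend_marked v True z) = extend_marked v False (flip_marks z)" for v z
        by (auto simp: flip_marks_def extend_marked_def fun_eq_iff split: nat.split)
      then show ?thesis
        using nn_integral_split_law_flip[OF ab(1) ab'(2) _ symmetric_functional_extend[OF sym]]
        by (simp add: add.commute[of b a])
    qed
    finally show ?thesis .
  qed
  have "(\<integral>\<^sup>+z. \<Phi> z \<partial>split_law \<alpha> a b) = (\<integral>\<^sup>+W. ?K W \<partial>beta_law a b)"
    using ab by (simp add: nn_integral_split_law split_kernel_def)
  also have "\<dots> = (\<integral>\<^sup>+W. ennreal W * ?K W + ennreal (1 - W) * ?K W \<partial>beta_law a b)"
  proof (rule nn_integral_cong_AE, use AE_beta_law[of a b] in eventually_elim)
    case (elim W)
    then have "ennreal W + ennreal (1 - W) = 1" by (simp flip: ennreal_plus)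
    then show ?case by (simp add: distrib_right[symmetric])
  qed
  also have "\<dots> = (\<integral>\<^sup>+W. ennreal W * ?K W \<partial>beta_law a b) + (\<integral>\<^sup>+W. ennreal (1 - W) * ?K W \<partial>beta_law a b)"
    by (rule nn_integral_add) measurable
  also have "\<dots> = ennreal (a / (a + b)) * (\<integral>\<^sup>+W. ?K W \<partial>beta_law (a + 1) b) +
      ennreal (b / (a + b)) * (\<integral>\<^sup>+W. ?K W \<partial>beta_law a (b + 1))"
    using ab by (simp add: nn_integral_beta_law_size_biased nn_integral_beta_law_size_biased_complement)
  also have "\<dots> = (\<integral>\<^sup>+v. ennreal (a / (a + b)) * (\<integral>\<^sup>+z. \<Phi> (extend_marked v True z) \<partial>split_law \<alpha> (a + \<alpha>) b) +
      ennreal (b / (a + b)) * (\<integral>\<^sup>+z. \<Phi> (extend_marked v False z) \<partial>split_law \<alpha> a (b + \<alpha>)) \<partial>beta_law (1 - \<alpha>) (a + b + \<alpha>))"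
    unfolding T F by (simp add: nn_integral_add nn_integral_cmult)
  finally show "(\<integral>\<^sup>+z. \<Phi> z \<partial>split_law \<alpha> a b) = \<dots>" .
qed

end

section \<open>Soft counts of ranked and coagulated blocks\<close>

text \<open>
  A real series over a set of naturals is summable exactly if it converges absolutely, so its value,
  including the default 0, is measurable in the terms and in the index set.
\<close>

lemma infsum_nat_eq:
  fixes f :: "nat \<Rightarrow> real"
  shows "infsum f {i. P i} = (if (\<Sum>i. ennreal \<bar>if P i then f i else 0\<bar>) < \<infinity> then (\<Sum>i. if P i then f i else 0) else 0)"
proof -
  let ?g = "\<lambda>i. if P i then f i else 0"
  have inf: "infsum f {i. P i} = infsum ?g UNIV"
    by (rule infsum_cong_neutral) auto
  have iff: "?g summable_on UNIV \<longleftrightarrow> summable (\<lambda>i. \<bar>?g i\<bar>)"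
    using summable_on_iff_abs_summable_on_real[of ?g UNIV] summable_on_UNIV_nonneg_real_iff[of "\<lambda>i. \<bar>?g i\<bar>"]
    by simp
  also have "\<dots> \<longleftrightarrow> (\<Sum>i. ennreal \<bar>?g i\<bar>) < \<infinity>"
  proof
    assume "summable (\<lambda>i. \<bar>?g i\<bar>)"
    from ennreal_suminf_neq_top[OF this abs_ge_zero]
    show "(\<Sum>i. ennreal \<bar>?g i\<bar>) < \<infinity>" unfolding infinity_ennreal_def less_top[symmetric] .
  next
    assume "(\<Sum>i. ennreal \<bar>?g i\<bar>) < \<infinity>"
    then show "summable (\<lambda>i. \<bar>?g i\<bar>)"
      unfolding infinity_ennreal_def less_top[symmetric] by (intro summable_suminf_not_top abs_ge_zero)
  qed
  finally have iff': "?g summable_on UNIV \<longleftrightarrow> (\<Sum>i. ennreal \<bar>?g i\<bar>) < \<infinity>" .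
  show ?thesis
  proof (cases "?g summable_on UNIV")
    case True
    have "?g sums infsum ?g UNIV"
      using True by (intro has_sum_imp_sums has_sum_infsum)
    then show ?thesis using True iff' inf by (auto simp: sums_iff)
  next
    case False
    then show ?thesis using iff' inf by (simp add: infsum_not_exists)
  qed
qed

lemma measurable_infsum_nat[measurable (raw)]:
  fixes f :: "'a \<Rightarrow> nat \<Rightarrow> real"
  assumes [measurable]: "\<And>i. (\<lambda>\<omega>. f \<omega> i) \<in> borel_measurable M" "\<And>i. Measurable.pred M (\<lambda>\<omega>. P \<omega> i)"
  shows "(\<lambda>\<omega>. infsum (f \<omega>) {i. P \<omega> i}) \<in> borel_measurable M"
  unfolding infsum_nat_eq by measurable

lemma unit_sequence_summable:
  assumes "unit_sequence y"
  shows "summable y" "suminf y = 1" "0 < y i" "0 \<le> y i" "y summable_on A"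
proof -
  show s: "summable y" and "suminf y = 1" "0 < y i" "0 \<le> y i" for i
    using assms by (auto simp: unit_sequence_def sums_iff intro: less_imp_le)
  then have "y summable_on UNIV"
    using assms by (subst summable_on_UNIV_nonneg_real_iff) (auto simp: unit_sequence_def intro: less_imp_le)
  then show "y summable_on A" by (rule summable_on_subset_banach) auto
qed

abbreviation ranked :: "(nat \<Rightarrow> real) \<Rightarrow> nat \<Rightarrow> real" where
  "ranked \<equiv> decreasing_rearrangement UNIV"

lemma measurable_ranked[measurable]: "ranked \<in> seq_space \<rightarrow>\<^sub>M seq_space"
  using measurable_decreasing_rearrangement[of "\<lambda>x i::nat. x i" seq_space "\<lambda>_ _. True"] by simp

lemma ranked_compose: "bij p \<Longrightarrow> ranked (y \<circ> p) = ranked y"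
  by (rule decreasing_rearrangement_reindex) auto

lemma is_decreasing_rearrangement_ranked:
  "unit_sequence y \<Longrightarrow> is_decreasing_rearrangement UNIV y (ranked y)"
  by (intro is_decreasing_rearrangement_positive unit_sequence_summable) auto

definition coag_blocks :: "(nat \<Rightarrow> bool) \<Rightarrow> nat option set" where
  "coag_blocks I = insert None (Some ` {j. \<not> I j})"

definition coag_family :: "(nat \<Rightarrow> real) \<Rightarrow> (nat \<Rightarrow> bool) \<Rightarrow> nat option \<Rightarrow> real" where
  "coag_family y I = case_option (\<Sum>\<^sub>\<infinity>i\<in>{i. I i}. y i) y"

lemma coag_map_eq: "coag_map y I = decreasing_rearrangement (coag_blocks I) (coag_family y I)"
  by (simp add: coag_map_def coag_blocks_def coag_family_def)

lemma measurable_coag_map[measurable (raw)]: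
  assumes [measurable]: "f \<in> M \<rightarrow>\<^sub>M seq_space" "g \<in> M \<rightarrow>\<^sub>M mark_space"
  shows "(\<lambda>x. coag_map (f x) (g x)) \<in> M \<rightarrow>\<^sub>M seq_space"
proof -
  have "coag_blocks I = {i. case i of None \<Rightarrow> True | Some j \<Rightarrow> \<not> I j}" for I
  proof (rule set_eqI)
    fix i show "i \<in> coag_blocks I \<longleftrightarrow> i \<in> {i. case i of None \<Rightarrow> True | Some j \<Rightarrow> \<not> I j}"
      by (cases i) (auto simp: coag_blocks_def)
  qed
  then have "(\<lambda>x. coag_map (f x) (g x)) = (\<lambda>x. decreasing_rearrangement
      {i. case i of None \<Rightarrow> True | Some j \<Rightarrow> \<not> g x j} (coag_family (f x) (g x)))"
    by (simp add: coag_map_eq)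
  also have "\<dots> \<in> M \<rightarrow>\<^sub>M seq_space"
  proof (rule measurable_decreasing_rearrangement)
    fix i show "(\<lambda>x. coag_family (f x) (g x) i) \<in> borel_measurable M"
      by (cases i) (auto simp: coag_family_def)
    show "Measurable.pred M (\<lambda>x. case i of None \<Rightarrow> True | Some j \<Rightarrow> \<not> g x j)"
      by (cases i) auto
  qed
  finally show ?thesis .
qed

lemma infsum_reindex_Collect:
  assumes "bij p"
  shows "infsum (f \<circ> p) {i. P (p i)} = infsum f {i. P i}"
proof -
  have "bij_betw p {i. P (p i)} {i. P i}"
    using assms by (auto simp: bij_def bij_betw_def inj_on_def surj_def image_iff)
  from infsum_reindex_bij_betw[OF this, of f] show ?thesis by (simp add: comp_def)
qed

text \<open>
  Coagulation is invariant under relabelling the blocks together with their marks, so it may be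
  applied to the sticks before they are ranked.
\<close>

lemma coag_map_compose:
  assumes p: "bij p"
  shows "coag_map (y \<circ> p) (I \<circ> p) = coag_map y I"
  unfolding coag_map_eq
proof (rule decreasing_rearrangement_reindex)
  have inj: "inj p" and surj: "surj p" using p by (auto simp: bij_def)
  show "bij_betw (map_option p) (coag_blocks (I \<circ> p)) (coag_blocks I)"
  proof (rule bij_betwI')
    fix i j assume "i \<in> coag_blocks (I \<circ> p)" "j \<in> coag_blocks (I \<circ> p)"
    show "map_option p i = map_option p j \<longleftrightarrow> i = j"
      using inj by (metis option.inj_map injD)
  next
    fix i assume "i \<in> coag_blocks (I \<circ> p)"
    then show "map_option p i \<in> coag_blocks I" by (auto simp: coag_blocks_def)
  next
    fix i assume "i \<in> coag_blocks I"
    then show "\<exists>j\<in>coag_blocks (I \<circ> p). i = map_option p j"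
    proof (cases i)
      case (Some k)
      obtain j where "k = p j" using surj by (auto simp: surj_def)
      then show ?thesis
        using Some \<open>i \<in> coag_blocks I\<close> by (intro bexI[of _ "Some j"]) (auto simp: coag_blocks_def)
    qed (auto simp: coag_blocks_def)
  qed
  have "(\<Sum>\<^sub>\<infinity>i\<in>{i. I (p i)}. y (p i)) = infsum y {i. I i}"
    using infsum_reindex_Collect[OF p, of y I] by (simp add: comp_def)
  then show "coag_family (y \<circ> p) (I \<circ> p) i = coag_family y I (map_option p i)" for i
    by (cases i) (simp_all add: coag_family_def)
qed

text \<open>
  A Lipschitz approximation of the indicator of \<open>{t<..}\<close>, of slope \<open>m\<close>.
\<close>

definition ramp :: "real \<Rightarrow> real \<Rightarrow> real \<Rightarrow> real" where
  "ramp m t x = min 1 (max 0 (m * (x - t)))"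

lemma ramp_range: "0 \<le> ramp m t x" "ramp m t x \<le> 1" "\<bar>ramp m t x\<bar> \<le> 1"
  by (auto simp: ramp_def)

lemma ramp_lipschitz: "0 \<le> m \<Longrightarrow> \<bar>ramp m t x - ramp m t x'\<bar> \<le> m * \<bar>x - x'\<bar>"
proof -
  assume "0 \<le> m"
  have "\<bar>ramp m t x - ramp m t x'\<bar> \<le> \<bar>m * (x - t) - m * (x' - t)\<bar>"
    unfolding ramp_def by linarith
  also have "\<dots> = m * \<bar>x - x'\<bar>"
    using \<open>0 \<le> m\<close> by (simp add: right_diff_distrib[symmetric] abs_mult)
  finally show ?thesis .
qed

lemma ramp_le: "0 \<le> m \<Longrightarrow> 0 \<le> t \<Longrightarrow> 0 \<le> x \<Longrightarrow> ramp m t x \<le> m * x"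
proof -
  assume a: "0 \<le> m" "0 \<le> t" "0 \<le> x"
  then have "m * (x - t) \<le> m * x" "0 \<le> m * x" by (auto intro: mult_left_mono)
  then show ?thesis unfolding ramp_def by linarith
qed

lemma ramp_eq_0: "0 \<le> m \<Longrightarrow> x \<le> t \<Longrightarrow> ramp m t x = 0"
  using mult_nonneg_nonpos[of m "x - t"] by (simp add: ramp_def)

lemma ramp_eq_1: "1 \<le> m * (x - t) \<Longrightarrow> ramp m t x = 1"
  by (auto simp: ramp_def)

lemma measurable_ramp[measurable]: "ramp m t \<in> borel_measurable borel"
  unfolding ramp_def[abs_def] by measurable

text \<open>
  The inner ramp softens the count of values above \<open>t\<close>, the outer one the event that this count
  exceeds \<open>k\<close>.  For a fixed family both are exact for large \<open>m\<close>: if at least \<open>k + 1\<close> values exceed \<open>t\<close>,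
  finitely many of them reach the plateau of the ramp, and otherwise the soft count never exceeds
  \<open>k\<close>.
\<close>

lemma eventually_ramp_count:
  assumes r: "is_decreasing_rearrangement A f r"
    and summ: "\<And>m. (\<lambda>i. ramp (real m) t (f i)) summable_on A"
  shows "\<forall>\<^sub>F m in sequentially. ramp (real m) (real k) (infsum (\<lambda>i. ramp (real m) t (f i)) A) =
    (if t < r k then 1 else 0)"
proof (cases "t < r k")
  case True
  then obtain S where S: "S \<subseteq> A" "finite S" "card S = Suc k" "\<And>i. i \<in> S \<Longrightarrow> t < f i"
    unfolding less_decreasing_rearrangement_iff[OF r] by auto
  have "\<forall>\<^sub>F m in sequentially. 1 \<le> real m * (f i - t)" if "i \<in> S" for i
  proof -
    have "filterlim (\<lambda>m. real m * (f i - t)) at_top sequentially"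
      using S(4)[OF that] by (intro filterlim_at_top_mult_tendsto_pos[OF tendsto_const] filterlim_real_sequentially) auto
    then show ?thesis by (simp add: filterlim_at_top)
  qed
  then have "\<forall>\<^sub>F m in sequentially. \<forall>i\<in>S. 1 \<le> real m * (f i - t)"
    by (intro eventually_ball_finite S) auto
  moreover have "\<forall>\<^sub>F m in sequentially. 1 \<le> m" by (rule eventually_ge_at_top)
  ultimately show ?thesis
  proof eventually_elim
    case (elim m)
    have "real (Suc k) = (\<Sum>i\<in>S. ramp (real m) t (f i))"
      using elim(1) S(3) by (simp add: ramp_eq_1)
    also have "\<dots> \<le> infsum (\<lambda>i. ramp (real m) t (f i)) A"
      by (rule finite_sum_le_infsum[OF summ S(2,1)]) (auto simp: ramp_range)
    finally have "1 \<le> infsum (\<lambda>i. ramp (real m) t (f i)) A - real k" by simp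
    then have "1 * 1 \<le> real m * (infsum (\<lambda>i. ramp (real m) t (f i)) A - real k)"
      using elim(2) by (intro mult_mono) auto
    then show ?case using True by (simp add: ramp_eq_1)
  qed
next
  case False
  let ?C = "{i\<in>A. t < f i}"
  have no: "\<not> (\<exists>S\<subseteq>A. finite S \<and> card S = Suc k \<and> (\<forall>i\<in>S. t < f i))"
    using False unfolding less_decreasing_rearrangement_iff[OF r] .
  have fin: "finite ?C"
  proof (rule ccontr)
    assume "infinite ?C"
    then obtain S where "finite S" "card S = Suc k" "S \<subseteq> ?C"
      using infinite_arbitrarily_large by blast
    then show False using no by blast
  qed
  have card: "card ?C \<le> k"
  proof (rule ccontr)
    assume "\<not> card ?C \<le> k"
    then have "Suc k \<le> card ?C" by simp
    then obtain S where "S \<subseteq> ?C" "card S = Suc k" "finite S"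
      by (rule obtain_subset_with_card_n)
    then show False using no by blast
  qed
  have "ramp (real m) (real k) (infsum (\<lambda>i. ramp (real m) t (f i)) A) = 0" for m
  proof -
    have "infsum (\<lambda>i. ramp (real m) t (f i)) A = infsum (\<lambda>i. ramp (real m) t (f i)) ?C"
      by (rule infsum_cong_neutral) (auto intro!: ramp_eq_0)
    also have "\<dots> = (\<Sum>i\<in>?C. ramp (real m) t (f i))" using fin by simp
    also have "\<dots> \<le> (\<Sum>i\<in>?C. 1)" by (intro sum_mono ramp_range)
    also have "\<dots> \<le> real k" using card by simp
    finally show ?thesis by (intro ramp_eq_0) auto
  qed
  then show ?thesis using False by simp
qed

definition soft_count_seq :: "real \<Rightarrow> real \<Rightarrow> (nat \<Rightarrow> real) \<Rightarrow> real" where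
  "soft_count_seq m t y = infsum (\<lambda>i. ramp m t (y i)) {i. True}"

text \<open>
  The soft count of the coagulated blocks: the merged block and the unmarked sticks.
\<close>

definition soft_count_coag :: "real \<Rightarrow> real \<Rightarrow> (nat \<Rightarrow> real) \<Rightarrow> (nat \<Rightarrow> bool) \<Rightarrow> real" where
  "soft_count_coag m s y I = ramp m s (infsum y {i. I i}) + infsum (\<lambda>i. ramp m s (y i)) {i. \<not> I i}"

lemma soft_count_compose:
  assumes p: "bij p"
  shows "soft_count_seq m t (y \<circ> p) = soft_count_seq m t y"
    and "soft_count_coag m t (y \<circ> p) (I \<circ> p) = soft_count_coag m t y I"
  using infsum_reindex_Collect[OF p, of "\<lambda>i. ramp m t (y i)" "\<lambda>_. True"]
    infsum_reindex_Collect[OF p, of y I]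
    infsum_reindex_Collect[OF p, of "\<lambda>i. ramp m t (y i)" "\<lambda>i. \<not> I i"]
  by (auto simp: soft_count_seq_def soft_count_coag_def comp_def)

lemma summable_on_ramp:
  assumes y: "unit_sequence y" and m: "0 \<le> m" "0 \<le> t"
  shows "(\<lambda>i. ramp m t (y i)) summable_on A"
proof (rule summable_on_comparison_test)
  show "(\<lambda>i. m * y i) summable_on A"
    by (intro summable_on_cmult_right unit_sequence_summable y)
qed (use ramp_le[OF m] ramp_range unit_sequence_summable[OF y] in auto)

text \<open>
  The two series share their first \<open>n\<close> terms; the others are at most \<open>C\<close> times the remaining lengths
  of \<open>y\<close> and of \<open>y'\<close>, which agree.
\<close>

lemma infsum_tail_diff:
  fixes f f' :: "nat \<Rightarrow> real"
  assumes y: "unit_sequence y" "unit_sequence y'" and eq: "\<And>i. i < n \<Longrightarrow> y i = y' i"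
    and fP: "\<And>i. i < n \<Longrightarrow> f i = f' i \<and> P i = P' i"
    and f: "\<And>i. \<bar>f i\<bar> \<le> C * y i" "\<And>i. \<bar>f' i\<bar> \<le> C * y' i" and C: "0 \<le> C"
  shows "\<bar>infsum f {i. P i} - infsum f' {i. P' i}\<bar> \<le> 2 * C * (1 - (\<Sum>i<n. y i))"
proof -
  let ?g = "\<lambda>i. if P i then f i else 0" and ?g' = "\<lambda>i. if P' i then f' i else 0"
  note u = unit_sequence_summable[OF y(1)] and u' = unit_sequence_summable[OF y(2)]
  have infsum_eq: "summable g \<and> infsum h {i. Q i} = suminf g"
    if g: "g = (\<lambda>i. if Q i then h i else 0)" and h: "\<And>i. \<bar>h i\<bar> \<le> C * z i" and z: "unit_sequence z"
    for g h z :: "nat \<Rightarrow> real" and Q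
  proof -
    have "summable (\<lambda>i. \<bar>g i\<bar>)"
    proof (rule summable_comparison_test'[of "\<lambda>i. C * z i" 0])
      show "summable (\<lambda>i. C * z i)" by (intro summable_mult unit_sequence_summable z)
      have "0 \<le> C * z i" for i using C unit_sequence_summable(4)[OF z] by simp
      then show "norm \<bar>g i\<bar> \<le> C * z i" for i using h[of i] by (simp add: g)
    qed
    moreover from ennreal_suminf_neq_top[OF this abs_ge_zero] have "(\<Sum>i. ennreal \<bar>g i\<bar>) < \<infinity>"
      unfolding infinity_ennreal_def less_top[symmetric] .
    ultimately show ?thesis
      using infsum_nat_eq[of h Q] unfolding g by (auto intro: summable_rabs_cancel)
  qed
  have g: "summable ?g" "infsum f {i. P i} = suminf ?g"
    using infsum_eq[OF refl f(1) y(1)] by auto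
  have g': "summable ?g'" "infsum f' {i. P' i} = suminf ?g'"
    using infsum_eq[OF refl f(2) y(2)] by auto
  let ?h = "\<lambda>i. C * (if i < n then 0 else y i + y' i)"
  have h: "(\<lambda>i. if i < n then 0 else y i + y' i) sums (2 * (1 - (\<Sum>i<n. y i)))"
  proof -
    have "(\<lambda>i. y i + y' i - (if i \<in> {..<n} then y i + y' i else 0)) sums (1 + 1 - (\<Sum>i\<in>{..<n}. y i + y' i))"
      using y by (intro sums_diff sums_add sums_If_finite_set) (auto simp: unit_sequence_def)
    moreover have "(\<Sum>i<n. y i + y' i) = 2 * (\<Sum>i<n. y i)"
      by (simp add: sum_distrib_left eq)
    moreover have "(\<lambda>i. y i + y' i - (if i \<in> {..<n} then y i + y' i else 0)) = (\<lambda>i. if i < n then 0 else y i + y' i)"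
      by auto
    ultimately show ?thesis by simp
  qed
  have le: "\<bar>?g i - ?g' i\<bar> \<le> ?h i" for i
  proof (cases "i < n")
    case True
    then show ?thesis using fP[of i] by simp
  next
    case False
    have "\<bar>?g i\<bar> \<le> C * y i" "\<bar>?g' i\<bar> \<le> C * y' i"
      using f C u(4) u'(4) by auto
    then show ?thesis using False by (simp add: algebra_simps)
  qed
  have sh: "summable ?h" using h by (intro summable_mult) (auto simp: sums_iff)
  have sd: "summable (\<lambda>i. \<bar>?g i - ?g' i\<bar>)"
    by (rule summable_comparison_test'[OF sh, of 0]) (use le in auto)
  have "\<bar>infsum f {i. P i} - infsum f' {i. P' i}\<bar> = \<bar>\<Sum>i. ?g i - ?g' i\<bar>"
    unfolding g(2) g'(2) by (simp add: suminf_diff[OF g(1) g'(1)])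
  also have "\<dots> \<le> (\<Sum>i. \<bar>?g i - ?g' i\<bar>)"
    by (rule summable_rabs[OF sd])
  also have "\<dots> \<le> suminf ?h"
    by (rule suminf_le[OF le sd sh])
  also have "\<dots> = C * (2 * (1 - (\<Sum>i<n. y i)))"
    using h by (simp add: suminf_mult sums_iff)
  finally show ?thesis by (simp add: mult_ac)
qed

lemma soft_count_tail_diff:
  assumes y: "unit_sequence y" "unit_sequence y'" and m: "0 \<le> m" and t: "0 \<le> t"
    and eq: "\<forall>i<n. y i = y' i \<and> I i = I' i"
  shows "\<bar>soft_count_seq m t y - soft_count_seq m t y'\<bar> \<le> 4 * m * (1 - (\<Sum>i<n. y i))"
    and "\<bar>soft_count_coag m t y I - soft_count_coag m t y' I'\<bar> \<le> 4 * m * (1 - (\<Sum>i<n. y i))"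
proof -
  let ?R = "1 - (\<Sum>i<n. y i)"
  have R: "0 \<le> ?R"
    using sum_le_suminf[of y "{..<n}"] unit_sequence_summable[OF y(1)] by auto
  have bound: "\<bar>ramp m t (z i)\<bar> \<le> m * z i" if "unit_sequence z" for z i
    using ramp_le[OF m t] ramp_range(1)[of m t] unit_sequence_summable(4)[OF that] by simp
  have d: "\<bar>infsum (\<lambda>i. ramp m t (y i)) {i. P i} - infsum (\<lambda>i. ramp m t (y' i)) {i. P' i}\<bar> \<le> 2 * m * ?R"
    if "\<And>i. i < n \<Longrightarrow> P i = P' i" for P P'
    by (rule infsum_tail_diff[OF y]) (use eq that bound y m in auto)
  show "\<bar>soft_count_seq m t y - soft_count_seq m t y'\<bar> \<le> 4 * m * ?R"
    using d[of "\<lambda>_. True" "\<lambda>_. True"] mult_nonneg_nonneg[OF m R] by (simp add: soft_count_seq_def)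
  \<comment> \<open>The merged block and the unmarked sticks each contribute \<open>2 * m\<close> to the constant.\<close>
  have "\<bar>infsum y {i. I i} - infsum y' {i. I' i}\<bar> \<le> 2 * 1 * ?R"
    by (rule infsum_tail_diff[OF y]) (use eq unit_sequence_summable(4)[OF y(1)] unit_sequence_summable(4)[OF y(2)] in auto)
  then have "m * \<bar>infsum y {i. I i} - infsum y' {i. I' i}\<bar> \<le> m * (2 * ?R)"
    using m by (intro mult_left_mono) auto
  also have "m * (2 * ?R) = 2 * m * ?R" by simp
  finally have "\<bar>ramp m t (infsum y {i. I i}) - ramp m t (infsum y' {i. I' i})\<bar> \<le> 2 * m * ?R"
    by (rule order_trans[OF ramp_lipschitz[OF m]])
  moreover have "\<bar>infsum (\<lambda>i. ramp m t (y i)) {i. \<not> I i} - infsum (\<lambda>i. ramp m t (y' i)) {i. \<not> I' i}\<bar> \<le> 2 * m * ?R"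
    by (rule d) (use eq in auto)
  ultimately show "\<bar>soft_count_coag m t y I - soft_count_coag m t y' I'\<bar> \<le> 4 * m * ?R"
    unfolding soft_count_coag_def by (simp add: abs_le_iff)
qed

section \<open>Splitting and marking have the same ranked law\<close>

text \<open>
  Constraints on finitely many coordinates from below form a generator that is stable under
  intersection.  The index sets are part of a box because a coordinate cannot be left free by the
  choice of a real bound.
\<close>

lemma box_measure_eqI:
  assumes MN: "sets M = sets (seq_space \<Otimes>\<^sub>M seq_space)" "sets N = sets (seq_space \<Otimes>\<^sub>M seq_space)"
    and fin: "finite_measure M"
    and eq: "\<And>J J' s t. finite J \<Longrightarrow> finite J' \<Longrightarrow>
      emeasure M {z. (\<forall>j\<in>J. s j < fst z j) \<and> (\<forall>j\<in>J'. t j < snd z j)} =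
      emeasure N {z. (\<forall>j\<in>J. s j < fst z j) \<and> (\<forall>j\<in>J'. t j < snd z j)}"
  shows "M = N"
proof -
  define box where "box J J' s t = {z :: (nat \<Rightarrow> real) \<times> (nat \<Rightarrow> real). (\<forall>j\<in>J. s j < fst z j) \<and> (\<forall>j\<in>J'. t j < snd z j)}"
    for J J' and s t :: "nat \<Rightarrow> real"
  define E where "E = {box J J' s t | J J' s t. finite J \<and> finite J'}"
  have boxE: "finite J \<Longrightarrow> finite J' \<Longrightarrow> box J J' s t \<in> E" for J J' s t
    unfolding E_def by blast
  have merge: "\<exists>u. \<forall>x. ((\<forall>j\<in>J1. s1 j < x j) \<and> (\<forall>j\<in>J2. s2 j < x j)) \<longleftrightarrow> (\<forall>j\<in>J1 \<union> J2. u j < x j)"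
    for J1 J2 and s1 s2 :: "nat \<Rightarrow> real"
    by (rule exI[of _ "\<lambda>j. if j \<in> J1 then if j \<in> J2 then max (s1 j) (s2 j) else s1 j else s2 j"]) auto
  have inter: "Int_stable E"
  proof (rule Int_stableI)
    fix a b assume "a \<in> E" "b \<in> E"
    then obtain J1 J1' s1 t1 J2 J2' s2 t2 where
      a: "a = box J1 J1' s1 t1" "finite J1" "finite J1'" and b: "b = box J2 J2' s2 t2" "finite J2" "finite J2'"
      unfolding E_def by blast
    obtain u where u: "\<And>x. ((\<forall>j\<in>J1. s1 j < x j) \<and> (\<forall>j\<in>J2. s2 j < x j)) \<longleftrightarrow> (\<forall>j\<in>J1 \<union> J2. u j < x j)"
      using merge[of J1 s1 J2 s2] by blast
    obtain v where v: "\<And>x. ((\<forall>j\<in>J1'. t1 j < x j) \<and> (\<forall>j\<in>J2'. t2 j < x j)) \<longleftrightarrow> (\<forall>j\<in>J1' \<union> J2'. v j < x j)"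
      using merge[of J1' t1 J2' t2] by blast
    have "a \<inter> b = box (J1 \<union> J2) (J1' \<union> J2') u v"
      unfolding a b box_def using u v by blast
    then show "a \<inter> b \<in> E" using a b by (auto intro: boxE)
  qed
  have box_sets: "box J J' s t \<in> sets (seq_space \<Otimes>\<^sub>M seq_space)" if "finite J" "finite J'" for J J' s t
  proof -
    have [measurable]: "finite J" "finite J'" by fact+
    have "{z \<in> space (seq_space \<Otimes>\<^sub>M seq_space). (\<forall>j\<in>J. s j < fst z j) \<and> (\<forall>j\<in>J'. t j < snd z j)} \<in> sets (seq_space \<Otimes>\<^sub>M seq_space)"
      by measurable
    then show ?thesis by (simp add: box_def space_pair_measure)
  qed
  have gen: "sets (seq_space \<Otimes>\<^sub>M seq_space) = sigma_sets UNIV E"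
  proof
    show "sigma_sets UNIV E \<subseteq> sets (seq_space \<Otimes>\<^sub>M seq_space)"
      using sets.sigma_sets_subset[of E "seq_space \<Otimes>\<^sub>M seq_space"] box_sets
      by (auto simp: E_def space_pair_measure)
    have sp: "space (sigma UNIV E) = UNIV" "sets (sigma UNIV E) = sigma_sets UNIV E"
      by auto
    have "(\<lambda>z. (fst z, snd z)) \<in> sigma UNIV E \<rightarrow>\<^sub>M seq_space \<Otimes>\<^sub>M seq_space"
    proof (intro measurable_Pair measurable_seq_spaceI borel_measurableI_greater)
      fix i a
      have "{z. a < fst z i} = box {i} {} (\<lambda>_. a) (\<lambda>_. 0)" "{z. a < snd z i} = box {} {i} (\<lambda>_. 0) (\<lambda>_. a)"
        by (auto simp: box_def)
      then show "{w \<in> space (sigma UNIV E). a < fst w i} \<in> sets (sigma UNIV E)"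
        "{w \<in> space (sigma UNIV E). a < snd w i} \<in> sets (sigma UNIV E)"
        by (auto simp: sp intro!: sigma_sets.Basic boxE)
    qed
    from measurable_sets[OF this] show "sets (seq_space \<Otimes>\<^sub>M seq_space) \<subseteq> sigma_sets UNIV E"
      by (auto simp: sp)
  qed
  interpret finite_measure M by fact
  show ?thesis
  proof (rule measure_eqI_generator_eq[OF inter, of UNIV M N "\<lambda>_. UNIV"])
    show "range (\<lambda>_::nat. UNIV) \<subseteq> E"
      using boxE[of "{}" "{}"] by (auto simp: box_def)
    show "emeasure M X = emeasure N X" if "X \<in> E" for X
      using that eq by (auto simp: E_def box_def)
  qed (auto simp: MN gen emeasure_finite)
qed

text \<open>
  A Lipschitz approximation of the event that the coagulated and the original ranked sequence exceed
  prescribed bounds in finitely many coordinates: entry \<open>j\<close>, counted from 0, exceeds \<open>s j\<close> when more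
  than \<open>j\<close> blocks do.
\<close>

definition test_functional ::
    "nat set \<Rightarrow> nat set \<Rightarrow> (nat \<Rightarrow> real) \<Rightarrow> (nat \<Rightarrow> real) \<Rightarrow> real \<Rightarrow> marked_seq \<Rightarrow> real" where
  "test_functional J J' s t m z =
     (\<Prod>j\<in>J. ramp m (real j) (soft_count_coag m (s j) (fst z) (snd z))) *
     (\<Prod>j\<in>J'. ramp m (real j) (soft_count_seq m (t j) (fst z)))"

lemma test_functional_range: "0 \<le> test_functional J J' s t m z" "test_functional J J' s t m z \<le> 1"
  unfolding test_functional_def
  by (auto intro!: mult_nonneg_nonneg mult_le_one prod_nonneg prod_le_1 simp: ramp_range)

lemma measurable_test_functional[measurable]:
  "test_functional J J' s t m \<in> borel_measurable marked_space"
proof -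
  have "(\<lambda>z. test_functional J J' s t m z) \<in> borel_measurable (seq_space \<Otimes>\<^sub>M mark_space)"
    unfolding test_functional_def soft_count_coag_def soft_count_seq_def by measurable
  then show ?thesis by (simp add: marked_space_def)
qed

lemma symmetric_test_functional: "symmetric_functional (\<lambda>z. ennreal (test_functional J J' s t m z))"
  unfolding symmetric_functional_def test_functional_def by (simp add: soft_count_compose)

lemma tail_lipschitz_test_functional:
  assumes m: "0 \<le> m" and s: "\<And>j. 0 \<le> s j" and t: "\<And>j. 0 \<le> t j"
  shows "tail_lipschitz n (real (card J + card J') * (m * (4 * m))) (\<lambda>z. ennreal (test_functional J J' s t m z))"
  unfolding tail_lipschitz_def
proof (intro allI impI)
  fix y y' :: "nat \<Rightarrow> real" and I I' :: "nat \<Rightarrow> bool"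
  assume y: "unit_sequence y" "unit_sequence y'" and eq: "\<forall>i<n. y i = y' i \<and> I i = I' i"
  let ?R = "1 - (\<Sum>i<n. y i)"
  let ?a = "\<lambda>j. ramp m (real j) (soft_count_coag m (s j) y I)" and ?a' = "\<lambda>j. ramp m (real j) (soft_count_coag m (s j) y' I')"
  let ?b = "\<lambda>j. ramp m (real j) (soft_count_seq m (t j) y)" and ?b' = "\<lambda>j. ramp m (real j) (soft_count_seq m (t j) y')"
  have R: "0 \<le> ?R"
    using sum_le_suminf[of y "{..<n}"] unit_sequence_summable[OF y(1)] by auto
  have ramp_diff: "\<bar>ramp m c x - ramp m c x'\<bar> \<le> m * (4 * m) * ?R" if "\<bar>x - x'\<bar> \<le> 4 * m * ?R" for c x x'
  proof -
    have "\<bar>ramp m c x - ramp m c x'\<bar> \<le> m * \<bar>x - x'\<bar>" by (rule ramp_lipschitz[OF m])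
    also have "\<dots> \<le> m * (4 * m * ?R)" using that m by (rule mult_left_mono)
    finally show ?thesis by (simp add: mult_ac)
  qed
  have "\<bar>(\<Prod>j\<in>J. ?a j) - (\<Prod>j\<in>J. ?a' j)\<bar> \<le> (\<Sum>j\<in>J. \<bar>?a j - ?a' j\<bar>)"
    using norm_prod_diff[of J ?a ?a'] by (simp add: ramp_range)
  also have "\<dots> \<le> (\<Sum>j\<in>J. m * (4 * m) * ?R)"
    by (intro sum_mono ramp_diff soft_count_tail_diff y m s eq)
  finally have A: "\<bar>(\<Prod>j\<in>J. ?a j) - (\<Prod>j\<in>J. ?a' j)\<bar> \<le> real (card J) * (m * (4 * m)) * ?R"
    by (simp add: mult_ac)
  have "\<bar>(\<Prod>j\<in>J'. ?b j) - (\<Prod>j\<in>J'. ?b' j)\<bar> \<le> (\<Sum>j\<in>J'. \<bar>?b j - ?b' j\<bar>)"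
    using norm_prod_diff[of J' ?b ?b'] by (simp add: ramp_range)
  also have "\<dots> \<le> (\<Sum>j\<in>J'. m * (4 * m) * ?R)"
    by (intro sum_mono ramp_diff soft_count_tail_diff(1)[OF y m t eq])
  finally have B: "\<bar>(\<Prod>j\<in>J'. ?b j) - (\<Prod>j\<in>J'. ?b' j)\<bar> \<le> real (card J') * (m * (4 * m)) * ?R"
    by (simp add: mult_ac)
  have prod_range: "0 \<le> (\<Prod>j\<in>K. ramp m (real j) (x j)) \<and> (\<Prod>j\<in>K. ramp m (real j) (x j)) \<le> 1" for K x
    by (auto intro!: prod_nonneg prod_le_1 simp: ramp_range)
  have mult_diff: "\<bar>p * q - p' * q'\<bar> \<le> \<bar>p - p'\<bar> + \<bar>q - q'\<bar>"
    if "0 \<le> p" "p \<le> 1" "0 \<le> q'" "q' \<le> 1" for p q p' q' :: real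
  proof -
    have "p * q - p' * q' = p * (q - q') + (p - p') * q'" by (simp add: algebra_simps)
    also have "\<bar>\<dots>\<bar> \<le> \<bar>p\<bar> * \<bar>q - q'\<bar> + \<bar>p - p'\<bar> * \<bar>q'\<bar>"
      by (metis abs_mult abs_triangle_ineq)
    also have "\<dots> \<le> 1 * \<bar>q - q'\<bar> + \<bar>p - p'\<bar> * 1"
      using that by (intro add_mono mult_mono) auto
    finally show ?thesis by simp
  qed
  have "\<bar>test_functional J J' s t m (y, I) - test_functional J J' s t m (y', I')\<bar>
      \<le> \<bar>(\<Prod>j\<in>J. ?a j) - (\<Prod>j\<in>J. ?a' j)\<bar> + \<bar>(\<Prod>j\<in>J'. ?b j) - (\<Prod>j\<in>J'. ?b' j)\<bar>"
    unfolding test_functional_def fst_conv snd_conv by (rule mult_diff) (simp_all add: prod_range)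
  also have "\<dots> \<le> real (card J + card J') * (m * (4 * m)) * ?R"
    using A B by (simp add: distrib_right)
  finally have "test_functional J J' s t m (y, I) \<le> test_functional J J' s t m (y', I') + real (card J + card J') * (m * (4 * m)) * ?R"
    by linarith
  then have "ennreal (test_functional J J' s t m (y, I)) \<le> ennreal (test_functional J J' s t m (y', I') + real (card J + card J') * (m * (4 * m)) * ?R)"
    by (rule ennreal_leI)
  also have "\<dots> = ennreal (test_functional J J' s t m (y', I')) + ennreal (real (card J + card J') * (m * (4 * m)) * ?R)"
    using R m by (intro ennreal_plus test_functional_range mult_nonneg_nonneg) auto
  finally show "ennreal (test_functional J J' s t m (y, I)) \<le> ennreal (test_functional J J' s t m (y', I')) +
      ennreal (real (card J + card J') * (m * (4 * m)) * ?R)" .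
qed

lemma infinite_coag_blocks: "proper_marks I \<Longrightarrow> infinite (coag_blocks I)"
  by (auto simp: proper_marks_def coag_blocks_def finite_image_iff)

lemma summable_on_coag_blocks_iff:
  "f summable_on coag_blocks I \<longleftrightarrow> (f \<circ> Some) summable_on {j. \<not> I j}" for f :: "nat option \<Rightarrow> real"
  unfolding coag_blocks_def by (simp add: summable_on_insert_iff summable_on_reindex)

lemma infsum_coag_blocks:
  fixes f :: "nat option \<Rightarrow> real"
  assumes "(f \<circ> Some) summable_on {j. \<not> I j}"
  shows "infsum f (coag_blocks I) = f None + infsum (f \<circ> Some) {j. \<not> I j}"
  unfolding coag_blocks_def using assms
  by (subst infsum_insert) (auto simp: summable_on_reindex infsum_reindex)

lemma coag_family_pos:
  assumes "unit_sequence y" "proper_marks I" "i \<in> coag_blocks I"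
  shows "0 < coag_family y I i"
proof (cases i)
  case None
  obtain j where j: "I j" using assms(2) by (auto simp: proper_marks_def)
  have "sum y {j} \<le> infsum y {i. I i}"
    using j by (intro finite_sum_le_infsum unit_sequence_summable[OF assms(1)]) auto
  then show ?thesis
    using None unit_sequence_summable(3)[OF assms(1), of j] by (simp add: coag_family_def)
qed (auto simp: coag_family_def unit_sequence_summable[OF assms(1)])

lemma is_decreasing_rearrangement_coag_map:
  assumes y: "unit_sequence y" and I: "proper_marks I"
  shows "is_decreasing_rearrangement (coag_blocks I) (coag_family y I) (coag_map y I)"
  unfolding coag_map_eq
proof (rule is_decreasing_rearrangement_positive)
  have "coag_family y I \<circ> Some = y" by (auto simp: fun_eq_iff coag_family_def)
  then show "coag_family y I summable_on coag_blocks I"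
    by (simp add: summable_on_coag_blocks_iff unit_sequence_summable[OF y])
qed (use coag_family_pos[OF y I] infinite_coag_blocks[OF I] in auto)

lemma rearrangement_pos:
  assumes "is_decreasing_rearrangement A f r" "\<And>i. i \<in> A \<Longrightarrow> 0 < f i"
  shows "0 < r k"
  using assms unfolding is_decreasing_rearrangement_def by (auto simp: bij_betw_apply)

lemma soft_count_coag_eq:
  assumes "unit_sequence y" "0 \<le> m" "0 \<le> s"
  shows "(\<lambda>i. ramp m s (coag_family y I i)) summable_on coag_blocks I"
    and "soft_count_coag m s y I = infsum (\<lambda>i. ramp m s (coag_family y I i)) (coag_blocks I)"
proof -
  have e: "(\<lambda>i. ramp m s (coag_family y I i)) \<circ> Some = (\<lambda>i. ramp m s (y i))"
    by (auto simp: fun_eq_iff coag_family_def)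
  have sm: "((\<lambda>i. ramp m s (coag_family y I i)) \<circ> Some) summable_on {j. \<not> I j}"
    unfolding e by (rule summable_on_ramp[OF assms])
  then show "(\<lambda>i. ramp m s (coag_family y I i)) summable_on coag_blocks I"
    by (simp add: summable_on_coag_blocks_iff)
  show "soft_count_coag m s y I = infsum (\<lambda>i. ramp m s (coag_family y I i)) (coag_blocks I)"
    unfolding infsum_coag_blocks[OF sm] e by (simp add: soft_count_coag_def coag_family_def)
qed

text \<open>
  The pair (coagulated sequence, ranked sequence) in the order \<open>(X, Y)\<close> of the duality.
\<close>

definition coag_rank :: "marked_seq \<Rightarrow> (nat \<Rightarrow> real) \<times> (nat \<Rightarrow> real)" where
  "coag_rank z = (coag_map (fst z) (snd z), ranked (fst z))"

lemma measurable_coag_rank[measurable]: "coag_rank \<in> marked_space \<rightarrow>\<^sub>M seq_space \<Otimes>\<^sub>M seq_space"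
proof -
  have "coag_rank \<in> seq_space \<Otimes>\<^sub>M mark_space \<rightarrow>\<^sub>M seq_space \<Otimes>\<^sub>M seq_space"
    unfolding coag_rank_def[abs_def] by measurable
  then show ?thesis by (simp add: marked_space_def)
qed

lemma test_functional_tendsto:
  assumes z: "unit_sequence (fst z)" "proper_marks (snd z)" and fin: "finite J" "finite J'"
    and s: "\<And>j. 0 \<le> s j" and t: "\<And>j. 0 \<le> t j"
  shows "(\<lambda>m. ennreal (test_functional J J' s t (real m) z)) \<longlonglongrightarrow>
    indicator {z. (\<forall>j\<in>J. s j < fst z j) \<and> (\<forall>j\<in>J'. t j < snd z j)} (coag_rank z)"
proof -
  obtain y I where yI: "z = (y, I)" by fastforce
  have y: "unit_sequence y" and I: "proper_marks I" using z yI by auto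
  have A: "\<forall>\<^sub>F m in sequentially. ramp (real m) (real j) (soft_count_coag (real m) (s j) y I) = (if s j < coag_map y I j then 1 else 0)" for j
    using eventually_ramp_count[OF is_decreasing_rearrangement_coag_map[OF y I] soft_count_coag_eq(1)[OF y of_nat_0_le_iff s]]
    by (simp add: soft_count_coag_eq(2)[OF y of_nat_0_le_iff s])
  have B: "\<forall>\<^sub>F m in sequentially. ramp (real m) (real j) (soft_count_seq (real m) (t j) y) = (if t j < ranked y j then 1 else 0)" for j
    using eventually_ramp_count[OF is_decreasing_rearrangement_ranked[OF y] summable_on_ramp[OF y of_nat_0_le_iff t]]
    by (simp add: soft_count_seq_def)
  have "\<forall>\<^sub>F m in sequentially. \<forall>j\<in>J. ramp (real m) (real j) (soft_count_coag (real m) (s j) y I) = (if s j < coag_map y I j then 1 else 0)"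
    by (intro eventually_ball_finite fin ballI A)
  moreover have "\<forall>\<^sub>F m in sequentially. \<forall>j\<in>J'. ramp (real m) (real j) (soft_count_seq (real m) (t j) y) = (if t j < ranked y j then 1 else 0)"
    by (intro eventually_ball_finite fin ballI B)
  ultimately have "\<forall>\<^sub>F m in sequentially. ennreal (test_functional J J' s t (real m) z) =
     indicator {z. (\<forall>j\<in>J. s j < fst z j) \<and> (\<forall>j\<in>J'. t j < snd z j)} (coag_rank z)"
  proof eventually_elim
    case (elim m)
    have p: "(\<Prod>j\<in>K. if Q j then 1 else (0::real)) = (if \<forall>j\<in>K. Q j then 1 else 0)" if "finite K" for K :: "nat set" and Q
      using that by (induction K) auto
    have "test_functional J J' s t (real m) z =
        (\<Prod>j\<in>J. if s j < coag_map y I j then 1 else 0) * (\<Prod>j\<in>J'. if t j < ranked y j then 1 else 0)"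
      unfolding test_functional_def yI fst_conv snd_conv using elim by simp
    then show ?case
      by (auto simp: p[OF fin(1)] p[OF fin(2)] coag_rank_def yI)
  qed
  then show ?thesis by (rule tendsto_eventually)
qed

context
  fixes \<alpha> :: real
  assumes \<alpha>: "0 \<le> \<alpha>" "\<alpha> < 1"
begin

text \<open>
  Splitting a unit length in two and breaking the parts gives, up to order, the same marked
  collection as breaking the whole and marking with a random success probability.  Both laws satisfy
  the same recursion, hence agree on the test functionals.  Letting the slope \<open>m\<close> tend to infinity
  gives equality on boxes with nonnegative bounds, and negative bounds are no restriction since all
  entries are positive almost surely.
\<close>

proposition split_law_eq_mark_law:
  assumes ab: "0 < a" "0 < b"
  shows "distr (split_law \<alpha> a b) (seq_space \<Otimes>\<^sub>M seq_space) coag_rank =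
    distr (mark_law \<alpha> a b) (seq_space \<Otimes>\<^sub>M seq_space) coag_rank"
proof -
  interpret P: prob_space "split_law \<alpha> a b" by (rule prob_space_split_law[OF \<alpha> ab])
  interpret Q: prob_space "mark_law \<alpha> a b" by (rule prob_space_mark_law[OF \<alpha> ab])
  let ?D = "\<lambda>M. distr M (seq_space \<Otimes>\<^sub>M seq_space) coag_rank"
  let ?Box = "\<lambda>J J' s t. {z :: (nat \<Rightarrow> real) \<times> (nat \<Rightarrow> real). (\<forall>j\<in>J. s j < fst z j) \<and> (\<forall>j\<in>J'. t j < snd z j)}"
  have box_sets: "?Box J J' s t \<in> sets (seq_space \<Otimes>\<^sub>M seq_space)" if "finite J" "finite J'" for J J' s t
  proof -
    have [measurable]: "finite J" "finite J'" by fact+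
    have "{z \<in> space (seq_space \<Otimes>\<^sub>M seq_space). (\<forall>j\<in>J. s j < fst z j) \<and> (\<forall>j\<in>J'. t j < snd z j)} \<in> sets (seq_space \<Otimes>\<^sub>M seq_space)"
      by measurable
    then show ?thesis by (simp add: space_pair_measure)
  qed
  have lim: "(\<lambda>m. \<integral>\<^sup>+z. ennreal (test_functional J J' s t (real m) z) \<partial>M) \<longlonglongrightarrow> emeasure (?D M) (?Box J J' s t)"
    if fin: "finite J" "finite J'" and st: "\<And>j. 0 \<le> s j" "\<And>j. 0 \<le> t j"
      and M: "prob_space M" "sets M = sets marked_space" "AE z in M. unit_sequence (fst z) \<and> proper_marks (snd z)"
    for J J' s t M
  proof -
    interpret prob_space M by fact
    have [measurable_cong]: "sets M = sets marked_space" by fact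
    have [measurable]: "?Box J J' s t \<in> sets (seq_space \<Otimes>\<^sub>M seq_space)" by (rule box_sets[OF fin])
    have "emeasure (?D M) (?Box J J' s t) =
      (\<integral>\<^sup>+w. indicator (?Box J J' s t) w \<partial>?D M)"
      by simp
    also have "\<dots> = (\<integral>\<^sup>+z. indicator (?Box J J' s t) (coag_rank z) \<partial>M)"
      by (rule nn_integral_distr) measurable
    finally have e: "emeasure (?D M) (?Box J J' s t) =
       (\<integral>\<^sup>+z. indicator (?Box J J' s t) (coag_rank z) \<partial>M)" .
    show ?thesis unfolding e
    proof (rule nn_integral_dominated_convergence[where w="\<lambda>_. 1"])
      show "AE z in M. (\<lambda>m. ennreal (test_functional J J' s t (real m) z)) \<longlonglongrightarrow> indicator (?Box J J' s t) (coag_rank z)"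
        using M(3) by eventually_elim (use fin st in \<open>auto intro!: test_functional_tendsto\<close>)
    qed (auto simp: test_functional_range emeasure_space_1)
  qed
  have pos: "emeasure (?D M) (?Box J J' s t) =
     emeasure (?D M) (?Box J J' (\<lambda>j. max 0 (s j)) (\<lambda>j. max 0 (t j)))"
    if fin: "finite J" "finite J'"
      and M: "sets M = sets marked_space" "AE z in M. unit_sequence (fst z) \<and> proper_marks (snd z)" for J J' s t M
  proof (rule emeasure_eq_AE)
    have m: "coag_rank \<in> M \<rightarrow>\<^sub>M seq_space \<Otimes>\<^sub>M seq_space"
      using measurable_coag_rank measurable_cong_sets[OF M(1) refl] by blast
    have "AE z in M. (\<forall>j. 0 < fst (coag_rank z) j) \<and> (\<forall>j. 0 < snd (coag_rank z) j)"
      using M(2)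
    proof eventually_elim
      case (elim z)
      then have z: "unit_sequence (fst z)" "proper_marks (snd z)" by auto
      show ?case
        using rearrangement_pos[OF is_decreasing_rearrangement_coag_map[OF z] coag_family_pos[OF z]]
          rearrangement_pos[OF is_decreasing_rearrangement_ranked[OF z(1)] unit_sequence_summable(3)[OF z(1)]]
        by (simp add: coag_rank_def)
    qed
    moreover have "{w \<in> space (seq_space \<Otimes>\<^sub>M seq_space). (\<forall>j. 0 < fst w j) \<and> (\<forall>j. 0 < snd w j)} \<in> sets (seq_space \<Otimes>\<^sub>M seq_space)"
      by measurable
    ultimately have "AE w in ?D M. (\<forall>j. 0 < fst w j) \<and> (\<forall>j. 0 < snd w j)"
      by (subst AE_distr_iff[OF m]) auto
    then show "AE w in ?D M. w \<in> ?Box J J' s t \<longleftrightarrow> w \<in> ?Box J J' (\<lambda>j. max 0 (s j)) (\<lambda>j. max 0 (t j))"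
      by eventually_elim auto
  qed (simp_all only: sets_distr box_sets[OF fin])
  note P = AE_split_law_proper[OF \<alpha> ab] and Q = AE_mark_law_proper[OF \<alpha> ab]
  show ?thesis
  proof (rule box_measure_eqI)
    show "finite_measure (?D (split_law \<alpha> a b))"
      by (rule P.finite_measure_distr) measurable
    fix J J' :: "nat set" and s t :: "nat \<Rightarrow> real" assume fin: "finite J" "finite J'"
    \<comment> \<open>The Lipschitz estimates need nonnegative thresholds.\<close>
    define s' t' where "s' j = max 0 (s j)" and "t' j = max 0 (t j)" for j
    have st: "0 \<le> s' j" "0 \<le> t' j" for j by (auto simp: s'_def t'_def)
    have eq: "(\<integral>\<^sup>+z. ennreal (test_functional J J' s' t' (real m) z) \<partial>split_law \<alpha> a b) =
        (\<integral>\<^sup>+z. ennreal (test_functional J J' s' t' (real m) z) \<partial>mark_law \<alpha> a b)" for m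
      by (rule stick_recursive_unique[OF \<alpha> stick_recursive_split_law[OF \<alpha>] stick_recursive_mark_law[OF \<alpha>] ab
            _ symmetric_test_functional _ tail_lipschitz_test_functional])
         (auto simp: st)
    have "emeasure (?D (split_law \<alpha> a b)) (?Box J J' s t) =
        emeasure (?D (split_law \<alpha> a b)) (?Box J J' s' t')"
      using pos[OF fin sets_split_law P, of s t] unfolding s'_def t'_def .
    also have "\<dots> = emeasure (?D (mark_law \<alpha> a b)) (?Box J J' s' t')"
      using lim[OF fin, of s' t', OF st P.prob_space_axioms sets_split_law P]
        lim[OF fin, of s' t', OF st Q.prob_space_axioms sets_mark_law Q]
      unfolding eq by (rule LIMSEQ_unique)
    also have "\<dots> = emeasure (?D (mark_law \<alpha> a b)) (?Box J J' s t)"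
      using pos[OF fin sets_mark_law Q, of s t, symmetric] unfolding s'_def t'_def .
    finally show "emeasure (?D (split_law \<alpha> a b)) (?Box J J' s t) =
        emeasure (?D (mark_law \<alpha> a b)) (?Box J J' s t)" .
  qed auto
qed

end

section \<open>Conditional laws and joint laws\<close>

text \<open>
  Integrating the defining property over the sets \<open>X -` A\<close>, which make up the sigma-algebra generated
  by \<open>X\<close>, trades the conditional expectation for joint probabilities.
\<close>

lemma regular_conditional_law_iff_joint:
  assumes "prob_space M" and X[measurable]: "X \<in> M \<rightarrow>\<^sub>M S" and Y[measurable]: "Y \<in> M \<rightarrow>\<^sub>M T"
    and K[measurable]: "K \<in> S \<rightarrow>\<^sub>M prob_algebra T"
  shows "regular_conditional_law M S X T Y K \<longleftrightarrow>
    (\<forall>A\<in>sets S. \<forall>B\<in>sets T. emeasure M (X -` A \<inter> Y -` B \<inter> space M) =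
       (\<integral>\<^sup>+\<omega>. indicator A (X \<omega>) * emeasure (K (X \<omega>)) B \<partial>M))"
proof -
  interpret prob_space M by fact
  let ?F = "vimage_algebra (space M) X S"
  have XF: "X \<in> ?F \<rightarrow>\<^sub>M S"
    using measurable_vimage_algebra1[of X "space M" S] measurable_space[OF X] by auto
  have sub: "subalgebra M ?F"
    unfolding subalgebra_def using X
    by (auto simp: sets_vimage_algebra2 measurable_space[OF X] Pi_iff)
  interpret F: sigma_finite_subalgebra M ?F
    by (rule finite_measure_subalgebra_is_sigma_finite) (unfold_locales, fact sub)
  have setsF: "sets ?F = {X -` A \<inter> space M | A. A \<in> sets S}"
    using measurable_space[OF X] by (subst sets_vimage_algebra2) auto
  have KS[measurable]: "K \<in> S \<rightarrow>\<^sub>M subprob_algebra T"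
    by (rule measurable_prob_algebraD) fact
  have prob_K: "prob_space (K (X \<omega>))" if "\<omega> \<in> space M" for \<omega>
    using measurable_space[OF K measurable_space[OF X that]] by (auto simp: space_prob_algebra)
  have "(AE \<omega> in M. measure (K (X \<omega>)) B = real_cond_exp M ?F (indicator (Y -` B \<inter> space M)) \<omega>) \<longleftrightarrow>
    (\<forall>A\<in>sets S. emeasure M (X -` A \<inter> Y -` B \<inter> space M) =
       (\<integral>\<^sup>+\<omega>. indicator A (X \<omega>) * emeasure (K (X \<omega>)) B \<partial>M))" if B[measurable]: "B \<in> sets T" for B
  proof -
    let ?h = "\<lambda>\<omega>. measure (K (X \<omega>)) B" and ?f = "indicator (Y -` B \<inter> space M) :: 'a \<Rightarrow> real"
    have h01: "0 \<le> ?h \<omega>" "\<omega> \<in> space M \<Longrightarrow> ?h \<omega> \<le> 1" for \<omega>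
      using prob_space.prob_le_1[OF prob_K] by auto
    have mS: "(\<lambda>x. measure (K x) B) \<in> borel_measurable S"
      by measurable
    have mF: "?h \<in> borel_measurable ?F" by (rule measurable_compose[OF XF mS])
    have mh[measurable]: "?h \<in> borel_measurable M" by (rule measurable_compose[OF X mS])
    have ih: "integrable M ?h"
      by (rule integrable_const_bound[where B=1]) (use h01 in \<open>auto intro!: AE_I2\<close>)
    have if': "integrable M ?f"
      using measurable_sets[OF Y B] by (intro integrable_real_indicator) (auto simp: less_top[symmetric])
    \<comment> \<open>Both integrals are finite, so the joint identity in \<open>ennreal\<close> is one between real set integrals.\<close>
    have key: "emeasure M (X -` A \<inter> Y -` B \<inter> space M) = (\<integral>\<^sup>+\<omega>. indicator A (X \<omega>) * emeasure (K (X \<omega>)) B \<partial>M) \<longleftrightarrow>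
      (\<integral>\<omega>\<in>X -` A \<inter> space M. ?f \<omega> \<partial>M) = (\<integral>\<omega>\<in>X -` A \<inter> space M. ?h \<omega> \<partial>M)" if A[measurable]: "A \<in> sets S" for A
    proof -
      have "(\<integral>\<omega>\<in>X -` A \<inter> space M. ?f \<omega> \<partial>M) = (\<integral>\<omega>. indicator (X -` A \<inter> Y -` B \<inter> space M) \<omega> \<partial>M)"
        unfolding set_lebesgue_integral_def by (intro Bochner_Integration.integral_cong) (auto split: split_indicator)
      also have "\<dots> = measure M (X -` A \<inter> Y -` B \<inter> space M)" by (simp add: Int_assoc)
      finally have 1: "(\<integral>\<omega>\<in>X -` A \<inter> space M. ?f \<omega> \<partial>M) = measure M (X -` A \<inter> Y -` B \<inter> space M)" .
      have "(\<integral>\<^sup>+\<omega>. indicator A (X \<omega>) * emeasure (K (X \<omega>)) B \<partial>M) =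
          (\<integral>\<^sup>+\<omega>. ennreal (indicator (X -` A \<inter> space M) \<omega> * ?h \<omega>) \<partial>M)"
      proof (rule nn_integral_cong)
        fix \<omega> assume w: "\<omega> \<in> space M"
        interpret K: prob_space "K (X \<omega>)" by (rule prob_K) fact
        show "indicator A (X \<omega>) * emeasure (K (X \<omega>)) B = ennreal (indicator (X -` A \<inter> space M) \<omega> * ?h \<omega>)"
          using w by (auto simp: K.emeasure_eq_measure split: split_indicator)
      qed
      also have "\<dots> = ennreal (\<integral>\<omega>. indicator (X -` A \<inter> space M) \<omega> * ?h \<omega> \<partial>M)"
        by (rule nn_integral_eq_integral) (auto intro!: integrable_mult_indicator[of _ M ?h, simplified] ih)
      finally have 2: "(\<integral>\<^sup>+\<omega>. indicator A (X \<omega>) * emeasure (K (X \<omega>)) B \<partial>M) = ennreal (\<integral>\<omega>\<in>X -` A \<inter> space M. ?h \<omega> \<partial>M)"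
        by (simp add: set_lebesgue_integral_def)
      have "0 \<le> (\<integral>\<omega>\<in>X -` A \<inter> space M. ?h \<omega> \<partial>M)"
        unfolding set_lebesgue_integral_def by (rule Bochner_Integration.integral_nonneg) simp
      then show ?thesis
        unfolding 1 2 emeasure_eq_measure by (subst ennreal_inj) auto
    qed
    show ?thesis
    proof
      assume ae: "AE \<omega> in M. ?h \<omega> = real_cond_exp M ?F ?f \<omega>"
      show "\<forall>A\<in>sets S. emeasure M (X -` A \<inter> Y -` B \<inter> space M) = (\<integral>\<^sup>+\<omega>. indicator A (X \<omega>) * emeasure (K (X \<omega>)) B \<partial>M)"
      proof
        fix A assume A[measurable]: "A \<in> sets S"
        have "(\<integral>\<omega>\<in>X -` A \<inter> space M. ?f \<omega> \<partial>M) = (\<integral>\<omega>\<in>X -` A \<inter> space M. real_cond_exp M ?F ?f \<omega> \<partial>M)"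
          by (rule F.real_cond_exp_intA[OF if']) (use A setsF in auto)
        also have "\<dots> = (\<integral>\<omega>\<in>X -` A \<inter> space M. ?h \<omega> \<partial>M)"
          unfolding set_lebesgue_integral_def by (rule integral_cong_AE) (use ae in auto)
        finally show "emeasure M (X -` A \<inter> Y -` B \<inter> space M) = (\<integral>\<^sup>+\<omega>. indicator A (X \<omega>) * emeasure (K (X \<omega>)) B \<partial>M)"
          by (simp only: key[OF A])
      qed
    next
      assume j: "\<forall>A\<in>sets S. emeasure M (X -` A \<inter> Y -` B \<inter> space M) = (\<integral>\<^sup>+\<omega>. indicator A (X \<omega>) * emeasure (K (X \<omega>)) B \<partial>M)"
      have "AE \<omega> in M. real_cond_exp M ?F ?f \<omega> = ?h \<omega>"
      proof (rule F.real_cond_exp_charact[OF _ if' ih mF])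
        fix C assume "C \<in> sets ?F"
        then obtain A where "A \<in> sets S" "C = X -` A \<inter> space M" unfolding setsF by blast
        then show "(\<integral>\<omega>\<in>C. ?f \<omega> \<partial>M) = (\<integral>\<omega>\<in>C. ?h \<omega> \<partial>M)"
          using j key by simp
      qed
      then show "AE \<omega> in M. ?h \<omega> = real_cond_exp M ?F ?f \<omega>" by eventually_elim simp
    qed
  qed
  then show ?thesis
    unfolding regular_conditional_law_def using K by blast
qed

lemma suminf_bij:
  fixes f :: "nat \<Rightarrow> ennreal"
  assumes "bij p"
  shows "(\<Sum>i. f (p i)) = (\<Sum>i. f i)"
  using nn_integral_bij_count_space[OF assms, of f] by (simp add: nn_integral_count_space_nat)

lemma unit_sequence_compose:
  assumes p: "bij p" and y: "unit_sequence y"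
  shows "unit_sequence (y \<circ> p)"
  using y suminf_bij[OF p, of "\<lambda>i. ennreal (y i)"] by (simp add: unit_sequence_iff_ennreal)

lemma ranked_bij:
  assumes "unit_sequence y"
  obtains p where "bij p" "ranked y = y \<circ> p" "decseq (ranked y)"
  using is_decreasing_rearrangement_ranked[OF assms] unfolding is_decreasing_rearrangement_def by blast

lemma ranked_simplex_iff: "x \<in> ranked_simplex \<longleftrightarrow> decseq x \<and> unit_sequence x"
  by (auto simp: ranked_simplex_def unit_sequence_def)

lemma ranked_mem_ranked_simplex: "unit_sequence y \<Longrightarrow> ranked y \<in> ranked_simplex"
  using ranked_bij[of y] unit_sequence_compose by (metis ranked_simplex_iff)

lemma sets_ranked_simplex[measurable]: "ranked_simplex \<in> sets seq_space"
proof -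
  have "ranked_simplex = {x \<in> space seq_space. (\<forall>n. x (Suc n) \<le> x n) \<and> unit_sequence x}"
    by (auto simp: ranked_simplex_iff decseq_Suc_iff)
  also have "\<dots> \<in> sets seq_space"
    using measurable_unit_sequence unfolding pred_def
    by (intro sets.sets_Collect_conj sets.sets_Collect_countable_All borel_measurable_le
        measurable_seq_space_component)
  finally show ?thesis .
qed

lemma space_ranked_simplex_space[simp]: "space ranked_simplex_space = ranked_simplex"
  by (simp add: ranked_simplex_space_def space_restrict_space)

text \<open>
  A marginal and a conditional law together are the same as a joint law.  For \<open>B\<close> the whole space the
  joint identity returns the marginal.  The kernel matters only on the ranked simplex, where its
  integrand is extended by zero to a measurable function on all sequences.
\<close>

lemma conditional_law_iff_joint_law:
  assumes M: "prob_space M" and X: "X \<in> M \<rightarrow>\<^sub>M ranked_simplex_space" and Y: "Y \<in> M \<rightarrow>\<^sub>M seq_space"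
    and K: "K \<in> ranked_simplex_space \<rightarrow>\<^sub>M prob_algebra seq_space"
    and P: "sets P = sets seq_space" "AE x in P. x \<in> ranked_simplex"
  shows "(distr M seq_space X = P \<and> regular_conditional_law M ranked_simplex_space X seq_space Y K) \<longleftrightarrow>
    (\<forall>A\<in>sets seq_space. \<forall>B\<in>sets seq_space. emeasure M (X -` A \<inter> Y -` B \<inter> space M) =
       (\<integral>\<^sup>+x. indicator A x * emeasure (K x) B \<partial>P))"
proof -
  have X'[measurable]: "X \<in> M \<rightarrow>\<^sub>M seq_space" and Xr: "\<And>\<omega>. \<omega> \<in> space M \<Longrightarrow> X \<omega> \<in> ranked_simplex"
    using X unfolding ranked_simplex_space_def by (auto simp: measurable_restrict_space2_iff)
  have [measurable_cong]: "sets P = sets seq_space" by fact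
  have spP: "space P = UNIV" using sets_eq_imp_space_eq[OF P(1)] by simp
  define q where "q B x = emeasure (K x) B * indicator ranked_simplex x" for B x
  have q[measurable]: "q B \<in> borel_measurable seq_space" if B: "B \<in> sets seq_space" for B
  proof -
    have "(\<lambda>x. emeasure (K x) B) \<in> borel_measurable ranked_simplex_space"
      using measurable_compose[OF measurable_prob_algebraD[OF K] measurable_emeasure_subprob_algebra[OF B]] .
    then show ?thesis
      unfolding q_def[abs_def] ranked_simplex_space_def
      by (subst (asm) borel_measurable_restrict_space_iff_ennreal) auto
  qed
  have Pq: "(\<integral>\<^sup>+x. indicator A x * emeasure (K x) B \<partial>P) = (\<integral>\<^sup>+x. indicator A x * q B x \<partial>P)" for A B
    by (rule nn_integral_cong_AE, use P(2) in eventually_elim) (auto simp: q_def)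
  have Mq: "(\<integral>\<^sup>+\<omega>. indicator A (X \<omega>) * emeasure (K (X \<omega>)) B \<partial>M) = (\<integral>\<^sup>+x. indicator A x * q B x \<partial>distr M seq_space X)"
    if [measurable]: "A \<in> sets seq_space" "B \<in> sets seq_space" for A B
  proof -
    have "(\<integral>\<^sup>+\<omega>. indicator A (X \<omega>) * emeasure (K (X \<omega>)) B \<partial>M) = (\<integral>\<^sup>+\<omega>. indicator A (X \<omega>) * q B (X \<omega>) \<partial>M)"
      by (rule nn_integral_cong) (auto simp: q_def Xr)
    also have "\<dots> = (\<integral>\<^sup>+x. indicator A x * q B x \<partial>distr M seq_space X)"
      by (rule nn_integral_distr[symmetric]) measurable
    finally show ?thesis .
  qed
  have rcl: "regular_conditional_law M ranked_simplex_space X seq_space Y K \<longleftrightarrow>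
    (\<forall>A\<in>sets seq_space. \<forall>B\<in>sets seq_space. emeasure M (X -` A \<inter> Y -` B \<inter> space M) =
       (\<integral>\<^sup>+x. indicator A x * q B x \<partial>distr M seq_space X))"
  proof -
    have "(\<forall>A\<in>sets ranked_simplex_space. \<forall>B\<in>sets seq_space. emeasure M (X -` A \<inter> Y -` B \<inter> space M) =
       (\<integral>\<^sup>+\<omega>. indicator A (X \<omega>) * emeasure (K (X \<omega>)) B \<partial>M)) \<longleftrightarrow>
      (\<forall>A\<in>sets seq_space. \<forall>B\<in>sets seq_space. emeasure M (X -` A \<inter> Y -` B \<inter> space M) =
       (\<integral>\<^sup>+\<omega>. indicator A (X \<omega>) * emeasure (K (X \<omega>)) B \<partial>M))" (is "(\<forall>A\<in>_. ?Q A) \<longleftrightarrow> (\<forall>A\<in>_. ?Q A)")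
    proof -
      have sub: "?Q (ranked_simplex \<inter> A) \<longleftrightarrow> ?Q A" for A
      proof -
        have "X -` (ranked_simplex \<inter> A) \<inter> Y -` B \<inter> space M = X -` A \<inter> Y -` B \<inter> space M" for B
          using Xr by auto
        moreover have "(\<integral>\<^sup>+\<omega>. indicator (ranked_simplex \<inter> A) (X \<omega>) * emeasure (K (X \<omega>)) B \<partial>M) =
            (\<integral>\<^sup>+\<omega>. indicator A (X \<omega>) * emeasure (K (X \<omega>)) B \<partial>M)" for B
          by (rule nn_integral_cong) (auto simp: Xr split: split_indicator)
        ultimately show ?thesis by simp
      qed
      have "sets ranked_simplex_space = (\<lambda>A. ranked_simplex \<inter> A) ` sets seq_space"
        by (simp add: ranked_simplex_space_def sets_restrict_space)
      then show ?thesis using sub by auto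
    qed
    then show ?thesis
      unfolding regular_conditional_law_iff_joint[OF M X Y K] by (simp add: Mq)
  qed
  show ?thesis
  proof
    assume l: "distr M seq_space X = P \<and> regular_conditional_law M ranked_simplex_space X seq_space Y K"
    then show "\<forall>A\<in>sets seq_space. \<forall>B\<in>sets seq_space. emeasure M (X -` A \<inter> Y -` B \<inter> space M) =
       (\<integral>\<^sup>+x. indicator A x * emeasure (K x) B \<partial>P)"
      unfolding rcl Pq by simp
  next
    assume r: "\<forall>A\<in>sets seq_space. \<forall>B\<in>sets seq_space. emeasure M (X -` A \<inter> Y -` B \<inter> space M) =
       (\<integral>\<^sup>+x. indicator A x * emeasure (K x) B \<partial>P)"
    have XP: "distr M seq_space X = P"
    proof (rule measure_eqI)
      fix A assume "A \<in> sets (distr M seq_space X)"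
      then have A[measurable]: "A \<in> sets seq_space" by simp
      have Kx: "emeasure (K x) UNIV = 1" if "x \<in> ranked_simplex" for x
      proof -
        have "K x \<in> space (prob_algebra seq_space)"
          using measurable_space[OF K] that by simp
        then have "prob_space (K x)" "sets (K x) = sets seq_space" by (auto simp: space_prob_algebra)
        then show ?thesis
          using prob_space.emeasure_space_1[of "K x"] sets_eq_imp_space_eq[of "K x" seq_space] by simp
      qed
      have "emeasure (distr M seq_space X) A = emeasure M (X -` A \<inter> Y -` UNIV \<inter> space M)"
        by (simp add: emeasure_distr)
      also have "\<dots> = (\<integral>\<^sup>+x. indicator A x * emeasure (K x) UNIV \<partial>P)"
        using bspec[OF bspec[OF r A] sets.top[of seq_space]] by simp
      also have "\<dots> = (\<integral>\<^sup>+x. indicator A x \<partial>P)"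
        by (rule nn_integral_cong_AE, use P(2) in eventually_elim) (simp add: Kx)
      also have "\<dots> = emeasure P A" by (rule nn_integral_indicator) simp
      finally show "emeasure (distr M seq_space X) A = emeasure P A" .
    qed (simp add: P)
    then show "distr M seq_space X = P \<and> regular_conditional_law M ranked_simplex_space X seq_space Y K"
      using r unfolding rcl Pq by simp
  qed
qed

section \<open>Fragmentation and coagulation of the sticks\<close>

lemma measurable_frag_map[measurable (raw)]:
  assumes [measurable]: "f \<in> M \<rightarrow>\<^sub>M seq_space" "g \<in> M \<rightarrow>\<^sub>M seq_space"
  shows "(\<lambda>w. frag_map (f w) i (g w)) \<in> M \<rightarrow>\<^sub>M seq_space"
proof -
  have "(Inl ` {j. j \<noteq> i} \<union> range Inr :: (nat + nat) set) = {c. case c of Inl j \<Rightarrow> j \<noteq> i | Inr k \<Rightarrow> True}"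
  proof (rule set_eqI)
    fix c :: "nat + nat"
    show "c \<in> Inl ` {j. j \<noteq> i} \<union> range Inr \<longleftrightarrow> c \<in> {c. case c of Inl j \<Rightarrow> j \<noteq> i | Inr k \<Rightarrow> True}"
      by (cases c) auto
  qed
  then have "(\<lambda>w. frag_map (f w) i (g w)) = (\<lambda>w. decreasing_rearrangement
      {c. case c of Inl j \<Rightarrow> j \<noteq> i | Inr k \<Rightarrow> True} (case_sum (f w) (\<lambda>k. f w i * g w k)))"
    by (simp add: frag_map_def)
  also have "\<dots> \<in> M \<rightarrow>\<^sub>M seq_space"
  proof (rule measurable_decreasing_rearrangement)
    fix c :: "nat + nat"
    show "(\<lambda>w. case_sum (f w) (\<lambda>k. f w i * g w k) c) \<in> borel_measurable M" by (cases c) auto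
    show "Measurable.pred M (\<lambda>w. case c of Inl j \<Rightarrow> j \<noteq> i | Inr k \<Rightarrow> True)" by (cases c) auto
  qed
  finally show ?thesis .
qed

lemma frag_map_compose:
  assumes p: "bij p"
  shows "frag_map (x \<circ> p) i \<eta> = frag_map x (p i) \<eta>"
  unfolding frag_map_def
proof (rule decreasing_rearrangement_reindex)
  show "bij_betw (map_sum p id) (Inl ` {j. j \<noteq> i} \<union> range Inr) (Inl ` {j. j \<noteq> p i} \<union> range Inr)"
  proof (rule bij_betwI[where g="map_sum (inv p) id"])
    show "map_sum p id \<in> Inl ` {j. j \<noteq> i} \<union> range Inr \<rightarrow> Inl ` {j. j \<noteq> p i} \<union> range Inr"
      using p by (auto simp: bij_def inj_eq)
    show "map_sum (inv p) id \<in> Inl ` {j. j \<noteq> p i} \<union> range Inr \<rightarrow> Inl ` {j. j \<noteq> i} \<union> range Inr"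
      using p by (auto simp: bij_def surj_f_inv_f)
  qed (use p in \<open>auto simp: bij_def surj_f_inv_f\<close>)
  show "case_sum (x \<circ> p) (\<lambda>k. (x \<circ> p) i * \<eta> k) c = case_sum x (\<lambda>k. x (p i) * \<eta> k) (map_sum p id c)" for c
    by (cases c) auto
qed

lemma frag_map_compose_fragments:
  assumes p: "bij p"
  shows "frag_map x i (\<eta> \<circ> p) = frag_map x i \<eta>"
  unfolding frag_map_def
proof (rule decreasing_rearrangement_reindex)
  show "bij_betw (map_sum id p) (Inl ` {j. j \<noteq> i} \<union> range Inr) (Inl ` {j. j \<noteq> i} \<union> range Inr)"
    by (rule bij_betwI[where g="map_sum id (inv p)"]) (use p in \<open>auto simp: bij_def surj_f_inv_f\<close>)
  show "case_sum x (\<lambda>k. x i * (\<eta> \<circ> p) k) c = case_sum x (\<lambda>k. x i * \<eta> k) (map_sum id p c)" for c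
    by (cases c) auto
qed

text \<open>
  Fragmenting the first stick by \<open>\<eta>\<close> yields the sticks of \<open>\<eta>\<close> scaled by \<open>v\<close> and those of \<open>x'\<close>
  scaled by \<open>1 - v\<close>.
\<close>

lemma frag_map_prepend_stick: "frag_map (prepend_stick v x') 0 \<eta> = ranked (merge_seq v \<eta> x')"
  unfolding frag_map_def
proof (rule decreasing_rearrangement_reindex)
  let ?s = "case_sum (\<lambda>j. 2 * j - 1) (\<lambda>k. 2 * k :: nat)"
  show "bij_betw ?s (Inl ` {j. j \<noteq> 0} \<union> range Inr) UNIV"
    by (rule bij_betwI[where g="\<lambda>n. if even n then Inr (n div 2) else Inl (Suc (n div 2))"])
       (auto simp: gr0_conv_Suc)
  show "case_sum (prepend_stick v x') (\<lambda>k. prepend_stick v x' 0 * \<eta> k) c = merge_seq v \<eta> x' (?s c)"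
    if "c \<in> Inl ` {j. j \<noteq> 0} \<union> range Inr" for c
    using that by (auto simp: merge_seq_def gr0_conv_Suc)
qed

text \<open>
  Merging the fragments restores the stick \<open>v\<close> because their total length is \<open>v\<close>.
\<close>

lemma coag_map_merge_seq:
  assumes "unit_sequence \<eta>"
  shows "coag_map (merge_seq v \<eta> x') even = ranked (prepend_stick v x')"
  unfolding coag_map_eq
proof (rule decreasing_rearrangement_reindex[symmetric])
  let ?s = "case_nat None (\<lambda>k. Some (2 * k + 1)) :: nat \<Rightarrow> nat option"
  show "bij_betw ?s UNIV (coag_blocks even)"
    by (rule bij_betwI[where g="case_option 0 (\<lambda>n. Suc (n div 2))"])
       (auto simp: coag_blocks_def split: nat.split)
  have "infsum (merge_seq v \<eta> x') {i. even i} = v"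
  proof -
    have "bij_betw (\<lambda>k::nat. 2 * k) UNIV {i. even i}"
      by (rule bij_betwI[where g="\<lambda>n. n div 2"]) auto
    from infsum_reindex_bij_betw[OF this, of "merge_seq v \<eta> x'"]
    have "infsum (merge_seq v \<eta> x') {i. even i} = infsum (\<lambda>k. v * \<eta> k) UNIV"
      by (simp add: merge_seq_def)
    also have "\<dots> = v * infsum \<eta> UNIV"
      by (rule infsum_cmult_right) (simp add: unit_sequence_summable[OF assms])
    also have "infsum \<eta> UNIV = 1"
    proof -
      have "\<eta> sums infsum \<eta> UNIV"
        by (intro has_sum_imp_sums has_sum_infsum unit_sequence_summable assms)
      then show ?thesis using assms by (auto simp: unit_sequence_def dest: sums_unique2)
    qed
    finally show ?thesis by simp
  qed
  then show "prepend_stick v x' i = coag_family (merge_seq v \<eta> x') even (?s i)" for i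
    by (cases i) (simp_all add: coag_family_def, simp add: merge_seq_def)
qed

lemma PD_eq_ranked_GEM: "PD \<alpha> \<theta> = distr (GEM \<alpha> \<theta>) seq_space ranked"
  unfolding PD_def GEM_def
  by (subst distr_distr[OF measurable_ranked measurable_stick_breaking_PiM]) (simp add: comp_def)

lemma sets_PD[measurable_cong, simp]: "sets (PD \<alpha> \<theta>) = sets seq_space"
  by (simp add: PD_def)

lemma space_PD[simp]: "space (PD \<alpha> \<theta>) = UNIV"
  by (simp add: PD_def)

lemma measurable_ranked_GEM[measurable]: "ranked \<in> GEM \<alpha> \<theta> \<rightarrow>\<^sub>M seq_space"
  by measurable

lemma distr_uniform_threshold:
  "distr (uniform_measure lborel {0<..<1}) (count_space UNIV) (\<lambda>u. u < b) = measure_pmf (bernoulli_pmf b)"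
proof (rule measure_eqI_countable[where A=UNIV])
  fix m :: bool
  let ?c = "min 1 (max 0 b)"
  have c: "0 \<le> ?c" "?c \<le> 1" by auto
  have "emeasure (distr (uniform_measure lborel {0<..<1}) (count_space UNIV) (\<lambda>u. u < b)) {m} =
      emeasure (uniform_measure lborel {0<..<1}) {u. (u < b) = m}"
    by (subst emeasure_distr) (auto simp: vimage_def)
  also have "\<dots> = emeasure (uniform_measure lborel {0<..<1}) {u. (u < ?c) = m}"
  proof -
    have "{0<..<1} \<inter> {u. (u < b) = m} = {0<..<1} \<inter> {u. (u < ?c) = m}" by auto
    then show ?thesis by (subst (1 2) emeasure_uniform_measure) auto
  qed
  also have "\<dots> = ennreal (if m then ?c else 1 - ?c)"
    using emeasure_uniform_less[OF c] by (cases m) auto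
  also have "\<dots> = emeasure (measure_pmf (bernoulli_pmf b)) {m}"
    by (simp add: emeasure_pmf_single bernoulli_pmf.rep_eq)
  finally show "emeasure (distr (uniform_measure lborel {0<..<1}) (count_space UNIV) (\<lambda>u. u < b)) {m} =
      emeasure (measure_pmf (bernoulli_pmf b)) {m}" .
qed simp_all

text \<open>
  This holds for every real \<open>b\<close>, as \<open>bernoulli_pmf\<close> clamps its argument to the unit interval; hence
  the mixture over \<open>b\<close> is taken over a kernel that is measurable everywhere.
\<close>

lemma distr_uniform_seq_threshold:
  "distr uniform_seq mark_space (\<lambda>u i. u i < b) = PiM UNIV (\<lambda>_. measure_pmf (bernoulli_pmf b))"
proof (rule measure_eqI_PiM_infinite[symmetric, OF refl])
  let ?U = "uniform_measure lborel {0<..<1::real}"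
  interpret prob_space "PiM UNIV (\<lambda>_::nat. measure_pmf (bernoulli_pmf b))"
    by (intro prob_space_PiM measure_pmf.prob_space_axioms)
  show "finite_measure (PiM UNIV (\<lambda>_::nat. measure_pmf (bernoulli_pmf b)))" by unfold_locales
  show "sets (distr uniform_seq mark_space (\<lambda>u i. u i < b)) = sets (PiM UNIV (\<lambda>_. measure_pmf (bernoulli_pmf b)))"
    by (simp add: sets_mark_space) (rule sets_PiM_cong, auto)
  fix A :: "nat \<Rightarrow> bool set" and J :: "nat set" assume J: "finite J"
  let ?X = "prod_emb UNIV (\<lambda>_. measure_pmf (bernoulli_pmf b)) J (Pi\<^sub>E J A)"
  have X: "?X \<in> sets mark_space"
  proof -
    have "?X = prod_emb UNIV (\<lambda>_. count_space UNIV) J (Pi\<^sub>E J A)" by (simp add: prod_emb_def)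
    also have "\<dots> \<in> sets mark_space" unfolding mark_space_def by (rule sets_PiM_I) (use J in auto)
    finally show ?thesis .
  qed
  have mU: "{u. (u < b) \<in> S} \<in> sets borel" for S
  proof -
    have "(\<lambda>u. u < b) -` S \<inter> space borel \<in> sets borel"
      by (rule measurable_sets[where A="count_space UNIV"]) auto
    then show ?thesis by (simp add: vimage_def)
  qed
  have "emeasure (PiM UNIV (\<lambda>_. measure_pmf (bernoulli_pmf b))) ?X = (\<Prod>j\<in>J. emeasure (measure_pmf (bernoulli_pmf b)) (A j))"
    by (rule emeasure_PiM_emb) (use J in \<open>auto intro: measure_pmf.prob_space_axioms\<close>)
  also have "\<dots> = (\<Prod>j\<in>J. emeasure ?U {u. (u < b) \<in> A j})"
    unfolding distr_uniform_threshold[symmetric] by (subst emeasure_distr) (auto simp: vimage_def)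
  also have "\<dots> = emeasure uniform_seq (prod_emb UNIV (\<lambda>_. ?U) J (\<Pi>\<^sub>E j\<in>J. {u. (u < b) \<in> A j}))"
    unfolding uniform_seq_def by (rule emeasure_PiM_emb[symmetric]) (use J mU in \<open>auto intro: prob_space_uniform\<close>)
  also have "prod_emb UNIV (\<lambda>_. ?U) J (\<Pi>\<^sub>E j\<in>J. {u. (u < b) \<in> A j}) = (\<lambda>u i. u i < b) -` ?X \<inter> space uniform_seq"
    by (auto simp: prod_emb_def uniform_seq_def space_PiM PiE_iff)
  also have "emeasure uniform_seq \<dots> = emeasure (distr uniform_seq mark_space (\<lambda>u i. u i < b)) ?X"
    by (rule emeasure_distr[symmetric]) (use X in measurable)
  finally show "emeasure (PiM UNIV (\<lambda>_. measure_pmf (bernoulli_pmf b))) ?X =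
     emeasure (distr uniform_seq mark_space (\<lambda>u i. u i < b)) ?X" .
qed

text \<open>
  The thresholds are i.i.d., so it does not matter whether they are attached to the sticks or to the
  ranked blocks.
\<close>

lemma nn_integral_uniform_seq_permute:
  assumes p: "bij p" and [measurable]: "f \<in> borel_measurable seq_space"
  shows "(\<integral>\<^sup>+u. f (u \<circ> p) \<partial>uniform_seq) = (\<integral>\<^sup>+u. f u \<partial>uniform_seq)"
proof -
  have m: "(\<lambda>u. u \<circ> p) \<in> uniform_seq \<rightarrow>\<^sub>M uniform_seq"
    by (subst measurable_cong_sets[OF refl sets_uniform_seq]) measurable
  have "distr uniform_seq uniform_seq (\<lambda>u. u \<circ> p) = uniform_seq"
    using distr_PiM_reindex[of UNIV "\<lambda>_. uniform_measure lborel {0<..<1::real}" p UNIV] prob_space_uniform p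
    by (auto simp: uniform_seq_def bij_def comp_def restrict_UNIV)
  then have "(\<integral>\<^sup>+u. f u \<partial>uniform_seq) = (\<integral>\<^sup>+u. f u \<partial>distr uniform_seq uniform_seq (\<lambda>u. u \<circ> p))"
    by simp
  also have "\<dots> = (\<integral>\<^sup>+u. f (u \<circ> p) \<partial>uniform_seq)"
    by (rule nn_integral_distr[OF m]) measurable
  finally show ?thesis by simp
qed

lemma coag_parameter_law_eq: "coag_parameter_law \<alpha> \<theta> = success_law \<alpha> (1 - \<alpha>) (\<theta> + \<alpha>)"
  by (simp add: coag_parameter_law_def success_law_def add.commute)

context
  fixes \<alpha> :: real
  assumes \<alpha>: "0 \<le> \<alpha>" "\<alpha> < 1"
begin

lemma prob_space_PD: "0 < \<theta> + \<alpha> \<Longrightarrow> prob_space (PD \<alpha> \<theta>)"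
  unfolding PD_eq_ranked_GEM
  by (intro prob_space.prob_space_distr prob_space_GEM[OF \<alpha>] measurable_ranked_GEM)

lemma AE_PD_ranked_simplex:
  assumes "0 < \<theta> + \<alpha>"
  shows "AE x in PD \<alpha> \<theta>. x \<in> ranked_simplex"
proof -
  have "AE y in GEM \<alpha> \<theta>. ranked y \<in> ranked_simplex"
    using AE_GEM_unit_sequence[OF \<alpha> assms] by eventually_elim (rule ranked_mem_ranked_simplex)
  then show ?thesis
    unfolding PD_eq_ranked_GEM by (subst AE_distr_iff) auto
qed

lemma nn_integral_PD:
  assumes [measurable]: "f \<in> borel_measurable seq_space"
  shows "(\<integral>\<^sup>+x. f x \<partial>PD \<alpha> \<theta>) = (\<integral>\<^sup>+y. f (ranked y) \<partial>GEM \<alpha> \<theta>)"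
  unfolding PD_eq_ranked_GEM by (rule nn_integral_distr) measurable

text \<open>
  The coagulation law on one fixed probability space, where its dependence on \<open>y\<close> is only through
  the map.
\<close>

definition coag_threshold_law :: "real \<Rightarrow> (nat \<Rightarrow> real) \<Rightarrow> (nat \<Rightarrow> real) measure" where
  "coag_threshold_law \<theta> y = distr (success_law \<alpha> (1 - \<alpha>) (\<theta> + \<alpha>) \<Otimes>\<^sub>M uniform_seq) seq_space
    (\<lambda>(b, u). coag_map y (\<lambda>i. u i < b))"

lemma emeasure_coag_threshold_law:
  assumes [measurable]: "A \<in> sets seq_space"
  shows "emeasure (coag_threshold_law \<theta> y) A =
    (\<integral>\<^sup>+b. \<integral>\<^sup>+u. indicator A (coag_map y (\<lambda>i. u i < b)) \<partial>uniform_seq \<partial>success_law \<alpha> (1 - \<alpha>) (\<theta> + \<alpha>))"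
proof -
  let ?S = "success_law \<alpha> (1 - \<alpha>) (\<theta> + \<alpha>)"
  interpret U: prob_space uniform_seq by (rule prob_space_uniform_seq)
  have y[measurable]: "y \<in> space seq_space" by simp
  have "emeasure (coag_threshold_law \<theta> y) A = (\<integral>\<^sup>+x. indicator A x \<partial>coag_threshold_law \<theta> y)"
    by (simp add: coag_threshold_law_def)
  also have "\<dots> = (\<integral>\<^sup>+w. indicator A (case w of (b, u) \<Rightarrow> coag_map y (\<lambda>i. u i < b)) \<partial>(?S \<Otimes>\<^sub>M uniform_seq))"
    unfolding coag_threshold_law_def by (rule nn_integral_distr) measurable
  also have "\<dots> = (\<integral>\<^sup>+b. \<integral>\<^sup>+u. indicator A (coag_map y (\<lambda>i. u i < b)) \<partial>uniform_seq \<partial>?S)"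
    by (subst U.nn_integral_fst[symmetric]) auto
  finally show ?thesis .
qed

lemma Coag_law_eq:
  assumes \<theta>: "0 < \<theta> + \<alpha>"
  shows "Coag_law \<alpha> \<theta> y = coag_threshold_law \<theta> y"
proof -
  let ?S = "success_law \<alpha> (1 - \<alpha>) (\<theta> + \<alpha>)"
  interpret S: prob_space ?S by (rule prob_space_success_law[OF \<alpha>]) (use \<alpha> \<theta> in auto)
  interpret U: prob_space uniform_seq by (rule prob_space_uniform_seq)
  have y[measurable]: "y \<in> space seq_space" by simp
  have cm[measurable]: "coag_map y \<in> mark_space \<rightarrow>\<^sub>M seq_space" by measurable
  define k where "k b = distr uniform_seq seq_space (\<lambda>u. coag_map y (\<lambda>i. u i < b))" for b
  have k: "distr (PiM UNIV (\<lambda>_. measure_pmf (bernoulli_pmf b))) seq_space (coag_map y) = k b" for b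
    unfolding distr_uniform_seq_threshold[symmetric] k_def
    by (subst distr_distr) (auto simp: comp_def)
  have km: "k \<in> ?S \<rightarrow>\<^sub>M subprob_algebra seq_space"
    unfolding k_def[abs_def]
    by (rule measurable_distr2[where M=uniform_seq])
       (auto intro!: measurable_const simp: space_subprob_algebra U.subprob_space_axioms)
  show ?thesis
  proof (rule measure_eqI)
    have C: "Coag_law \<alpha> \<theta> y = ?S \<bind> k"
      unfolding Coag_law_def coag_parameter_law_eq k ..
    have sets_bind: "sets (?S \<bind> k) = sets seq_space"
      using sets_bind[OF sets_kernel[OF km] S.not_empty] by simp
    then show "sets (Coag_law \<alpha> \<theta> y) = sets (coag_threshold_law \<theta> y)"
      unfolding C by (simp add: coag_threshold_law_def)
    fix A assume "A \<in> sets (Coag_law \<alpha> \<theta> y)"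
    then have A[measurable]: "A \<in> sets seq_space"
      unfolding C sets_bind .
    have "emeasure (Coag_law \<alpha> \<theta> y) A = (\<integral>\<^sup>+b. emeasure (k b) A \<partial>?S)"
      unfolding C by (rule emeasure_bind[OF S.not_empty km A])
    also have "\<dots> = (\<integral>\<^sup>+b. \<integral>\<^sup>+u. indicator A (coag_map y (\<lambda>i. u i < b)) \<partial>uniform_seq \<partial>?S)"
    proof (rule nn_integral_cong)
      fix b
      have "emeasure (k b) A = (\<integral>\<^sup>+x. indicator A x \<partial>k b)" by (simp add: k_def)
      also have "\<dots> = (\<integral>\<^sup>+u. indicator A (coag_map y (\<lambda>i. u i < b)) \<partial>uniform_seq)"
        unfolding k_def by (rule nn_integral_distr) measurable
      finally show "emeasure (k b) A = \<dots>" .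
    qed
    finally show "emeasure (Coag_law \<alpha> \<theta> y) A = emeasure (coag_threshold_law \<theta> y) A"
      by (simp add: emeasure_coag_threshold_law)
  qed
qed

lemma measurable_Coag_law:
  assumes \<theta>: "0 < \<theta> + \<alpha>"
  shows "Coag_law \<alpha> \<theta> \<in> ranked_simplex_space \<rightarrow>\<^sub>M prob_algebra seq_space"
proof -
  let ?S = "success_law \<alpha> (1 - \<alpha>) (\<theta> + \<alpha>)"
  interpret S: prob_space ?S by (rule prob_space_success_law[OF \<alpha>]) (use \<alpha> \<theta> in auto)
  interpret U: prob_space uniform_seq by (rule prob_space_uniform_seq)
  interpret SU: pair_prob_space ?S uniform_seq ..
  have "coag_threshold_law \<theta> \<in> seq_space \<rightarrow>\<^sub>M prob_algebra seq_space"
  proof (rule measurable_prob_algebraI)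
    show "coag_threshold_law \<theta> \<in> seq_space \<rightarrow>\<^sub>M subprob_algebra seq_space"
      unfolding coag_threshold_law_def
      by (rule measurable_distr2[where M="?S \<Otimes>\<^sub>M uniform_seq"])
         (auto intro!: measurable_const simp: space_subprob_algebra SU.subprob_space_axioms)
    fix y :: "nat \<Rightarrow> real"
    have [measurable]: "y \<in> space seq_space" by simp
    show "prob_space (coag_threshold_law \<theta> y)"
      unfolding coag_threshold_law_def by (rule SU.prob_space_distr) measurable
  qed
  then show ?thesis
    unfolding Coag_law_eq[OF \<theta>, abs_def] ranked_simplex_space_def by (rule measurable_restrict_space1)
qed

lemma emeasure_Frag_law:
  assumes x: "x \<in> ranked_simplex" and B[measurable]: "B \<in> sets seq_space"
  shows "emeasure (Frag_law \<alpha> x) B =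
    (\<Sum>i. ennreal (x i) * (\<integral>\<^sup>+\<eta>. indicator B (frag_map x i \<eta>) \<partial>PD \<alpha> (1 - \<alpha>)))"
    and "prob_space (Frag_law \<alpha> x)"
proof -
  let ?p = "measure_pmf (embed_pmf x)" and ?P = "PD \<alpha> (1 - \<alpha>)"
  interpret P: prob_space ?P by (rule prob_space_PD) (use \<alpha> in auto)
  interpret pP: pair_prob_space ?p ?P ..
  have u: "unit_sequence x" using x by (simp add: ranked_simplex_iff)
  have pmf: "pmf (embed_pmf x) i = x i" for i
    using u unit_sequence_summable(4)[OF u]
    by (intro pmf_embed_pmf) (auto simp: nn_integral_count_space_nat unit_sequence_iff_ennreal)
  have [measurable]: "x \<in> space seq_space" by simp
  have [measurable]: "(\<lambda>(i, \<eta>). frag_map x i \<eta>) \<in> ?p \<Otimes>\<^sub>M ?P \<rightarrow>\<^sub>M seq_space"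
  proof -
    have "(\<lambda>(i, \<eta>). frag_map x i \<eta>) \<in> count_space UNIV \<Otimes>\<^sub>M ?P \<rightarrow>\<^sub>M seq_space"
      by (rule measurable_pair_measure_countable1) auto
    then show ?thesis by (simp cong: measurable_cong_sets)
  qed
  show "prob_space (Frag_law \<alpha> x)"
    unfolding Frag_law_def by (rule pP.prob_space_distr) measurable
  have "emeasure (Frag_law \<alpha> x) B = (\<integral>\<^sup>+z. indicator B z \<partial>Frag_law \<alpha> x)"
    by (simp add: Frag_law_def)
  also have "\<dots> = (\<integral>\<^sup>+w. indicator B (case w of (i, \<eta>) \<Rightarrow> frag_map x i \<eta>) \<partial>(?p \<Otimes>\<^sub>M ?P))"
    unfolding Frag_law_def by (rule nn_integral_distr) measurable
  also have "\<dots> = (\<integral>\<^sup>+i. \<integral>\<^sup>+\<eta>. indicator B (frag_map x i \<eta>) \<partial>?P \<partial>?p)"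
    by (subst P.nn_integral_fst[symmetric]) auto
  also have "\<dots> = (\<Sum>i. ennreal (x i) * (\<integral>\<^sup>+\<eta>. indicator B (frag_map x i \<eta>) \<partial>?P))"
    by (simp add: nn_integral_measure_pmf pmf nn_integral_count_space_nat)
  finally show "emeasure (Frag_law \<alpha> x) B = \<dots>" .
qed

lemma measurable_Frag_law: "Frag_law \<alpha> \<in> ranked_simplex_space \<rightarrow>\<^sub>M prob_algebra seq_space"
proof (rule measurable_prob_algebraI)
  interpret P: prob_space "PD \<alpha> (1 - \<alpha>)" by (rule prob_space_PD) (use \<alpha> in auto)
  show pr: "prob_space (Frag_law \<alpha> x)" if "x \<in> space ranked_simplex_space" for x
    using that by (intro emeasure_Frag_law(2)) auto
  show "Frag_law \<alpha> \<in> ranked_simplex_space \<rightarrow>\<^sub>M subprob_algebra seq_space"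
  proof (rule measurable_subprob_algebra)
    show "subprob_space (Frag_law \<alpha> x)" if "x \<in> space ranked_simplex_space" for x
      using pr[OF that] by (rule prob_space_imp_subprob_space)
    show "sets (Frag_law \<alpha> x) = sets seq_space" for x by (simp add: Frag_law_def)
    fix B assume [measurable]: "B \<in> sets seq_space"
    have "(\<lambda>x. \<Sum>i. ennreal (x i) * (\<integral>\<^sup>+\<eta>. indicator B (frag_map x i \<eta>) \<partial>PD \<alpha> (1 - \<alpha>))) \<in> borel_measurable seq_space"
      by measurable
    then have "(\<lambda>x. \<Sum>i. ennreal (x i) * (\<integral>\<^sup>+\<eta>. indicator B (frag_map x i \<eta>) \<partial>PD \<alpha> (1 - \<alpha>))) \<in> borel_measurable ranked_simplex_space"
      unfolding ranked_simplex_space_def by (rule measurable_restrict_space1)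
    then show "(\<lambda>x. emeasure (Frag_law \<alpha> x) B) \<in> borel_measurable ranked_simplex_space"
      by (subst measurable_cong) (auto simp: emeasure_Frag_law(1))
  qed
qed

text \<open>
  Pass from the ranked sequence to the sticks.  The fragmented block is a size-biased pick and may
  therefore be taken to be the first stick \<open>v\<close>, with law \<open>beta_law (1 - \<alpha>) (\<theta> + \<alpha>)\<close>.  Its fragments
  form a GEM sequence with parameter \<open>1 - \<alpha>\<close> and the other sticks one with parameter \<open>\<theta> + \<alpha>\<close>.  This
  is \<open>split_law\<close> with \<open>Y\<close> all pieces together and \<open>X\<close> the result of merging the marked ones.
\<close>

lemma nn_integral_PD_Frag_law:
  assumes \<theta>: "0 < \<theta> + \<alpha>" and A[measurable]: "A \<in> sets seq_space" and B[measurable]: "B \<in> sets seq_space"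
  shows "(\<integral>\<^sup>+x. indicator A x * emeasure (Frag_law \<alpha> x) B \<partial>PD \<alpha> \<theta>) =
    (\<integral>\<^sup>+z. indicator (A \<times> B) (coag_rank z) \<partial>split_law \<alpha> (1 - \<alpha>) (\<theta> + \<alpha>))"
proof -
  have pos: "0 < 1 - \<alpha>" "0 < 1 - \<alpha> + \<alpha>" "0 < \<theta> + \<alpha>" "0 < \<theta> + \<alpha> + \<alpha>" using \<alpha> \<theta> by auto
  interpret P: prob_space "PD \<alpha> (1 - \<alpha>)" by (rule prob_space_PD[OF pos(2)])
  interpret G: prob_space "GEM \<alpha> (1 - \<alpha>)" by (rule prob_space_GEM[OF \<alpha> pos(2)])
  interpret G': prob_space "GEM \<alpha> (\<theta> + \<alpha>)" by (rule prob_space_GEM[OF \<alpha> pos(4)])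
  interpret GG: pair_prob_space "GEM \<alpha> (1 - \<alpha>)" "GEM \<alpha> (\<theta> + \<alpha>)" ..
  define q where "q x i = (\<integral>\<^sup>+\<eta>. indicator B (frag_map x i \<eta>) \<partial>PD \<alpha> (1 - \<alpha>))" for x i
  define F where "F x i = indicator A (ranked x) * q x i" for x i
  have [measurable]: "(\<lambda>x. q x i) \<in> borel_measurable seq_space" for i
    unfolding q_def by measurable
  have [measurable]: "(\<lambda>x. F x i) \<in> borel_measurable seq_space" for i
    unfolding F_def by measurable
  have qsym: "q (x \<circ> p) i = q x (p i)" if "bij p" for x p i
    unfolding q_def frag_map_compose[OF that] ..
  have Fsym: "F (x \<circ> p) i = F x (p i)" if "bij p" for x p i
    unfolding F_def ranked_compose[OF that] qsym[OF that] ..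
  have q1: "q x i \<le> 1" for x i
  proof -
    have "q x i \<le> (\<integral>\<^sup>+\<eta>. 1 \<partial>PD \<alpha> (1 - \<alpha>))"
      unfolding q_def by (intro nn_integral_mono) (auto split: split_indicator)
    then show ?thesis using P.emeasure_space_1 by simp
  qed
  have F1: "F x i \<le> 1" for x i
    using q1[of x i] by (auto simp: F_def split: split_indicator)
  have "(\<integral>\<^sup>+x. indicator A x * emeasure (Frag_law \<alpha> x) B \<partial>PD \<alpha> \<theta>) =
      (\<integral>\<^sup>+x. indicator A x * (\<Sum>i. ennreal (x i) * q x i) \<partial>PD \<alpha> \<theta>)"
    by (rule nn_integral_cong_AE, use AE_PD_ranked_simplex[OF \<theta>] in eventually_elim)
       (simp add: emeasure_Frag_law(1) q_def)
  also have "\<dots> = (\<integral>\<^sup>+x. indicator A (ranked x) * (\<Sum>i. ennreal (ranked x i) * q (ranked x) i) \<partial>GEM \<alpha> \<theta>)"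
    by (rule nn_integral_PD) measurable
  also have "\<dots> = (\<integral>\<^sup>+x. (\<Sum>i. ennreal (x i) * F x i) \<partial>GEM \<alpha> \<theta>)"
  proof (rule nn_integral_cong_AE, use AE_GEM_unit_sequence[OF \<alpha> \<theta>] in eventually_elim)
    case (elim x)
    obtain p where p: "bij p" "ranked x = x \<circ> p" using ranked_bij[OF elim] by blast
    have "(\<Sum>i. ennreal (ranked x i) * q (ranked x) i) = (\<Sum>i. ennreal (x (p i)) * q x (p i))"
      unfolding p(2) qsym[OF p(1)] by simp
    also have "\<dots> = (\<Sum>i. ennreal (x i) * q x i)"
      by (rule suminf_bij[OF p(1), of "\<lambda>i. ennreal (x i) * q x i"])
    finally show ?case
      unfolding F_def by (simp add: ennreal_suminf_cmult[symmetric] mult_ac)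
  qed
  also have "\<dots> = (\<integral>\<^sup>+x. F x 0 \<partial>GEM \<alpha> \<theta>)"
    by (rule GEM_size_biased[OF \<alpha> \<theta> _ Fsym F1]) measurable
  also have "\<dots> = (\<integral>\<^sup>+v. \<integral>\<^sup>+x'. F (prepend_stick v x') 0 \<partial>GEM \<alpha> (\<theta> + \<alpha>) \<partial>beta_law (1 - \<alpha>) (\<theta> + \<alpha>))"
    by (rule nn_integral_GEM_rec[OF \<alpha> \<theta>]) measurable
  also have "\<dots> = (\<integral>\<^sup>+v. \<integral>\<^sup>+x'. \<integral>\<^sup>+\<eta>. indicator (A \<times> B) (coag_rank (merge_seq v \<eta> x', even))
      \<partial>GEM \<alpha> (1 - \<alpha>) \<partial>GEM \<alpha> (\<theta> + \<alpha>) \<partial>beta_law (1 - \<alpha>) (\<theta> + \<alpha>))"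
  proof (intro nn_integral_cong)
    fix v :: real and x' :: "nat \<Rightarrow> real"
    have [measurable]: "x' \<in> space seq_space" by simp
    have "F (prepend_stick v x') 0 = indicator A (ranked (prepend_stick v x')) *
        (\<integral>\<^sup>+\<eta>. indicator B (frag_map (prepend_stick v x') 0 (ranked \<eta>)) \<partial>GEM \<alpha> (1 - \<alpha>))"
      unfolding F_def q_def by (subst nn_integral_PD) auto
    also have "\<dots> = (\<integral>\<^sup>+\<eta>. indicator A (ranked (prepend_stick v x')) * indicator B (frag_map (prepend_stick v x') 0 (ranked \<eta>)) \<partial>GEM \<alpha> (1 - \<alpha>))"
      by (rule nn_integral_cmult[symmetric]) measurable
    also have "\<dots> = (\<integral>\<^sup>+\<eta>. indicator (A \<times> B) (coag_rank (merge_seq v \<eta> x', even)) \<partial>GEM \<alpha> (1 - \<alpha>))"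
    proof (rule nn_integral_cong_AE, use AE_GEM_unit_sequence[OF \<alpha> pos(2)] in eventually_elim)
      case (elim \<eta>)
      obtain p where p: "bij p" "ranked \<eta> = \<eta> \<circ> p" using ranked_bij[OF elim] by blast
      show ?case
        unfolding p(2) frag_map_compose_fragments[OF p(1)] frag_map_prepend_stick coag_rank_def fst_conv snd_conv
          coag_map_merge_seq[OF elim] by (auto split: split_indicator)
    qed
    finally show "F (prepend_stick v x') 0 = \<dots>" .
  qed
  also have "\<dots> = (\<integral>\<^sup>+v. \<integral>\<^sup>+\<eta>. \<integral>\<^sup>+x'. indicator (A \<times> B) (coag_rank (merge_seq v \<eta> x', even))
      \<partial>GEM \<alpha> (\<theta> + \<alpha>) \<partial>GEM \<alpha> (1 - \<alpha>) \<partial>beta_law (1 - \<alpha>) (\<theta> + \<alpha>))"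
    by (intro nn_integral_cong GG.Fubini') measurable
  also have "\<dots> = (\<integral>\<^sup>+z. indicator (A \<times> B) (coag_rank z) \<partial>split_law \<alpha> (1 - \<alpha>) (\<theta> + \<alpha>))"
    by (rule nn_integral_split_law[OF \<alpha> pos(1,3), symmetric]) measurable
  finally show ?thesis .
qed

text \<open>
  The marks may be attached to the sticks instead of the ranked blocks, which gives \<open>mark_law\<close>; its
  stick parameter is \<open>(1 - \<alpha>) + (\<theta> + \<alpha>) = \<theta> + 1\<close>.
\<close>

lemma nn_integral_PD_Coag_law:
  assumes \<theta>: "0 < \<theta> + \<alpha>" and A[measurable]: "A \<in> sets seq_space" and B[measurable]: "B \<in> sets seq_space"
  shows "(\<integral>\<^sup>+y. indicator B y * emeasure (Coag_law \<alpha> \<theta> y) A \<partial>PD \<alpha> (\<theta> + 1)) =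
    (\<integral>\<^sup>+z. indicator (A \<times> B) (coag_rank z) \<partial>mark_law \<alpha> (1 - \<alpha>) (\<theta> + \<alpha>))"
proof -
  let ?S = "success_law \<alpha> (1 - \<alpha>) (\<theta> + \<alpha>)"
  have pos: "0 < 1 - \<alpha>" "0 < \<theta> + 1 + \<alpha>" using \<alpha> \<theta> by auto
  interpret U: prob_space uniform_seq by (rule prob_space_uniform_seq)
  interpret S: prob_space ?S by (rule prob_space_success_law[OF \<alpha> pos(1) \<theta>])
  have e: "1 - \<alpha> + (\<theta> + \<alpha>) = \<theta> + 1" by simp
  have "(\<integral>\<^sup>+y. indicator B y * emeasure (Coag_law \<alpha> \<theta> y) A \<partial>PD \<alpha> (\<theta> + 1)) =
    (\<integral>\<^sup>+y. indicator B (ranked y) * emeasure (Coag_law \<alpha> \<theta> (ranked y)) A \<partial>GEM \<alpha> (\<theta> + 1))"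
    unfolding Coag_law_eq[OF \<theta>] emeasure_coag_threshold_law[OF A] by (rule nn_integral_PD) measurable
  also have "\<dots> = (\<integral>\<^sup>+y. \<integral>\<^sup>+b. \<integral>\<^sup>+u. indicator (A \<times> B) (coag_rank (y, \<lambda>i. u i < b)) \<partial>uniform_seq \<partial>?S \<partial>GEM \<alpha> (\<theta> + 1))"
  proof (rule nn_integral_cong_AE, use AE_GEM_unit_sequence[OF \<alpha> pos(2)] in eventually_elim)
    case (elim y)
    have [measurable]: "y \<in> space seq_space" by simp
    obtain p where p: "bij p" "ranked y = y \<circ> p" using ranked_bij[OF elim] by blast
    have perm: "(\<integral>\<^sup>+u. indicator A (coag_map (ranked y) (\<lambda>i. u i < b)) \<partial>uniform_seq) =
        (\<integral>\<^sup>+u. indicator A (coag_map y (\<lambda>i. u i < b)) \<partial>uniform_seq)" for b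
    proof -
      have eq: "coag_map (ranked y) (\<lambda>i. (u \<circ> p) i < b) = coag_map y (\<lambda>i. u i < b)" for u
        using coag_map_compose[OF p(1), of y "\<lambda>i. u i < b"] by (simp add: p(2) comp_def)
      have "(\<integral>\<^sup>+u. indicator A (coag_map (ranked y) (\<lambda>i. u i < b)) \<partial>uniform_seq) =
          (\<integral>\<^sup>+u. indicator A (coag_map (ranked y) (\<lambda>i. (u \<circ> p) i < b)) \<partial>uniform_seq)"
        by (rule nn_integral_uniform_seq_permute[OF p(1), symmetric]) measurable
      then show ?thesis unfolding eq .
    qed
    have "indicator B (ranked y) * emeasure (Coag_law \<alpha> \<theta> (ranked y)) A =
        (\<integral>\<^sup>+b. \<integral>\<^sup>+u. indicator B (ranked y) * indicator A (coag_map y (\<lambda>i. u i < b)) \<partial>uniform_seq \<partial>?S)"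
      unfolding Coag_law_eq[OF \<theta>] emeasure_coag_threshold_law[OF A] perm by (simp add: nn_integral_cmult)
    also have "\<dots> = (\<integral>\<^sup>+b. \<integral>\<^sup>+u. indicator (A \<times> B) (coag_rank (y, \<lambda>i. u i < b)) \<partial>uniform_seq \<partial>?S)"
      by (intro nn_integral_cong) (auto simp: coag_rank_def split: split_indicator)
    finally show ?case .
  qed
  also have "\<dots> = (\<integral>\<^sup>+z. indicator (A \<times> B) (coag_rank z) \<partial>mark_law \<alpha> (1 - \<alpha>) (\<theta> + \<alpha>))"
    by (subst nn_integral_mark_law[OF \<alpha> pos(1) \<theta>]) (auto simp: e)
  finally show ?thesis .
qed

text \<open>
  The duality as an equality of the joint laws of \<open>(X, Y)\<close> on measurable rectangles.
\<close>

proposition PD_Frag_law_eq_PD_Coag_law: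
  assumes \<theta>: "0 < \<theta> + \<alpha>" and A[measurable]: "A \<in> sets seq_space" and B[measurable]: "B \<in> sets seq_space"
  shows "(\<integral>\<^sup>+x. indicator A x * emeasure (Frag_law \<alpha> x) B \<partial>PD \<alpha> \<theta>) =
    (\<integral>\<^sup>+y. indicator B y * emeasure (Coag_law \<alpha> \<theta> y) A \<partial>PD \<alpha> (\<theta> + 1))"
proof -
  have pos: "0 < 1 - \<alpha>" using \<alpha> by simp
  let ?N = "seq_space \<Otimes>\<^sub>M seq_space"
  have law: "(\<integral>\<^sup>+z. indicator (A \<times> B) (coag_rank z) \<partial>L) = (\<integral>\<^sup>+w. indicator (A \<times> B) w \<partial>distr L ?N coag_rank)"
    if [measurable_cong]: "sets L = sets marked_space" for L
    by (rule nn_integral_distr[symmetric]) measurable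
  show ?thesis
    unfolding nn_integral_PD_Frag_law[OF \<theta> A B] nn_integral_PD_Coag_law[OF \<theta> A B]
    by (simp only: law sets_split_law sets_mark_law split_law_eq_mark_law[OF \<alpha> pos \<theta>])
qed

end

theorem theorem3p1:
  fixes M :: "'a measure" and X Y :: "'a \<Rightarrow> nat \<Rightarrow> real" and \<alpha> \<theta> :: real
  assumes "0 \<le> \<alpha>" and "\<alpha> < 1" and "\<theta> > - \<alpha>"
    and "prob_space M"
    and "X \<in> M \<rightarrow>\<^sub>M ranked_simplex_space"
    and "Y \<in> M \<rightarrow>\<^sub>M ranked_simplex_space"
  shows "(distr M seq_space X = PD \<alpha> \<theta> \<and>
          regular_conditional_law M ranked_simplex_space X seq_space Y (Frag_law \<alpha>)) \<longleftrightarrow>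
         (distr M seq_space Y = PD \<alpha> (\<theta> + 1) \<and>
          regular_conditional_law M ranked_simplex_space Y seq_space X (Coag_law \<alpha> \<theta>))"
proof -
  note \<alpha> = assms(1,2)
  have \<theta>: "0 < \<theta> + \<alpha>" "0 < \<theta> + 1 + \<alpha>" using assms(3) by auto
  have XY: "X \<in> M \<rightarrow>\<^sub>M seq_space" "Y \<in> M \<rightarrow>\<^sub>M seq_space"
    using assms(5,6) unfolding ranked_simplex_space_def by (auto simp: measurable_restrict_space2_iff)
  show ?thesis
    unfolding
      conditional_law_iff_joint_law[OF assms(4,5) XY(2) measurable_Frag_law[OF \<alpha>] sets_PD AE_PD_ranked_simplex[OF \<alpha> \<theta>(1)]]
      conditional_law_iff_joint_law[OF assms(4,6) XY(1) measurable_Coag_law[OF \<alpha> \<theta>(1)] sets_PD AE_PD_ranked_simplex[OF \<alpha> \<theta>(2)]]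
    using PD_Frag_law_eq_PD_Coag_law[OF \<alpha> \<theta>(1)] by (auto simp: Int_commute Int_left_commute)
qed

end
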